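(* Let $\mathcal A$ be a set and for each $T\geq1$ let $\chi_T:\mathcal A\to[0,\infty)$ be a function such that $\{a\in\mathcal A:\chi_T(a)>0\}$ is finite for every $T\geq1$ and $\lim_{T\to+\infty}\sum_{a\in\mathcal A}\chi_T(a)=+\infty$. Fix any positive constants $\kappa,\lambda_1,\lambda_2,B,K,C,r$ and let $h\in\mathcal D(\kappa,\lambda_1,\lambda_2,B,K)$ be such that \[ \sum_{p\leq x}h(p)=r\log\log x+O(1) \] and such that $h(p^e)\leq C/p^2$ for all primes $p$ and integers $e\geq2$. Fix any $\theta,\xi$ and let $\mathfrak C=(c_a)_{a\in\mathcal A}$ be a sequence of strictly positive integers that is equidistributed with respect to the constants $\theta,\xi,\kappa,\lambda_1,\lambda_2,B,K$, a function $M=M(T)$ and the density function $h$. Assume that there exist $\alpha>0$ and $\widetilde B>0$ such that $\sup\{c_a:a\in\mathcal A,\chi_T(a)>0\}\leq\widetilde B M(T)^\alpha$ for all $T\geq1$. Suppose $\psi:\mathbb N\to\mathbb R$ is an additive function such that there exists some constant $\tilde A\geq1$ with $\psi(n)\leq\tilde A\,\Omega(n)$, and such that for every $\epsilon>0$ there exists $\tilde C\geq0$ with $\psi(n)\leq\epsilon\log n+\tilde C$. Then for every fixed constants $\varepsilon_1\in(0,1)$ and $\varepsilon_2>0$ and all $T,z_2\geq1$ with $r\tilde A(1+\varepsilon_2)\log\log M\leq z_2$ we have \[ \sum_{\substack{a\in\mathcal A\\ \psi(c_a)\geq z_2}}\chi_T(a)\ll M\exp\left(-\frac{\mathfrak c(\varepsilon_2)}{\tilde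 A}z_2\right). \] Further assume that there exists some constant $\tilde A_1>0$ such that \[ \sum_{p\leq x}(1-\varepsilon_1)^{\psi(p)/\tilde A_1}h(p)\leq r(1-\varepsilon_1)\log\log x+O(1); \] then for all $T,z_1\geq1$ \[ \sum_{\substack{a\in\mathcal A\\ \psi(c_a)\leq z_1}}\chi_T(a)\ll M\exp\left(-\frac{\log(1+\varepsilon_1)}{\tilde A_1}\Bigl(r\tilde A_1(1-\varepsilon_1)\log\log M-z_1\Bigr)\right). \] Here $M=M(T)$, $\mathfrak c(\varepsilon)=-\frac{\varepsilon}{1+\varepsilon}+\log(1+\varepsilon)$, and the implied constants depend on $\varepsilon_i,\tilde A,C,\tilde C,\alpha,B,\widetilde B,\theta,\xi,K,\kappa,\lambda_i,\psi$ and the implied constants in the equidistribution estimate for $C_d(T)$, but are independent of $z_i$, $T$ and $M$.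
   Context: $p$ always denotes a prime. $\Omega(n)$ is the number of prime factors of $n$ counted with multiplicity. A function $\psi$ is additive if $\psi(mn)=\psi(m)+\psi(n)$ for coprime $m,n$. Density functions: for $\kappa,\lambda_1,\lambda_2,B,K>0$, $\mathcal D(\kappa,\lambda_1,\lambda_2,B,K)$ is the set of multiplicative functions $h:\mathbb N\to\mathbb R_{\geq0}$ such that (i) for all $B<w<z$, $\prod_{w\leq p<z}(1-h(p))^{-1}\leq\left(\frac{\log z}{\log w}\right)^\kappa\left(1+\frac{K}{\log w}\right)$; (ii) for every prime $p>B$ and integer $e\geq1$, $h(p^e)\leq B/p$; (iii) for every prime $p$ and $e\geq1$, $h(p^e)\leq p^{-e\lambda_1+\lambda_2}$. Equidistribution: for a non-zero integer $d$ and $T\geq1$ let $C_d(T)=\sum_{a\in\mathcal A,\ d\mid c_a}\chi_T(a)$. The sequence $\mathfrak C=(c_a)_{a\in\mathcal A}$ is equidistributed with respect to positive reals $\theta,\xi,\kappa,\lambda_1,\lambda_2,B,K$ with $\max\{\theta,\xi\}<1$, a function $M:\mathbb R_{\geq1}\to\mathbb R_{\geq1}$ and $h\in\mathcal D(\kappa,\lambda_1,\lambda_2,B,K)$ if \[ C_d(T)=h(d)M(T)\Bigl\{1+O\Bigl(\prod_{\substack{B<p\leq M(T)\\ p\nmid d}}(1-h(p))^2\Bigr)\Bigr\}+O(M(T)^{1-\xi}) \] for every $T\geq1$ and every $d\leq M(T)^\theta$, with implied constants independent of $d$ and $T$. Convention: whenever iterated logarithms of a real variable appear, the variable is assumed sufficiently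 large for them to be well-defined.
   Formalization: The second bound also assumes -ψ(n) ≤ DΩ(n) for some D and, for every ε>0, -ψ(n) ≤ ε log n + D_ε; without a lower bound on ψ it is false (ψ very negative at p^e, e≥2). Implied constants also depend on Ã₁ and the O(1) constants in the two prime-sum hypotheses. *)

theory Defs
  imports Complex_Main "HOL-Computational_Algebra.Primes"
begin

text \<open>
  Arithmetic functions on the positive integers are functions on \<^typ>\<open>nat\<close> whose value at 0 is
  irrelevant: every condition below is restricted to positive arguments.
\<close>

definition multiplicative_fun :: "(nat \<Rightarrow> real) \<Rightarrow> bool" where
  "multiplicative_fun h \<longleftrightarrow>
     h 1 = 1 \<and> (\<forall>m n. 1 \<le> m \<longrightarrow> 1 \<le> n \<longrightarrow> coprime m n \<longrightarrow> h (m * n) = h m * h n)"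

definition additive_fun :: "(nat \<Rightarrow> real) \<Rightarrow> bool" where
  "additive_fun \<psi> \<longleftrightarrow>
     (\<forall>m n. 1 \<le> m \<longrightarrow> 1 \<le> n \<longrightarrow> coprime m n \<longrightarrow> \<psi> (m * n) = \<psi> m + \<psi> n)"

definition bigomega :: "nat \<Rightarrow> nat" where
  "bigomega n = size (prime_factorization n)"

text \<open>
  The requirement \<open>1 < w\<close> in the first condition matters only if \<open>B < 1\<close>; there the right-hand side
  is meaningless for \<open>w \<le> 1\<close>.
\<close>

definition density_functions ::
  "real \<Rightarrow> real \<Rightarrow> real \<Rightarrow> real \<Rightarrow> real \<Rightarrow> (nat \<Rightarrow> real) set" where
  "density_functions \<kappa> lam1 lam2 B K = {h.
     multiplicative_fun h \<and>
     (\<forall>n\<ge>1. 0 \<le> h n) \<and>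
     (\<forall>w z. B < w \<longrightarrow> 1 < w \<longrightarrow> w < z \<longrightarrow>
        (\<Prod>p | prime p \<and> w \<le> real p \<and> real p < z. inverse (1 - h p))
          \<le> (ln z / ln w) powr \<kappa> * (1 + K / ln w)) \<and>
     (\<forall>p e. prime p \<longrightarrow> B < real p \<longrightarrow> 1 \<le> e \<longrightarrow> h (p ^ e) \<le> B / real p) \<and>
     (\<forall>p e. prime p \<longrightarrow> 1 \<le> e \<longrightarrow> h (p ^ e) \<le> real p powr (- real e * lam1 + lam2))}"

text \<open>
  Sums of \<open>chi T\<close> over the \<open>a \<in> A\<close> with property \<open>P\<close>. They run over the finite support of \<open>chi T\<close>,
  because \<^const>\<open>sum\<close> over an infinite set is 0.
\<close>

definition chi_sum :: "'a set \<Rightarrow> (real \<Rightarrow> 'a \<Rightarrow> real) \<Rightarrow> real \<Rightarrow> ('a \<Rightarrow> bool) \<Rightarrow> real" where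
  "chi_sum A chi T P = (\<Sum>a | a \<in> A \<and> chi T a > 0 \<and> P a. chi T a)"

definition weight_family :: "'a set \<Rightarrow> (real \<Rightarrow> 'a \<Rightarrow> real) \<Rightarrow> bool" where
  "weight_family A chi \<longleftrightarrow>
     (\<forall>T\<ge>1. \<forall>a\<in>A. 0 \<le> chi T a) \<and>
     (\<forall>T\<ge>1. finite {a \<in> A. chi T a > 0}) \<and>
     filterlim (\<lambda>T. chi_sum A chi T (\<lambda>_. True)) at_top at_top"

text \<open>
  \<open>E1\<close> and \<open>E2\<close> are the two implied constants of the equidistribution estimate; \<open>u\<close> and \<open>v\<close> are its
  two error terms.
\<close>

definition equidistributed ::
  "real \<Rightarrow> real \<Rightarrow> real \<Rightarrow> real \<Rightarrow> real \<Rightarrow> real \<Rightarrow> real \<Rightarrow> real \<Rightarrow> real \<Rightarrow>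
   'a set \<Rightarrow> (real \<Rightarrow> 'a \<Rightarrow> real) \<Rightarrow> ('a \<Rightarrow> nat) \<Rightarrow> (real \<Rightarrow> real) \<Rightarrow> (nat \<Rightarrow> real) \<Rightarrow> bool" where
  "equidistributed E1 E2 \<theta> \<xi> \<kappa> lam1 lam2 B K A chi c M h \<longleftrightarrow>
     0 < \<theta> \<and> 0 < \<xi> \<and> 0 < \<kappa> \<and> 0 < lam1 \<and> 0 < lam2 \<and> 0 < B \<and> 0 < K \<and> max \<theta> \<xi> < 1 \<and>
     (\<forall>T\<ge>1. 1 \<le> M T) \<and>
     h \<in> density_functions \<kappa> lam1 lam2 B K \<and>
     (\<forall>T d. 1 \<le> T \<longrightarrow> 1 \<le> d \<longrightarrow> real d \<le> M T powr \<theta> \<longrightarrow>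
        (\<exists>u v. \<bar>u\<bar> \<le> E1 * (\<Prod>p | prime p \<and> B < real p \<and> real p \<le> M T \<and> \<not> p dvd d. (1 - h p)\<^sup>2) \<and>
               \<bar>v\<bar> \<le> E2 * M T powr (1 - \<xi>) \<and>
               chi_sum A chi T (\<lambda>a. d dvd c a) = h d * M T * (1 + u) + v))"

definition frak_c :: "real \<Rightarrow> real" where
  "frak_c \<epsilon> = - \<epsilon> / (1 + \<epsilon>) + ln (1 + \<epsilon>)"

text \<open>
  A lower bound for \<open>\<psi>\<close>, of the same shape as the upper bounds imposed on \<open>\<psi>\<close> in the theorem. It
  holds trivially if \<open>\<psi>\<close> is nonnegative. The lower-tail estimate is false without some such
  condition: take \<open>c a = a\<close> on the positive integers, \<open>chi T\<close> the indicator of \<open>[1,T]\<close>, \<open>M T = T\<close>,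
  \<open>h n = 1 / n\<close>, and \<open>\<psi>\<close> additive with \<open>\<psi> p = 1\<close> and \<open>\<psi> (p ^ e) = - exp (exp p)\<close> for \<open>e \<ge> 2\<close>. If \<open>p\<close>
  is the least prime with \<open>exp (exp p) \<ge> log 2 T\<close>, then \<open>\<psi> n \<le> 0\<close> for every \<open>n \<le> T\<close> exactly divisible
  by \<open>p ^ 2\<close>, so far too many \<open>n \<le> T\<close> satisfy \<open>\<psi> n \<le> 1\<close>.
\<close>

definition moderate_below :: "(nat \<Rightarrow> real) \<Rightarrow> bool" where
  "moderate_below \<psi> \<longleftrightarrow>
     (\<exists>D. \<forall>n\<ge>1. - \<psi> n \<le> D * real (bigomega n)) \<and>
     (\<forall>\<epsilon>>0. \<exists>D. \<forall>n\<ge>1. - \<psi> n \<le> \<epsilon> * ln (real n) + D)"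

end

theory Submission
  imports Defs "HOL-Library.FuncSet"
begin

text \<open>
  Both tails follow from Chernoff's inequality and the mean value bound
  \<open>\<Sum>a. chi T a * F (c a) \<le> L * M * exp (\<Sum>p\<le>M. (F p - 1) * h p)\<close> for multiplicative \<open>F\<close> of the
  form \<open>exp (s * \<psi> n)\<close>, a bound of Nair--Tenenbaum type. For its proof let \<open>X\<close> be a small power of
  \<open>M\<close> and \<open>w j = M powr (\<tau> / 2 / 2 ^ j)\<close>. If the \<open>w 0\<close>-smooth part of \<open>n\<close> is at most \<open>X\<close>, the rest of \<open>n\<close>
  has boundedly many prime factors; otherwise there is a \<open>j\<close> for which the \<open>w (Suc j)\<close>-smooth part is
  at most \<open>X\<close> but the \<open>w j\<close>-smooth part is not, and then \<open>n\<close> has a divisor between \<open>X powr (1 / 2)\<close> and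
  \<open>X\<close> composed of primes up to \<open>w j\<close>. Such \<open>n\<close> are so rare, by Rankin's trick, that they compensate
  the possible size of \<open>F\<close> on the \<open>w (Suc j)\<close>-rough part. In all cases it remains to sum \<open>F\<close> over smooth
  parts up to \<open>X\<close>: the excess of \<open>F\<close> over \<open>1\<close> is expanded as a divisor sum, and the factors
  \<open>F p < 1\<close> are bounded from above by a Brun--Hooley sieve, which treats them as a weighted sieve
  condition.
\<close>

section \<open>Smooth parts and divisor sums\<close>

text \<open>The exponent must come out exactly: primes with \<open>F p < 1\<close> have to save as
  much as the others cost, since dropping them can lose a power of \<open>ln M\<close>. The
  Brun--Hooley sieve fits because, for any dimension \<kappa>, it loses only a constant while its
  moduli stay below the fourth power of the sieving limit, which may therefore be a fixed power of
  \<open>M\<close>. Three losses remain. Shrinking the prime range from \<open>M\<close> to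
  \<open>w (Suc j)\<close> costs a factor of order \<open>2 powr (j * \<kappa>)\<close>, which the
  gain \<open>exp (- (2 ^ Suc j))\<close> outweighs. Absolute errors save a power of
  \<open>M\<close>, which suffices because the Euler product is at least a negative power of
  \<open>ln M\<close>. Once \<open>w j\<close> is bounded, counting large prime factors gives
  nothing, and the bound of \<psi> by \<epsilon> times the logarithm takes over. So the two growth
  hypotheses have separate tasks: the bound by \<open>bigomega\<close> controls the rough part and
  the primes above \<open>p0\<close>, the logarithmic one the primes up to \<open>p0\<close> and the
  last range. The lower tail is the same moment bound for the negative of \<psi>, hence the shape of
  \<open>moderate_below\<close>. All constants are built from numerical parameters only, which
  yields uniformity in \<open>T\<close>, the sequence and \<open>h\<close>.\<close>

definition primes_in :: "real \<Rightarrow> real \<Rightarrow> nat set" where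
  "primes_in a b = {p. prime p \<and> a < real p \<and> real p \<le> b}"

lemma finite_primes_in [simp]: "finite (primes_in a b)"
proof (rule finite_subset)
  show "primes_in a b \<subseteq> {..nat \<lfloor>b\<rfloor>}"
    by (auto simp: primes_in_def le_nat_iff le_floor_iff)
qed simp

lemma card_primes_in_le:
  assumes "0 \<le> x"
  shows "real (card (primes_in 0 x)) \<le> x"
proof -
  have "primes_in 0 x \<subseteq> {1..nat \<lfloor>x\<rfloor>}" by (auto simp: primes_in_def le_nat_iff le_floor_iff)
  then have "card (primes_in 0 x) \<le> nat \<lfloor>x\<rfloor>"
    using card_mono[of "{1..nat \<lfloor>x\<rfloor>}" "primes_in 0 x"] by simp
  then show ?thesis using assms by linarith
qed

lemma primes_in_prime: "p \<in> primes_in a b \<Longrightarrow> prime p"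
  by (simp add: primes_in_def)

section \<open>Integers as products of prime powers\<close>

lemma prime_power_prod_eq:
  fixes n :: nat
  assumes "0 < n" "finite P" "prime_factors n \<subseteq> P" "\<And>p. p \<in> P \<Longrightarrow> prime p"
  shows "(\<Prod>p\<in>P. p ^ multiplicity p n) = n"
proof -
  have "(\<Prod>p\<in>P. p ^ multiplicity p n) = (\<Prod>p\<in>prime_factors n. p ^ multiplicity p n)"
    using assms
    by (intro prod.mono_neutral_right) (auto simp: prime_factors_multiplicity)
  with assms(1) show ?thesis using prime_factorization_nat by metis
qed

lemma prime_power_prod_pos:
  fixes e :: "nat \<Rightarrow> nat"
  assumes "\<And>p. p \<in> P \<Longrightarrow> prime p"
  shows "0 < (\<Prod>p\<in>P. p ^ e p)"
  using assms by (intro prod_pos) (auto simp: prime_gt_0_nat)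

lemma prime_factors_prime_power_prod:
  fixes e :: "nat \<Rightarrow> nat"
  assumes "finite P" "\<And>p. p \<in> P \<Longrightarrow> prime p"
  shows "prime_factors (\<Prod>p\<in>P. p ^ e p) \<subseteq> P"
  using assms multiplicity_prod_prime_powers[OF assms(1), of _ e]
  by (auto simp: prime_factors_multiplicity split: if_splits)

lemma prime_power_prod_dvd:
  fixes m n :: nat
  assumes "0 < m" "0 < n" "\<And>p. prime p \<Longrightarrow> multiplicity p m \<le> multiplicity p n"
  shows "m dvd n"
  using assms by (intro multiplicity_le_imp_dvd) auto

text \<open>Divisors of a product of prime powers correspond to exponent vectors bounded by
  \<open>e\<close>, which is what multiplying out the left side enumerates. This is a finite Euler
  product.\<close>

lemma sum_divisors_prime_power_prod:
  fixes t :: "nat \<Rightarrow> nat \<Rightarrow> real" and e :: "nat \<Rightarrow> nat"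
  assumes P: "finite P" "\<And>p. p \<in> P \<Longrightarrow> prime p"
  shows "(\<Prod>p\<in>P. \<Sum>k\<le>e p. t p k) =
    (\<Sum>d | d dvd (\<Prod>p\<in>P. p ^ e p). \<Prod>p\<in>P. t p (multiplicity p d))"
proof -
  let ?N = "\<Prod>p\<in>P. p ^ e p"
  have N: "0 < ?N" using P by (intro prime_power_prod_pos)
  have m: "multiplicity p (\<Prod>p\<in>P. p ^ g p) = g p" if "p \<in> P" for p and g :: "nat \<Rightarrow> nat"
    using P that by (simp add: multiplicity_prod_prime_powers)
  have "(\<Prod>p\<in>P. \<Sum>k\<le>e p. t p k) = (\<Sum>g\<in>PiE P (\<lambda>p. {..e p}). \<Prod>p\<in>P. t p (g p))"
    using P by (intro prod_sum_PiE) auto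
  also have "\<dots> = (\<Sum>d | d dvd ?N. \<Prod>p\<in>P. t p (multiplicity p d))"
  proof (rule sum.reindex_bij_witness[where i = "\<lambda>d. \<lambda>p\<in>P. multiplicity p d"
        and j = "\<lambda>g. \<Prod>p\<in>P. p ^ g p"])
    fix g assume g: "g \<in> PiE P (\<lambda>p. {..e p})"
    show "(\<lambda>p\<in>P. multiplicity p (\<Prod>p\<in>P. p ^ g p)) = g"
    proof
      fix x show "(\<lambda>p\<in>P. multiplicity p (\<Prod>p\<in>P. p ^ g p)) x = g x"
        using g m[of x g] PiE_arb[OF g, of x] by (cases "x \<in> P") simp_all
    qed
    show "(\<Prod>p\<in>P. p ^ g p) \<in> {d. d dvd ?N}"
    proof -
      have "(\<Prod>p\<in>P. p ^ g p) dvd ?N"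
        using g by (intro prod_dvd_prod le_imp_power_dvd) (auto simp: PiE_def)
      then show ?thesis by simp
    qed
    show "(\<Prod>p\<in>P. t p (multiplicity p (\<Prod>p\<in>P. p ^ g p))) = (\<Prod>p\<in>P. t p (g p))"
      using m by (intro prod.cong) auto
  next
    fix d assume "d \<in> {d. d dvd ?N}"
    then have d: "d dvd ?N" by simp
    have d0: "0 < d" using d N by (meson dvd_pos_nat)
    have "prime_factors d \<subseteq> P"
      using dvd_prime_factors[OF _ d] N prime_factors_prime_power_prod[OF P, of e] by force
    then have "(\<Prod>p\<in>P. p ^ multiplicity p d) = d"
      using P d0 by (intro prime_power_prod_eq) auto
    then show "(\<Prod>p\<in>P. p ^ (\<lambda>p\<in>P. multiplicity p d) p) = d"
      by (simp cong: prod.cong)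
    have "multiplicity p d \<le> e p" if "p \<in> P" for p
      using dvd_imp_multiplicity_le[OF d, of p] N m[OF that, of e] by simp
    then show "(\<lambda>p\<in>P. multiplicity p d) \<in> PiE P (\<lambda>p. {..e p})" by auto
  qed
  finally show ?thesis .
qed

lemma multiplicative_fun_prime_power_prod:
  assumes h: "multiplicative_fun h" and P: "finite P" "\<And>p. p \<in> P \<Longrightarrow> prime p"
  shows "h (\<Prod>p\<in>P. p ^ e p) = (\<Prod>p\<in>P. h (p ^ e p))"
  using P
proof (induction P rule: finite_induct)
  case empty
  then show ?case using h by (simp add: multiplicative_fun_def)
next
  case (insert q P)
  have "coprime (q ^ e q) (\<Prod>p\<in>P. p ^ e p)"
    using insert by (intro prod_coprime_right) (auto intro!: primes_coprime coprime_power_left_iff[THEN iffD2]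
      simp: coprime_power_left_iff coprime_power_right_iff)
  moreover have "1 \<le> q ^ e q" "1 \<le> (\<Prod>p\<in>P. p ^ e p)"
    using prime_power_prod_pos[of P e] insert by (auto simp: Suc_le_eq prime_gt_0_nat)
  ultimately have "h (q ^ e q * (\<Prod>p\<in>P. p ^ e p)) = h (q ^ e q) * h (\<Prod>p\<in>P. p ^ e p)"
    using h by (simp add: multiplicative_fun_def)
  then show ?case using insert by simp
qed

lemma multiplicative_fun_eq_prod:
  assumes "multiplicative_fun h" "0 < n" "finite P" "prime_factors n \<subseteq> P" "\<And>p. p \<in> P \<Longrightarrow> prime p"
  shows "h n = (\<Prod>p\<in>P. h (p ^ multiplicity p n))"
  using multiplicative_fun_prime_power_prod[OF assms(1,3,5), of "\<lambda>p. multiplicity p n"]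
    prime_power_prod_eq[OF assms(2-5)] by simp

section \<open>Smooth parts\<close>

definition smooth_part :: "real \<Rightarrow> nat \<Rightarrow> nat" where
  "smooth_part w n = (\<Prod>p\<in>primes_in 0 w. p ^ multiplicity p n)"

lemma smooth_part_pos [simp]: "0 < smooth_part w n"
  unfolding smooth_part_def by (intro prime_power_prod_pos) (rule primes_in_prime)

lemma multiplicity_smooth_part:
  "prime p \<Longrightarrow> multiplicity p (smooth_part w n) = (if real p \<le> w then multiplicity p n else 0)"
  unfolding smooth_part_def
  by (subst multiplicity_prod_prime_powers) (simp_all add: primes_in_prime, simp add: primes_in_def prime_gt_0_nat)

lemma smooth_part_dvd: "0 < n \<Longrightarrow> smooth_part w n dvd n"
  by (intro prime_power_prod_dvd) (auto simp: multiplicity_smooth_part)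

lemma smooth_part_dvd_smooth_part: "w \<le> W \<Longrightarrow> smooth_part w n dvd smooth_part W n"
  by (intro prime_power_prod_dvd) (auto simp: multiplicity_smooth_part)

text \<open>Take the largest admissible divisor up to \<open>X\<close>. Its cofactor in the
  \<open>W\<close>-smooth part is not 1, and multiplying by one of its primes, which is at most
  \<open>W\<close>, must overshoot \<open>X\<close>.\<close>

lemma ex_truncated_divisor:
  assumes "1 \<le> w" "w \<le> W" "real (smooth_part w n) \<le> X" "X < real (smooth_part W n)"
  shows "\<exists>D. D dvd smooth_part W n \<and> smooth_part w n dvd D \<and> real D \<le> X \<and> X < real D * W"
proof -
  define S where "S = {D. D dvd smooth_part W n \<and> smooth_part w n dvd D \<and> real D \<le> X}"
  have "finite S" by (rule finite_subset[of _ "{D. D dvd smooth_part W n}"]) (auto simp: S_def)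
  moreover have "smooth_part w n \<in> S"
    using assms by (simp add: S_def smooth_part_dvd_smooth_part)
  ultimately have D: "Max S \<in> S" "\<And>E. E \<in> S \<Longrightarrow> E \<le> Max S"
    by (auto intro: Max_in)
  define D where "D = Max S"
  have D': "D dvd smooth_part W n" "smooth_part w n dvd D" "real D \<le> X"
    using D(1) by (auto simp: S_def D_def)
  obtain k where k: "smooth_part W n = D * k" using D'(1) by (elim dvdE)
  have "0 < D * k" using k smooth_part_pos by metis
  then have "0 < D" "0 < k" by auto
  have "k \<noteq> 1" using k D'(3) assms(4) by auto
  then obtain p where p: "prime p" "p dvd k" using prime_factor_nat by blast
  have "p dvd smooth_part W n" using p k by simp
  then have "0 < multiplicity p (smooth_part W n)"
    using p by (simp add: prime_multiplicity_gt_zero_iff)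
  then have pW: "real p \<le> W" using p by (simp add: multiplicity_smooth_part split: if_splits)
  have "X < real (D * p)"
  proof (rule ccontr)
    assume "\<not> X < real (D * p)"
    then have "D * p \<in> S" using p D' k by (auto simp: S_def intro: dvd_mult2)
    then have "D * p \<le> D * 1" using D(2) by (simp add: D_def)
    then show False using \<open>0 < D\<close> prime_gt_1_nat[OF p(1)] by simp
  qed
  also have "\<dots> \<le> real D * W" using pW \<open>0 < D\<close> by simp
  finally show ?thesis using D' by blast
qed

text \<open>Counted with multiplicity, \<open>n\<close> has at most \<open>ln n / ln w\<close> prime
  factors above \<open>w\<close>, and each costs at most a factor \<open>A0\<close>.\<close>

lemma le_smooth_part_mult:
  fixes F :: "nat \<Rightarrow> real"
  assumes F: "multiplicative_fun F" "\<And>n. 0 < n \<Longrightarrow> 0 \<le> F n"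
    and A0: "1 \<le> A0" "\<And>p k. prime p \<Longrightarrow> F (p ^ k) \<le> A0 ^ k"
    and n: "0 < n" and w: "1 < w"
  shows "F n \<le> F (smooth_part w n) * A0 powr (ln (real n) / ln w)"
proof -
  define U where "U = {p \<in> prime_factors n. w < real p}"
  have U: "finite U" "\<And>p. p \<in> U \<Longrightarrow> prime p" by (auto simp: U_def)
  define V where "V = primes_in 0 w \<union> U"
  have V: "finite V" "\<And>p. p \<in> V \<Longrightarrow> prime p"
    using U by (auto simp: V_def primes_in_prime)
  have V': "prime_factors n \<subseteq> V"
  proof
    fix p assume p: "p \<in> prime_factors n"
    then have "prime p" by auto
    then have "0 < p" by (rule prime_gt_0_nat)
    with p \<open>prime p\<close> show "p \<in> V" by (simp add: V_def primes_in_def U_def) linarith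
  qed
  have disj: "primes_in 0 w \<inter> U = {}" by (auto simp: primes_in_def U_def)
  have eq: "prod f V = prod f (primes_in 0 w) * prod f U" for f :: "nat \<Rightarrow> 'b :: comm_monoid_mult"
    unfolding V_def using disj U by (intro prod.union_disjoint) auto
  have "F n = (\<Prod>p\<in>V. F (p ^ multiplicity p n))"
    using F(1) n V V' by (intro multiplicative_fun_eq_prod) auto
  also have "\<dots> = F (smooth_part w n) * (\<Prod>p\<in>U. F (p ^ multiplicity p n))"
    unfolding smooth_part_def
    by (subst multiplicative_fun_prime_power_prod[OF F(1)]) (simp_all add: primes_in_prime eq)
  also have "\<dots> \<le> F (smooth_part w n) * A0 powr (ln (real n) / ln w)"
  proof (rule mult_left_mono)
    define k where "k = (\<Sum>p\<in>U. multiplicity p n)"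
    have "(\<Prod>p\<in>U. F (p ^ multiplicity p n)) \<le> (\<Prod>p\<in>U. A0 ^ multiplicity p n)"
      using A0 F(2) U by (intro prod_mono) (auto simp: prime_gt_0_nat)
    also have "\<dots> = A0 ^ k" by (simp add: k_def power_sum)
    also have "\<dots> = A0 powr real k" using A0 by (simp add: powr_realpow)
    also have "\<dots> \<le> A0 powr (ln (real n) / ln w)"
    proof (rule powr_mono)
      have "w ^ k = (\<Prod>p\<in>U. w ^ multiplicity p n)" by (simp add: k_def power_sum)
      also have "\<dots> \<le> (\<Prod>p\<in>U. real p ^ multiplicity p n)"
        using w by (intro prod_mono) (auto simp: U_def intro!: power_mono)
      also have "\<dots> = real (\<Prod>p\<in>U. p ^ multiplicity p n)" by simp
      also have "\<dots> \<le> real n"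
      proof -
        have "n = (\<Prod>p\<in>V. p ^ multiplicity p n)"
          using prime_power_prod_eq[OF n V(1) V' V(2)] by simp
        then have "(\<Prod>p\<in>U. p ^ multiplicity p n) dvd n"
          by (metis dvd_triv_right eq)
        then show ?thesis using n by (simp add: dvd_imp_le del: of_nat_prod)
      qed
      finally have "ln (w ^ k) \<le> ln (real n)" using w n by (subst ln_le_cancel_iff) auto
      then show "real k \<le> ln (real n) / ln w" using w by (simp add: ln_realpow field_simps)
    qed (use A0 in auto)
    finally show "(\<Prod>p\<in>U. F (p ^ multiplicity p n)) \<le> A0 powr (ln (real n) / ln w)" .
  qed (use F in auto)
  finally show ?thesis .
qed

section \<open>The Brun--Hooley sieve\<close>

definition trunc_sum :: "nat \<Rightarrow> 'a set \<Rightarrow> ('a \<Rightarrow> real) \<Rightarrow> real" where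
  "trunc_sum b U y = (\<Sum>S | S \<subseteq> U \<and> card S \<le> b. \<Prod>p\<in>S. - y p)"

lemma trunc_sum_0:
  assumes "finite U"
  shows "trunc_sum 0 U y = 1"
proof -
  have "{S. S \<subseteq> U \<and> card S \<le> 0} = {{}}"
    using assms by (auto simp: card_eq_0_iff dest: finite_subset)
  then show ?thesis by (simp add: trunc_sum_def)
qed

lemma trunc_sum_empty: "trunc_sum b {} y = 1"
  by (simp add: trunc_sum_def cong: conj_cong)

text \<open>The condition on the cardinality is an arbitrary \<open>Q\<close>, so that one splitting
  serves both for truncated sums and for elementary symmetric functions.\<close>

lemma sum_subsets_insert:
  fixes f :: "'a set \<Rightarrow> real"
  assumes "finite U" "q \<notin> U"
  shows "(\<Sum>S | S \<subseteq> insert q U \<and> Q (card S). f S) =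
    (\<Sum>S | S \<subseteq> U \<and> Q (card S). f S) + (\<Sum>S | S \<subseteq> U \<and> Q (Suc (card S)). f (insert q S))"
proof -
  let ?A = "{S. S \<subseteq> U \<and> Q (card S)}" and ?B = "{S. S \<subseteq> U \<and> Q (Suc (card S))}"
  have fin: "finite ?A" "finite ?B"
    using assms by (auto intro: finite_subset[of _ "Pow U"])
  have card: "card (insert q S) = Suc (card S)" if "S \<subseteq> U" for S
    using that assms finite_subset by (metis card_insert_disjoint subsetD)
  have "{S. S \<subseteq> insert q U \<and> Q (card S)} = ?A \<union> insert q ` ?B"
  proof (intro equalityI subsetI)
    fix S assume S: "S \<in> {S. S \<subseteq> insert q U \<and> Q (card S)}"
    show "S \<in> ?A \<union> insert q ` ?B"
    proof (cases "q \<in> S")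
      case True
      then have "S = insert q (S - {q})" "S - {q} \<subseteq> U" using S by auto
      then show ?thesis using S card[of "S - {q}"] by (auto intro!: image_eqI[of _ _ "S - {q}"])
    qed (use S in auto)
  qed (use card in auto)
  moreover have "?A \<inter> insert q ` ?B = {}" using assms by auto
  moreover have "inj_on (insert q) ?B" using assms by (auto simp: inj_on_def)
  ultimately show ?thesis using fin by (simp add: sum.union_disjoint sum.reindex)
qed

lemma prod_insert_subset:
  fixes f :: "'a \<Rightarrow> real"
  assumes "finite U" "q \<notin> U" "S \<subseteq> U"
  shows "prod f (insert q S) = f q * prod f S"
  using assms finite_subset by (metis prod.insert subsetD)

lemma trunc_sum_insert:
  assumes "finite U" "q \<notin> U"
  shows "trunc_sum (Suc b) (insert q U) y = trunc_sum (Suc b) U y - y q * trunc_sum b U y"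
  unfolding trunc_sum_def sum_subsets_insert[OF assms, where Q = "\<lambda>c. c \<le> Suc b"]
  using prod_insert_subset[OF assms, of _ "\<lambda>p. - y p"]
  by (simp add: sum_distrib_left sum_negf)

text \<open>By the recursion \<open>trunc_sum_insert\<close>, the error at level
  \<open>Suc c\<close> is the old error at that level minus \<open>y q\<close> times the error at
  level \<open>c\<close>. These have opposite signs by induction, so they reinforce each
  other.\<close>

lemma bonferroni:
  assumes "finite U" "\<And>p. p \<in> U \<Longrightarrow> 0 \<le> y p" "\<And>p. p \<in> U \<Longrightarrow> y p \<le> 1"
  shows "(even b \<longrightarrow> (\<Prod>p\<in>U. 1 - y p) \<le> trunc_sum b U y) \<and>
    (odd b \<longrightarrow> trunc_sum b U y \<le> (\<Prod>p\<in>U. 1 - y p))"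
  using assms
proof (induction U arbitrary: b rule: finite_induct)
  case empty
  then show ?case by (simp add: trunc_sum_empty)
next
  case (insert q U)
  let ?\<Pi> = "\<Prod>p\<in>U. 1 - y p"
  have IH: "even b \<Longrightarrow> ?\<Pi> \<le> trunc_sum b U y" "odd b \<Longrightarrow> trunc_sum b U y \<le> ?\<Pi>" for b
    using insert by auto
  have y: "0 \<le> y q" using insert by auto
  have prod: "(\<Prod>p\<in>insert q U. 1 - y p) = ?\<Pi> - y q * ?\<Pi>"
    using insert by (simp add: algebra_simps)
  show ?case
  proof (cases b)
    case 0
    have "(\<Prod>p\<in>insert q U. 1 - y p) \<le> 1" using insert by (intro prod_le_1) auto
    then show ?thesis using 0 insert by (simp add: trunc_sum_0)
  next
    case (Suc c)
    show ?thesis unfolding Suc prod trunc_sum_insert[OF insert(1,2)]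
      using IH[of c] IH[of "Suc c"] mult_left_mono[OF _ y, of ?\<Pi> "trunc_sum c U y"]
        mult_left_mono[OF _ y, of "trunc_sum c U y" ?\<Pi>]
      by (cases "even c") fastforce+
  qed
qed

text \<open>The left side is the \<open>m\<close>-th elementary symmetric function, each of whose
  monomials occurs \<open>fact m\<close> times in the \<open>m\<close>-th power of the sum.\<close>

lemma sum_subsets_card_le:
  fixes y :: "'a \<Rightarrow> real"
  assumes "finite U" "\<And>p. p \<in> U \<Longrightarrow> 0 \<le> y p"
  shows "(\<Sum>S | S \<subseteq> U \<and> card S = m. \<Prod>p\<in>S. y p) \<le> (\<Sum>p\<in>U. y p) ^ m / fact m"
  using assms
proof (induction U arbitrary: m rule: finite_induct)
  case empty
  show ?case by (cases "m = 0") (simp_all cong: conj_cong)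
next
  case (insert q U)
  let ?s = "\<Sum>p\<in>U. y p"
  have s: "0 \<le> ?s" and y: "0 \<le> y q" using insert by (auto intro: sum_nonneg)
  have IH: "(\<Sum>S | S \<subseteq> U \<and> card S = m. \<Prod>p\<in>S. y p) \<le> ?s ^ m / fact m" for m
    using insert by auto
  show ?case
  proof (cases m)
    case 0
    have "{S. S \<subseteq> insert q U \<and> card S = 0} = {{}}"
      using insert(1) by (auto simp: card_eq_0_iff dest: finite_subset)
    then show ?thesis using 0 by simp
  next
    case (Suc k)
    have "(\<Sum>S | S \<subseteq> insert q U \<and> card S = m. \<Prod>p\<in>S. y p) =
      (\<Sum>S | S \<subseteq> U \<and> card S = Suc k. \<Prod>p\<in>S. y p) + y q * (\<Sum>S | S \<subseteq> U \<and> card S = k. \<Prod>p\<in>S. y p)"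
      unfolding Suc sum_subsets_insert[OF insert(1,2), where Q = "\<lambda>c. c = Suc k"]
      using prod_insert_subset[OF insert(1,2), of _ y] by (simp add: sum_distrib_left)
    also have "\<dots> \<le> ?s ^ Suc k / fact (Suc k) + y q * (?s ^ k / fact k)"
      by (intro add_mono mult_left_mono IH y)
    also have "\<dots> = (?s ^ Suc k + real (Suc k) * ?s ^ k * y q) / fact (Suc k)"
    proof -
      have "real (Suc k) * ?s ^ k * y q / fact (Suc k) = (real (Suc k) * (?s ^ k * y q)) / (real (Suc k) * fact k)"
        by (simp only: fact_Suc mult.assoc)
      also have "\<dots> = y q * (?s ^ k / fact k)" by simp
      finally show ?thesis by (simp only: add_divide_distrib)
    qed
    also have "\<dots> \<le> (?s + y q) ^ Suc k / fact (Suc k)"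
    proof (rule divide_right_mono)
      \<comment> \<open>The left side consists of the first two terms of the binomial
        expansion.\<close>
      have "?s ^ Suc k + real (Suc k) * ?s ^ k * y q \<le> (?s + y q) ^ Suc k"
      proof (induction k)
        case (Suc k)
        have "?s ^ Suc (Suc k) + real (Suc (Suc k)) * ?s ^ Suc k * y q
            \<le> (?s + y q) * (?s ^ Suc k + real (Suc k) * ?s ^ k * y q)"
          using s y by (simp add: algebra_simps)
        also have "\<dots> \<le> (?s + y q) * (?s + y q) ^ Suc k"
          using Suc s y by (intro mult_left_mono) auto
        finally show ?case by simp
      qed simp
      then show "?s ^ Suc k + real (Suc k) * ?s ^ k * y q \<le> (?s + y q) ^ Suc k" .
    qed simp
    finally show ?thesis using insert Suc by (simp add: add.commute)
  qed
qed

text \<open>The next partial sum already lies below the product, so the excess is at most the first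
  omitted term of the expansion.\<close>

lemma trunc_sum_le:
  assumes U: "finite U" and y: "\<And>p. p \<in> U \<Longrightarrow> 0 \<le> y p" "\<And>p. p \<in> U \<Longrightarrow> y p \<le> 1"
  shows "trunc_sum (2 * b) U y \<le> (\<Prod>p\<in>U. 1 - y p) + (\<Sum>p\<in>U. y p) ^ (2 * b + 1) / fact (2 * b + 1)"
proof -
  have fin: "finite {S. S \<subseteq> U \<and> Q S}" for Q
    using U by (auto intro: finite_subset[of _ "Pow U"])
  have set: "{S. S \<subseteq> U \<and> card S \<le> Suc (2 * b)} =
      {S. S \<subseteq> U \<and> card S \<le> 2 * b} \<union> {S. S \<subseteq> U \<and> card S = 2 * b + 1}" by auto
  have "trunc_sum (Suc (2 * b)) U y = trunc_sum (2 * b) U y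
      + (\<Sum>S | S \<subseteq> U \<and> card S = 2 * b + 1. \<Prod>p\<in>S. - y p)"
    unfolding trunc_sum_def set by (intro sum.union_disjoint fin) auto
  also have "(\<Sum>S | S \<subseteq> U \<and> card S = 2 * b + 1. \<Prod>p\<in>S. - y p)
      = - (\<Sum>S | S \<subseteq> U \<and> card S = 2 * b + 1. \<Prod>p\<in>S. y p)"
    unfolding sum_negf[symmetric] by (intro sum.cong refl) (auto simp: prod_uminus)
  finally show ?thesis
    using bonferroni[OF U, of y "Suc (2 * b)"] y sum_subsets_card_le[OF U, of y "2 * b + 1"] by simp
qed

lemma exp_minus_le_one_minus:
  fixes y :: real
  assumes "0 \<le> y" "y \<le> 1 / 2"
  shows "exp (- 2 * y) \<le> 1 - y"
proof -
  have "0 \<le> y * (1 - 2 * y)" using assms by (intro mult_nonneg_nonneg) auto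
  then have "1 \<le> (1 - y) * (1 + 2 * y)" by (simp add: algebra_simps)
  also have "\<dots> \<le> (1 - y) * exp (2 * y)" using assms by (intro mult_left_mono) auto
  finally show ?thesis by (simp add: exp_minus field_simps)
qed

text \<open>Because \<open>y p \<le> 1 / 2\<close>, the full product is at least
  \<open>exp (- 2 * L)\<close>. The additive error of \<open>trunc_sum_le\<close> thus becomes a
  relative one, which can be multiplied over blocks.\<close>

lemma trunc_sum_le_mult_exp:
  assumes U: "finite U" and y: "\<And>p. p \<in> U \<Longrightarrow> 0 \<le> y p" "\<And>p. p \<in> U \<Longrightarrow> y p \<le> 1 / 2"
    and L: "(\<Sum>p\<in>U. y p) \<le> L"
  shows "trunc_sum (2 * b) U y
    \<le> (\<Prod>p\<in>U. 1 - y p) * exp (exp (2 * L) * (L ^ (2 * b + 1) / fact (2 * b + 1)))"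
proof -
  let ?\<Pi> = "\<Prod>p\<in>U. 1 - y p" and ?s = "\<Sum>p\<in>U. y p" and ?q = "L ^ (2 * b + 1) / fact (2 * b + 1)"
  have s: "0 \<le> ?s" using y by (intro sum_nonneg) auto
  have q: "0 \<le> ?q" using s L by simp
  have "exp (- 2 * L) \<le> exp (- 2 * ?s)" using L by simp
  also have "\<dots> = (\<Prod>p\<in>U. exp (- 2 * y p))" using U by (simp add: exp_sum sum_distrib_left)
  also have "\<dots> \<le> ?\<Pi>" using y exp_minus_le_one_minus by (intro prod_mono) auto
  finally have \<Pi>: "1 \<le> ?\<Pi> * exp (2 * L)" by (simp add: exp_minus field_simps)
  have "trunc_sum (2 * b) U y \<le> ?\<Pi> + ?s ^ (2 * b + 1) / fact (2 * b + 1)"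
    using U y by (intro trunc_sum_le) force+
  also have "\<dots> \<le> ?\<Pi> + ?q"
    using s L by (intro add_left_mono divide_right_mono power_mono) auto
  also have "\<dots> \<le> ?\<Pi> + (?\<Pi> * exp (2 * L)) * ?q"
    using mult_right_mono[OF \<Pi> q] by simp
  also have "\<dots> = ?\<Pi> * (1 + exp (2 * L) * ?q)" by (simp add: algebra_simps)
  also have "\<dots> \<le> ?\<Pi> * exp (exp (2 * L) * ?q)"
    using y by (intro mult_left_mono prod_nonneg) force+
  finally show ?thesis .
qed

text \<open>
  The blocks are the fibres of \<open>\<iota>\<close>. Truncating at an even number of elements in each block keeps
  every block factor nonnegative and above the full product, so the product of the truncations is
  an upper bound sieve.
\<close>

definition brun_hooley_sets :: "('a \<Rightarrow> nat) \<Rightarrow> 'a set \<Rightarrow> 'a set set" where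
  "brun_hooley_sets \<iota> U = {S. S \<subseteq> U \<and> (\<forall>i. card {p \<in> S. \<iota> p = i} \<le> 2 * i)}"

lemma finite_brun_hooley_sets: "finite U \<Longrightarrow> finite (brun_hooley_sets \<iota> U)"
  unfolding brun_hooley_sets_def by (rule finite_subset[of _ "Pow U"]) auto

text \<open>Membership in \<open>brun_hooley_sets\<close> is decided in each block separately, so
  the sum factors over the blocks; the induction splits off the last one.\<close>

lemma sum_brun_hooley_sets:
  assumes "finite U" "\<And>p. p \<in> U \<Longrightarrow> \<iota> p < I"
  shows "(\<Sum>S\<in>brun_hooley_sets \<iota> U. \<Prod>p\<in>S. - y p) = (\<Prod>i<I. trunc_sum (2 * i) {p \<in> U. \<iota> p = i} y)"
  using assms
proof (induction I arbitrary: U)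
  case 0
  then have "brun_hooley_sets \<iota> U = {{}}" by (auto simp: brun_hooley_sets_def)
  then show ?case by simp
next
  case (Suc I)
  define U' where "U' = {p \<in> U. \<iota> p < I}"
  define V where "V = {p \<in> U. \<iota> p = I}"
  have U: "U = U' \<union> V" "U' \<inter> V = {}" using Suc.prems by (force simp: U'_def V_def)+
  have fin: "finite U'" "finite V" using Suc.prems by (auto simp: U'_def V_def)
  let ?T = "{S. S \<subseteq> V \<and> card S \<le> 2 * I}" and ?f = "\<lambda>S. \<Prod>p\<in>S. - y p"
  have "(\<Sum>S\<in>brun_hooley_sets \<iota> U. ?f S) = (\<Sum>(S, S')\<in>brun_hooley_sets \<iota> U' \<times> ?T. ?f S * ?f S')"
  proof (rule sum.reindex_bij_witness[where j = "\<lambda>S. (S \<inter> U', S \<inter> V)" and i = "\<lambda>(S, S'). S \<union> S'"])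
    fix S assume S: "S \<in> brun_hooley_sets \<iota> U"
    then have SU: "S \<subseteq> U" by (simp add: brun_hooley_sets_def)
    then have "finite S" using Suc.prems finite_subset by blast
    show "(case (S \<inter> U', S \<inter> V) of (S, S') \<Rightarrow> S \<union> S') = S" using SU U by auto
    have "card {p \<in> S \<inter> U'. \<iota> p = i} \<le> 2 * i" for i
    proof -
      have "card {p \<in> S \<inter> U'. \<iota> p = i} \<le> card {p \<in> S. \<iota> p = i}"
        using \<open>finite S\<close> by (intro card_mono) auto
      also have "\<dots> \<le> 2 * i" using S by (simp add: brun_hooley_sets_def)
      finally show ?thesis .
    qed
    moreover have "S \<inter> V = {p \<in> S. \<iota> p = I}" using SU by (auto simp: V_def)
    then have "card (S \<inter> V) \<le> 2 * I" using S by (simp add: brun_hooley_sets_def)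
    ultimately show "(S \<inter> U', S \<inter> V) \<in> brun_hooley_sets \<iota> U' \<times> ?T"
      by (auto simp: brun_hooley_sets_def)
    have "?f ((S \<inter> U') \<union> (S \<inter> V)) = ?f (S \<inter> U') * ?f (S \<inter> V)"
      using U \<open>finite S\<close> by (intro prod.union_disjoint) auto
    moreover have "(S \<inter> U') \<union> (S \<inter> V) = S" using SU U by auto
    ultimately show "(case (S \<inter> U', S \<inter> V) of (S, S') \<Rightarrow> ?f S * ?f S') = ?f S" by simp
  next
    fix P assume "P \<in> brun_hooley_sets \<iota> U' \<times> ?T"
    then obtain S S' where P: "P = (S, S')" and S: "S \<in> brun_hooley_sets \<iota> U'" "S' \<subseteq> V" "card S' \<le> 2 * I"
      by auto
    then have SU: "S \<subseteq> U'" by (simp add: brun_hooley_sets_def)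
    show "(\<lambda>S. (S \<inter> U', S \<inter> V)) (case P of (S, S') \<Rightarrow> S \<union> S') = P"
      using P SU S U by auto
    have "card {p \<in> S \<union> S'. \<iota> p = i} \<le> 2 * i" for i
    proof (cases "i = I")
      case True
      then have "{p \<in> S \<union> S'. \<iota> p = i} = S'" using SU S by (auto simp: U'_def V_def)
      then show ?thesis using S True by simp
    next
      case False
      then have "{p \<in> S \<union> S'. \<iota> p = i} = {p \<in> S. \<iota> p = i}" using SU S by (auto simp: U'_def V_def)
      then show ?thesis using S by (simp add: brun_hooley_sets_def)
    qed
    then show "(case P of (S, S') \<Rightarrow> S \<union> S') \<in> brun_hooley_sets \<iota> U"
      using P SU S U by (auto simp: brun_hooley_sets_def)
  qed
  also have "\<dots> = (\<Sum>S\<in>brun_hooley_sets \<iota> U'. ?f S) * trunc_sum (2 * I) V y"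
    by (simp add: trunc_sum_def sum_product sum.cartesian_product)
  also have "(\<Sum>S\<in>brun_hooley_sets \<iota> U'. ?f S) = (\<Prod>i<I. trunc_sum (2 * i) {p \<in> U'. \<iota> p = i} y)"
    using fin by (intro Suc.IH) (auto simp: U'_def)
  also have "\<dots> = (\<Prod>i<I. trunc_sum (2 * i) {p \<in> U. \<iota> p = i} y)"
    by (intro prod.cong refl arg_cong2[where f = "\<lambda>A. trunc_sum A"] arg_cong[where f = "\<lambda>U. trunc_sum _ U y"])
      (auto simp: U'_def)
  finally show ?case by (simp add: V_def)
qed

lemma prod_blocks:
  fixes f :: "'a \<Rightarrow> real"
  assumes "finite U" "\<And>p. p \<in> U \<Longrightarrow> \<iota> p < (I :: nat)"
  shows "(\<Prod>i<I. \<Prod>p | p \<in> U \<and> \<iota> p = i. f p) = prod f U"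
  using assms by (intro prod.group) auto

lemma sum_blocks:
  fixes f :: "'a \<Rightarrow> real"
  assumes "finite U" "\<And>p. p \<in> U \<Longrightarrow> \<iota> p < (I :: nat)"
  shows "(\<Sum>i<I. \<Sum>p | p \<in> U \<and> \<iota> p = i. f p) = sum f U"
  using assms by (intro sum.group) auto

text \<open>Used for the primes dividing a single integer, where it is the pointwise sieve
  inequality. \<open>brun_hooley_upper\<close> evaluates the same kind of sum on average, with
  densities in place of the weights.\<close>

lemma brun_hooley_lower:
  fixes y :: "'a \<Rightarrow> real"
  assumes U: "finite U" and y: "\<And>p. p \<in> U \<Longrightarrow> 0 \<le> y p" "\<And>p. p \<in> U \<Longrightarrow> y p \<le> 1"
  shows "(\<Prod>p\<in>U. 1 - y p) \<le> (\<Sum>S\<in>brun_hooley_sets \<iota> U. \<Prod>p\<in>S. - y p)"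
proof -
  \<comment> \<open>The inserted 0 keeps \<open>Max\<close> meaningful if \<open>U\<close> is
    empty.\<close>
  define I where "I = Suc (Max (insert 0 (\<iota> ` U)))"
  have I: "\<iota> p < I" if "p \<in> U" for p using that U by (auto simp: I_def less_Suc_eq_le intro!: Max_ge)
  have "(\<Prod>p\<in>U. 1 - y p) = (\<Prod>i<I. \<Prod>p | p \<in> U \<and> \<iota> p = i. 1 - y p)"
    using prod_blocks[of U \<iota> I "\<lambda>p. 1 - y p"] U I by simp
  also have "\<dots> \<le> (\<Prod>i<I. trunc_sum (2 * i) {p \<in> U. \<iota> p = i} y)"
  proof (rule prod_mono)
    fix i assume "i \<in> {..<I}"
    show "0 \<le> (\<Prod>p | p \<in> U \<and> \<iota> p = i. 1 - y p) \<and>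
        (\<Prod>p | p \<in> U \<and> \<iota> p = i. 1 - y p) \<le> trunc_sum (2 * i) {p \<in> U. \<iota> p = i} y"
      using bonferroni[of "{p \<in> U. \<iota> p = i}" y "2 * i"] U y by (auto intro!: prod_nonneg)
  qed
  also have "\<dots> = (\<Sum>S\<in>brun_hooley_sets \<iota> U. \<Prod>p\<in>S. - y p)"
    using sum_brun_hooley_sets[of U \<iota> I y] U I by simp
  finally show ?thesis .
qed

lemma sum_odd_terms_le_exp:
  fixes L :: real
  assumes "0 \<le> L"
  shows "(\<Sum>i<I. L ^ (2 * i + 1) / fact (2 * i + 1)) \<le> exp L"
proof -
  have sums: "(\<lambda>n. L ^ n / fact n) sums exp L"
    using exp_converges[of L] by (simp add: divide_inverse mult.commute)
  have "(\<Sum>i<I. L ^ (2 * i + 1) / fact (2 * i + 1)) = (\<Sum>n\<in>(\<lambda>i. 2 * i + 1) ` {..<I}. L ^ n / fact n)"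
    by (subst sum.reindex) (auto simp: inj_on_def)
  also have "\<dots> \<le> (\<Sum>n. L ^ n / fact n)"
    using assms sums by (intro sum_le_suminf) (auto simp: sums_iff)
  also have "\<dots> = exp L" using sums by (simp add: sums_iff)
  finally show ?thesis .
qed

text \<open>The truncation level grows with the block index while the mass \<open>L\<close> per
  block does not. The relative errors are therefore distinct odd terms of the series of
  \<open>exp L\<close>, and their product over all blocks stays bounded.\<close>

lemma brun_hooley_upper:
  fixes y :: "'a \<Rightarrow> real"
  assumes U: "finite U" and y: "\<And>p. p \<in> U \<Longrightarrow> 0 \<le> y p" "\<And>p. p \<in> U \<Longrightarrow> y p \<le> 1 / 2"
    and L: "0 \<le> L" "\<And>i. (\<Sum>p | p \<in> U \<and> \<iota> p = i. y p) \<le> L"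
  shows "(\<Sum>S\<in>brun_hooley_sets \<iota> U. \<Prod>p\<in>S. - y p) \<le> exp (exp (3 * L)) * (\<Prod>p\<in>U. 1 - y p)"
proof -
  define I where "I = Suc (Max (insert 0 (\<iota> ` U)))"
  have I: "\<iota> p < I" if "p \<in> U" for p using that U by (auto simp: I_def less_Suc_eq_le intro!: Max_ge)
  have "(\<Sum>S\<in>brun_hooley_sets \<iota> U. \<Prod>p\<in>S. - y p) = (\<Prod>i<I. trunc_sum (2 * i) {p \<in> U. \<iota> p = i} y)"
    using sum_brun_hooley_sets[of U \<iota> I y] U I by simp
  also have "\<dots> \<le> (\<Prod>i<I. (\<Prod>p | p \<in> U \<and> \<iota> p = i. 1 - y p) *
      exp (exp (2 * L) * (L ^ (2 * i + 1) / fact (2 * i + 1))))"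
  proof (rule prod_mono)
    fix i assume "i \<in> {..<I}"
    have y1: "y p \<le> 1" if "p \<in> U" for p using y(2)[OF that] by simp
    have "0 \<le> (\<Prod>p | p \<in> U \<and> \<iota> p = i. 1 - y p)" using y1 by (auto intro!: prod_nonneg)
    also have "\<dots> \<le> trunc_sum (2 * i) {p \<in> U. \<iota> p = i} y"
      using bonferroni[of "{p \<in> U. \<iota> p = i}" y "2 * i"] U y(1) y1 by auto
    finally have "0 \<le> trunc_sum (2 * i) {p \<in> U. \<iota> p = i} y" .
    moreover have "trunc_sum (2 * i) {p \<in> U. \<iota> p = i} y \<le> (\<Prod>p | p \<in> U \<and> \<iota> p = i. 1 - y p) *
      exp (exp (2 * L) * (L ^ (2 * i + 1) / fact (2 * i + 1)))"
      using U y L by (intro trunc_sum_le_mult_exp) auto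
    ultimately show "0 \<le> trunc_sum (2 * i) {p \<in> U. \<iota> p = i} y \<and>
      trunc_sum (2 * i) {p \<in> U. \<iota> p = i} y \<le> (\<Prod>p | p \<in> U \<and> \<iota> p = i. 1 - y p) *
      exp (exp (2 * L) * (L ^ (2 * i + 1) / fact (2 * i + 1)))" by simp
  qed
  also have "\<dots> = (\<Prod>p\<in>U. 1 - y p) *
      exp (exp (2 * L) * (\<Sum>i<I. L ^ (2 * i + 1) / fact (2 * i + 1)))"
    unfolding prod.distrib sum_distrib_left exp_sum[OF finite_lessThan]
    using prod_blocks[of U \<iota> I "\<lambda>p. 1 - y p"] U I by simp
  also have "\<dots> \<le> (\<Prod>p\<in>U. 1 - y p) * exp (exp (2 * L) * exp L)"
  proof (intro mult_left_mono prod_nonneg)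
    show "exp (exp (2 * L) * (\<Sum>i<I. L ^ (2 * i + 1) / fact (2 * i + 1))) \<le> exp (exp (2 * L) * exp L)"
      using sum_odd_terms_le_exp[OF L(1), of I] by simp
  qed (use y in force)
  also have "exp (2 * L) * exp L = exp (3 * L)" by (simp flip: exp_add)
  finally show ?thesis by (simp add: mult.commute)
qed

section \<open>Density functions\<close>

lemma sum_inverse_squares_le:
  assumes "finite A" "\<And>p. p \<in> A \<Longrightarrow> prime p"
  shows "(\<Sum>p\<in>A. 1 / (real p)\<^sup>2) \<le> 2"
proof -
  have *: "(\<Sum>n=1..Suc N. 1 / (real n)\<^sup>2) \<le> 2 - 1 / real (Suc N)" for N
  proof (induction N)
    case (Suc N)
    have "1 / (real (Suc (Suc N)))\<^sup>2 \<le> 1 / (real (Suc N) * real (Suc (Suc N)))"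
      unfolding power2_eq_square by (intro divide_left_mono mult_right_mono) auto
    also have "\<dots> = 1 / real (Suc N) - 1 / real (Suc (Suc N))" by (simp add: field_simps)
    finally show ?case using Suc by simp
  qed simp
  define N where "N = Max (insert 0 A)"
  have "(\<Sum>p\<in>A. 1 / (real p)\<^sup>2) \<le> (\<Sum>n=1..Suc N. 1 / (real n)\<^sup>2)"
  proof (rule sum_mono2)
    show "A \<subseteq> {1..Suc N}"
    proof
      fix p assume p: "p \<in> A"
      then have "p \<le> N" using assms(1) by (auto simp: N_def intro!: Max_ge)
      then show "p \<in> {1..Suc N}" using prime_ge_1_nat[OF assms(2)[OF p]] by simp
    qed
  qed auto
  also have "\<dots> \<le> 2" using *[of N] by (rule order_trans) simp
  finally show ?thesis .
qed

text \<open>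
  \<open>log_index w p = i\<close> means \<open>w powr (1 / 2 ^ Suc i) < p \<le> w powr (1 / 2 ^ i)\<close>.
\<close>

definition log_index :: "real \<Rightarrow> nat \<Rightarrow> nat" where
  "log_index w p = nat \<lfloor>log 2 (ln w / ln (real p))\<rfloor>"

lemma log_index_bounds:
  assumes "1 < real p" "real p \<le> w"
  shows "2 ^ log_index w p * ln (real p) \<le> ln w" "ln w < 2 ^ Suc (log_index w p) * ln (real p)"
proof -
  let ?q = "ln w / ln (real p)"
  have p: "0 < ln (real p)" using assms by simp
  have q: "1 \<le> ?q" using assms p by (simp add: field_simps)
  then have l: "0 \<le> log 2 ?q" by (simp add: zero_le_log_cancel_iff)
  then have i: "real (log_index w p) \<le> log 2 ?q" "log 2 ?q < real (log_index w p) + 1"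
    unfolding log_index_def by linarith+
  have "2 powr real (log_index w p) \<le> ?q" using i(1) q by (simp add: le_log_iff)
  then show "2 ^ log_index w p * ln (real p) \<le> ln w" using p by (simp add: powr_realpow field_simps)
  have "?q < 2 powr (real (Suc (log_index w p)))" using i(2) q by (simp add: log_less_iff add.commute)
  also have "\<dots> = 2 ^ Suc (log_index w p)" by (subst powr_realpow) auto
  finally show "ln w < 2 ^ Suc (log_index w p) * ln (real p)" using p by (simp add: field_simps)
qed

lemma exp_minus_one_le: "exp x - 1 \<le> x * exp (x :: real)"
proof -
  have "(1 - x) * exp x \<le> exp (- x) * exp x"
    using exp_ge_add_one_self[of "- x"] by (intro mult_right_mono) auto
  then show ?thesis by (simp add: exp_minus algebra_simps)
qed

lemma sum_half_powers_le: "(\<Sum>i<I. (1 / 2) ^ i) \<le> (2 :: real)"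
  by (subst geometric_sum) (auto simp: field_simps)

lemma sum_i_half_powers_le: "(\<Sum>i<I. real i / 2 ^ i) \<le> 2"
proof -
  have "(\<Sum>i<I. real i / 2 ^ i) = 2 - 2 * (real I + 1) / 2 ^ I"
    by (induction I) (simp_all add: add_divide_distrib)
  then show ?thesis by simp
qed

text \<open>Block \<open>i\<close> offers at most \<open>2 * i\<close> primes, each at most
  \<open>w powr (1 / 2 ^ i)\<close>; the exponents \<open>2 * i / 2 ^ i\<close> add up to at most 4.
  Block 0, the primes above the square root of \<open>w\<close>, contributes none.\<close>

lemma brun_hooley_prod_le:
  assumes w: "1 \<le> w" and U: "finite U" "\<And>p. p \<in> U \<Longrightarrow> prime p" "\<And>p. p \<in> U \<Longrightarrow> real p \<le> w"
    and S: "S \<in> brun_hooley_sets (log_index w) U"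
  shows "real (\<Prod>S) \<le> w ^ 4"
proof -
  have SU: "S \<subseteq> U" using S by (simp add: brun_hooley_sets_def)
  then have fin: "finite S" using U finite_subset by blast
  define I where "I = Suc (Max (insert 0 (log_index w ` S)))"
  have I: "log_index w p < I" if "p \<in> S" for p
    using that fin by (auto simp: I_def less_Suc_eq_le intro!: Max_ge)
  have p1: "1 < real p" if "p \<in> S" for p
    using that SU U(2) prime_gt_1_nat by (metis of_nat_1 of_nat_less_iff subsetD)
  have "ln (real (\<Prod>S)) = (\<Sum>p\<in>S. ln (real p))"
    unfolding of_nat_prod using fin p1 by (intro ln_prod) force+
  also have "\<dots> = (\<Sum>i<I. \<Sum>p | p \<in> S \<and> log_index w p = i. ln (real p))"
    using sum_blocks[of S "log_index w" I "\<lambda>p. ln (real p)"] fin I by simp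
  also have "\<dots> \<le> (\<Sum>i<I. real (2 * i) * (ln w / 2 ^ i))"
  proof (rule sum_mono)
    fix i
    have "(\<Sum>p | p \<in> S \<and> log_index w p = i. ln (real p)) \<le>
        real (card {p \<in> S. log_index w p = i}) * (ln w / 2 ^ i)"
    proof (rule sum_bounded_above)
      fix p assume "p \<in> {p \<in> S. log_index w p = i}"
      then show "ln (real p) \<le> ln w / 2 ^ i"
        using log_index_bounds(1)[of p w] p1 SU U by (auto simp: field_simps)
    qed
    also have "\<dots> \<le> real (2 * i) * (ln w / 2 ^ i)"
    proof (rule mult_right_mono)
      have "card {p \<in> S. log_index w p = i} \<le> 2 * i" using S by (simp add: brun_hooley_sets_def)
      then show "real (card {p \<in> S. log_index w p = i}) \<le> real (2 * i)" by (simp del: of_nat_mult)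
    qed (use w in auto)
    finally show "(\<Sum>p | p \<in> S \<and> log_index w p = i. ln (real p)) \<le> real (2 * i) * (ln w / 2 ^ i)" .
  qed
  also have "\<dots> = 2 * ln w * (\<Sum>i<I. real i / 2 ^ i)" by (simp add: sum_distrib_left mult_ac)
  also have "\<dots> \<le> 2 * ln w * 2" using w by (intro mult_left_mono sum_i_half_powers_le) auto
  also have "\<dots> = ln (w ^ 4)" using w by (simp add: ln_realpow)
  finally have "ln (real (\<Prod>S)) \<le> ln (w ^ 4)" .
  moreover have "0 < real (\<Prod>S)" using p1 by (fastforce intro!: prod_pos)
  ultimately show ?thesis using w by (subst (asm) ln_le_cancel_iff) auto
qed

text \<open>The threshold \<open>p0\<close> separates small primes, where \<open>h p\<close> may be
  large and only crude bounds are available, from those with \<open>h p \<le> 1 / 2\<close>. The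
  bound \<open>3 \<le> p0\<close> makes \<open>ln p0\<close> at least 1.\<close>

locale density =
  fixes \<kappa> lam1 lam2 B K C p0 :: real and h :: "nat \<Rightarrow> real"
  assumes pos: "0 < \<kappa>" "0 < lam1" "0 < lam2" "0 < B" "0 < K" "0 < C"
    and p0: "3 \<le> p0" "2 * B \<le> p0"
    and h_in: "h \<in> density_functions \<kappa> lam1 lam2 B K"
    and h_sq: "\<And>p e. prime p \<Longrightarrow> 2 \<le> e \<Longrightarrow> h (p ^ e) \<le> C / (real p)\<^sup>2"
begin

text \<open>For \<open>z \<le> a\<^sup>2\<close> the quotient in \<open>sum_h_le\<close> is at most
  4, and \<open>ln 4 \<le> 2\<close>; this is the resulting bound for the mass of one block.\<close>

definition L0 :: real where "L0 = 2 * \<kappa> + K"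

lemma L0_pos: "0 < L0" using pos by (simp add: L0_def)

lemma h_mult: "multiplicative_fun h"
  using h_in by (simp add: density_functions_def)

lemma h_nonneg: "0 < n \<Longrightarrow> 0 \<le> h n"
  using h_in by (simp add: density_functions_def)

lemma h_prime_nonneg: "prime p \<Longrightarrow> 0 \<le> h p"
  by (simp add: h_nonneg prime_gt_0_nat)

lemma h_le:
  assumes "prime p" "p0 \<le> real p"
  shows "h p \<le> B / real p"
proof -
  have "B < real p" using assms p0 pos by simp
  moreover have "\<forall>p e. prime p \<longrightarrow> B < real p \<longrightarrow> 1 \<le> e \<longrightarrow> h (p ^ e) \<le> B / real p"
    using h_in by (simp add: density_functions_def)
  ultimately have "h (p ^ 1) \<le> B / real p" using assms by blast
  then show ?thesis by simp
qed

lemma h_le_half: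
  assumes "prime p" "p0 \<le> real p"
  shows "h p \<le> 1 / 2"
proof -
  have "B / real p \<le> 1 / 2" using assms p0 by (simp add: field_simps)
  then show "h p \<le> 1 / 2" using h_le[OF assms] by linarith
qed

lemma h_pow_le: "prime p \<Longrightarrow> 1 \<le> e \<Longrightarrow> h (p ^ e) \<le> real p powr (- real e * lam1 + lam2)"
  using h_in by (simp add: density_functions_def)

lemma h_prod_bound:
  assumes "B < w" "1 < w" "w < z"
  shows "(\<Prod>p | prime p \<and> w \<le> real p \<and> real p < z. inverse (1 - h p)) \<le> (ln z / ln w) powr \<kappa> * (1 + K / ln w)"
  using h_in assms by (simp add: density_functions_def)

text \<open>Since \<open>exp (h p) \<le> inverse (1 - h p)\<close>, this is the logarithm of the
  product condition on density functions.\<close>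

lemma sum_h_le:
  assumes a: "p0 \<le> a" "a \<le> z"
  shows "(\<Sum>p\<in>primes_in a z. h p) \<le> \<kappa> * ln (2 * ln z / ln a) + K"
proof -
  have a3: "3 \<le> a" using a p0 by simp
  have la: "1 \<le> ln a"
    using a3 exp_le by (simp add: ln_ge_iff)
  have lz: "ln a \<le> ln z" using a a3 by simp
  have Ba: "B < a" using a p0 pos by simp
  \<comment> \<open>The product condition excludes the right endpoint and needs a nonempty interval.
    Passing to the square of \<open>z\<close> covers \<open>p = z\<close> and \<open>a = z\<close>,
    at the price of the 2 inside the logarithm.\<close>
  have zz: "z < z\<^sup>2" using a a3 by (simp add: power2_eq_square)
  let ?P = "{p. prime p \<and> a \<le> real p \<and> real p < z\<^sup>2}"
  have fin: "finite ?P"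
    by (rule finite_subset[OF _ finite_primes_in[of 0 "z\<^sup>2"]])
      (auto simp: primes_in_def prime_gt_0_nat)
  have ge: "exp (h p) \<le> inverse (1 - h p)" if "prime p" "a \<le> real p" for p
  proof -
    have "h p \<le> 1 / 2" using that a by (intro h_le_half) auto
    moreover have "1 - h p \<le> exp (- h p)" using exp_ge_add_one_self[of "- h p"] by simp
    ultimately have "inverse (exp (- h p)) \<le> inverse (1 - h p)"
      by (intro le_imp_inverse_le) auto
    then show ?thesis by (simp add: exp_minus)
  qed
  have "exp (\<Sum>p\<in>primes_in a z. h p) = (\<Prod>p\<in>primes_in a z. exp (h p))"
    by (simp add: exp_sum)
  also have "\<dots> \<le> (\<Prod>p\<in>primes_in a z. inverse (1 - h p))"
  proof (rule prod_mono)
    fix p assume "p \<in> primes_in a z"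
    then show "0 \<le> exp (h p) \<and> exp (h p) \<le> inverse (1 - h p)"
      using ge by (simp add: primes_in_def)
  qed
  also have "\<dots> \<le> (\<Prod>p\<in>?P. inverse (1 - h p))"
  proof (rule prod_mono2)
    fix p assume p: "p \<in> ?P - primes_in a z"
    have "1 \<le> exp (h p)" using p h_prime_nonneg by simp
    also have "\<dots> \<le> inverse (1 - h p)" using p ge by simp
    finally show "1 \<le> inverse (1 - h p)" .
  next
    fix p assume "p \<in> primes_in a z"
    then have "exp (h p) \<le> inverse (1 - h p)" using ge by (simp add: primes_in_def)
    then show "0 \<le> inverse (1 - h p)" using exp_ge_zero order_trans by blast
  qed (use fin zz in \<open>auto simp: primes_in_def\<close>)
  also have "\<dots> \<le> (ln (z\<^sup>2) / ln a) powr \<kappa> * (1 + K / ln a)"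
    using Ba a3 zz a by (intro h_prod_bound) auto
  also have "\<dots> \<le> (2 * ln z / ln a) powr \<kappa> * exp K"
  proof (rule mult_mono)
    have "1 + K / ln a \<le> 1 + K" using la pos by (simp add: field_simps)
    also have "\<dots> \<le> exp K" by simp
    finally show "1 + K / ln a \<le> exp K" .
    show "0 \<le> 1 + K / ln a" using la pos by simp
    have "ln (z\<^sup>2) = 2 * ln z" using a a3 by (simp add: ln_realpow)
    then show "(ln (z\<^sup>2) / ln a) powr \<kappa> \<le> (2 * ln z / ln a) powr \<kappa>" by simp
  qed simp
  also have "\<dots> = exp (\<kappa> * ln (2 * ln z / ln a) + K)"
    using la lz by (simp add: powr_def exp_add)
  finally show ?thesis by simp
qed

lemma sum_h_le_L0:
  assumes a: "p0 \<le> a" "z \<le> a\<^sup>2"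
  shows "(\<Sum>p\<in>primes_in a z. h p) \<le> L0"
proof (cases "a \<le> z")
  case True
  have a3: "3 \<le> a" using a p0 by simp
  have "ln z \<le> ln (a\<^sup>2)" using a a3 True by (subst ln_le_cancel_iff) auto
  then have "2 * ln z / ln a \<le> 4" using a3 by (simp add: ln_realpow field_simps)
  moreover have "0 < 2 * ln z / ln a" using a3 True by simp
  ultimately have "ln (2 * ln z / ln a) \<le> ln 4" by (subst ln_le_cancel_iff) auto
  also have "ln (4 :: real) \<le> 2" using ln_le_minus_one[of "2 :: real"] ln_mult[of 2 "2::real"] by simp
  finally have "\<kappa> * ln (2 * ln z / ln a) \<le> \<kappa> * 2" using pos by (intro mult_left_mono) auto
  then show ?thesis using sum_h_le[OF a(1) True] by (simp add: L0_def)
next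
  case False
  then have "primes_in a z = {}" by (auto simp: primes_in_def)
  then show ?thesis using L0_pos by simp
qed

text \<open>A block lies in an interval from \<open>a\<close> to \<open>a\<^sup>2\<close>. What
  matters is uniformity in \<open>i\<close> and \<open>w\<close>: this is the hypothesis
  \<open>L\<close> of \<open>brun_hooley_upper\<close>.\<close>

lemma sum_h_block_le:
  assumes "1 \<le> w"
  shows "(\<Sum>p | p \<in> primes_in p0 w \<and> log_index w p = i. h p) \<le> L0"
proof -
  define a where "a = w powr (1 / 2 ^ Suc i)"
  have w: "0 < w" using assms by simp
  have a2: "a\<^sup>2 = w powr (1 / 2 ^ i)"
    unfolding a_def using w by (simp add: powr_powr flip: powr_numeral) 
  have sub: "{p. p \<in> primes_in p0 w \<and> log_index w p = i} \<subseteq> primes_in (max p0 a) (a\<^sup>2)"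
  proof
    fix p assume "p \<in> {p. p \<in> primes_in p0 w \<and> log_index w p = i}"
    then have p: "prime p" "p0 < real p" "real p \<le> w" "log_index w p = i"
      by (auto simp: primes_in_def)
    have p1: "1 < real p" using p p0 by simp
    note b = log_index_bounds[OF p1 p(3), unfolded p(4)]
    have "ln a < ln (real p)"
      using b(2) w by (simp add: a_def ln_powr field_simps)
    then have "a < real p" using p1 w by (subst (asm) ln_less_cancel_iff) (auto simp: a_def)
    moreover have "ln (real p) \<le> ln (a\<^sup>2)"
      using b(1) w by (simp add: a2 ln_powr field_simps)
    then have "real p \<le> a\<^sup>2" using p1 w by (subst (asm) ln_le_cancel_iff) (auto simp: a2)
    ultimately show "p \<in> primes_in (max p0 a) (a\<^sup>2)" using p by (auto simp: primes_in_def)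
  qed
  have "(\<Sum>p | p \<in> primes_in p0 w \<and> log_index w p = i. h p) \<le> (\<Sum>p\<in>primes_in (max p0 a) (a\<^sup>2). h p)"
    using sub by (intro sum_mono2 finite_primes_in h_prime_nonneg) (auto simp: primes_in_def)
  also have "\<dots> \<le> L0"
    using w by (intro sum_h_le_L0 power_mono) (auto simp: a_def)
  finally show ?thesis .
qed

text \<open>The mass of \<open>h\<close> up to \<open>w\<close> is unbounded, but on block
  \<open>i\<close> the exponent \<open>\<beta> * ln p\<close> is at most \<open>c / 2 ^ i\<close>.
  The blocks, each of mass at most \<open>L0\<close>, are thus weighted by a geometric series. A
  Rankin factor of this kind costs only a constant.\<close>

lemma sum_powr_minus_one_le:
  assumes w: "1 < w" and \<beta>: "0 \<le> \<beta>" "\<beta> * ln w \<le> c"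
  shows "(\<Sum>p\<in>primes_in p0 w. (real p powr \<beta> - 1) * h p) \<le> 2 * (c * exp c * L0)"
proof -
  have "0 \<le> \<beta> * ln w" using w \<beta> by simp
  then have c: "0 \<le> c" using \<beta> by linarith
  define I where "I = Suc (Max (insert 0 (log_index w ` primes_in p0 w)))"
  have I: "log_index w p < I" if "p \<in> primes_in p0 w" for p
    using that by (auto simp: I_def less_Suc_eq_le intro!: Max_ge)
  have "(\<Sum>p\<in>primes_in p0 w. (real p powr \<beta> - 1) * h p) =
      (\<Sum>i<I. \<Sum>p | p \<in> primes_in p0 w \<and> log_index w p = i. (real p powr \<beta> - 1) * h p)"
    using sum_blocks[of "primes_in p0 w" "log_index w" I "\<lambda>p. (real p powr \<beta> - 1) * h p"] I by simp
  also have "\<dots> \<le> (\<Sum>i<I. \<Sum>p | p \<in> primes_in p0 w \<and> log_index w p = i. c * exp c * (1 / 2) ^ i * h p)"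
  proof (intro sum_mono mult_right_mono)
    fix i p assume "p \<in> {p. p \<in> primes_in p0 w \<and> log_index w p = i}"
    then have p: "prime p" "p0 < real p" "real p \<le> w" "log_index w p = i"
      by (auto simp: primes_in_def)
    have p1: "1 < real p" using p p0 by simp
    define x where "x = \<beta> * ln (real p)"
    have "2 ^ i * x \<le> \<beta> * ln w"
      using mult_left_mono[OF log_index_bounds(1)[OF p1 p(3)] \<beta>(1)] p(4) by (simp add: x_def mult_ac)
    then have x: "x \<le> c * (1 / 2) ^ i" using \<beta>(2) by (simp add: field_simps power_divide)
    have "c * (1 / 2) ^ i \<le> c" using c by (intro mult_left_le) (auto simp: power_le_one)
    then have xc: "x \<le> c" using x by simp
    have "0 \<le> x" using \<beta> p1 by (simp add: x_def)
    have "real p powr \<beta> - 1 = exp x - 1" using p1 by (simp add: x_def powr_def)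
    also have "\<dots> \<le> x * exp x" by (rule exp_minus_one_le)
    also have "\<dots> \<le> (c * (1 / 2) ^ i) * exp c" using x xc \<open>0 \<le> x\<close> by (intro mult_mono) auto
    finally show "real p powr \<beta> - 1 \<le> c * exp c * (1 / 2) ^ i" by (simp add: mult_ac)
    show "0 \<le> h p" using p by (rule_tac h_prime_nonneg)
  qed
  also have "\<dots> = (\<Sum>i<I. c * exp c * (1 / 2) ^ i * (\<Sum>p | p \<in> primes_in p0 w \<and> log_index w p = i. h p))"
    by (simp add: sum_distrib_left)
  also have "\<dots> \<le> (\<Sum>i<I. c * exp c * (1 / 2) ^ i * L0)"
    using w c by (intro sum_mono mult_left_mono sum_h_block_le) auto
  also have "\<dots> = c * exp c * L0 * (\<Sum>i<I. (1 / 2) ^ i)"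
    by (simp add: sum_distrib_left mult_ac)
  also have "\<dots> \<le> c * exp c * L0 * 2"
    using c L0_pos by (intro mult_left_mono sum_half_powers_le) auto
  finally show ?thesis by simp
qed

lemma sum_h_squared_le:
  assumes "P \<subseteq> primes_in p0 W"
  shows "(\<Sum>p\<in>P. (h p)\<^sup>2) \<le> 2 * B\<^sup>2"
proof -
  have fin: "finite P" using assms by (rule finite_subset) simp
  have "(\<Sum>p\<in>P. (h p)\<^sup>2) \<le> (\<Sum>p\<in>P. B\<^sup>2 * (1 / (real p)\<^sup>2))"
  proof (rule sum_mono)
    fix p assume "p \<in> P"
    then have p: "prime p" "p0 < real p" using assms by (auto simp: primes_in_def)
    have "(h p)\<^sup>2 \<le> (B / real p)\<^sup>2" using p h_le h_prime_nonneg by (intro power_mono) auto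
    then show "(h p)\<^sup>2 \<le> B\<^sup>2 * (1 / (real p)\<^sup>2)" by (simp add: power_divide)
  qed
  also have "\<dots> = B\<^sup>2 * (\<Sum>p\<in>P. 1 / (real p)\<^sup>2)" by (simp add: sum_distrib_left)
  also have "\<dots> \<le> B\<^sup>2 * 2" using fin assms primes_in_prime
    by (intro mult_left_mono sum_inverse_squares_le) auto
  finally show ?thesis by simp
qed

end

section \<open>Sieve bound for divisor sums\<close>

lemma finite_primes_in_unfolded [simp]:
  "finite {p. prime p \<and> a < real p \<and> real p \<le> b}"
  "finite {p. prime p \<and> a < real p \<and> real p \<le> b \<and> R p}"
  by (rule finite_subset[OF _ finite_primes_in[of a b]], auto simp: primes_in_def)+

lemma prod_primes_dvd_iff:
  fixes S :: "nat set"
  assumes "finite S" "\<And>p. p \<in> S \<Longrightarrow> prime p"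
  shows "\<Prod>S dvd n \<longleftrightarrow> (\<forall>p\<in>S. p dvd n)"
proof
  assume "\<forall>p\<in>S. p dvd n"
  with assms show "\<Prod>S dvd n"
  proof (induction S rule: finite_induct)
    case (insert q S)
    have "coprime q (\<Prod>S)"
      using insert by (intro prod_coprime_right primes_coprime) auto
    then show ?case using insert by (auto intro: divides_mult)
  qed simp
qed (use assms in \<open>meson dvd_prodI dvd_trans\<close>)

lemma prime_dvd_prod_primes_iff:
  fixes S :: "nat set"
  assumes "finite S" "\<And>p. p \<in> S \<Longrightarrow> prime p" "prime q"
  shows "q dvd \<Prod>S \<longleftrightarrow> q \<in> S"
proof -
  have "q dvd \<Prod>S \<longleftrightarrow> (\<exists>p\<in>S. q dvd p)" using prime_dvd_prod_iff[of S q "\<lambda>p. p"] assms by simp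
  also have "\<dots> \<longleftrightarrow> q \<in> S" by (metis assms(2,3) dvd_refl primes_dvd_imp_eq)
  finally show ?thesis .
qed

lemma exp_twice_le:
  fixes y :: real
  assumes "0 \<le> y" "y \<le> 1 / 2"
  shows "exp (2 * y) \<le> 1 + 4 * y"
proof -
  have "exp (2 * y) \<le> 1 + 2 * y + (2 * y)\<^sup>2" using assms by (intro exp_bound) auto
  also have "(2 * y)\<^sup>2 \<le> 2 * y"
    using mult_right_mono[of "2 * y" 1 "2 * y"] assms by (simp add: power2_eq_square)
  finally show ?thesis by simp
qed

text \<open>The data of a divisor sum twisted by a sieve: \<gamma> gives the local weights of the
  divisors, which have size up to \<open>X\<close> and primes up to \<open>W\<close>;
  \<open>x\<close> gives the weights of the sieve, which acts on primes up to \<open>w\<close>. The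
  constant \<Gamma> collects all local bounds; the last axiom is for the remainder terms.\<close>

locale sieve_weights = density +
  fixes w W X \<Gamma> :: real and \<gamma> :: "nat \<Rightarrow> nat \<Rightarrow> real" and x :: "nat \<Rightarrow> real"
  assumes wW: "1 \<le> w" "w \<le> W" and X: "1 \<le> X" and \<Gamma>: "1 \<le> \<Gamma>"
    and x: "\<And>p. prime p \<Longrightarrow> 0 \<le> x p" "\<And>p. prime p \<Longrightarrow> x p \<le> 1"
    and \<gamma>_nonneg: "\<And>p k. prime p \<Longrightarrow> 1 \<le> k \<Longrightarrow> 0 \<le> \<gamma> p k"
    and \<gamma>_small: "\<And>p N. p \<in> primes_in 0 p0 \<Longrightarrow> (\<Sum>k=1..N. \<gamma> p k * h (p ^ k)) \<le> \<Gamma>"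
    and \<gamma>_1: "\<And>p. p \<in> primes_in p0 W \<Longrightarrow> \<gamma> p 1 \<le> \<Gamma>"
    and \<gamma>_ge2: "\<And>p N. p \<in> primes_in p0 W \<Longrightarrow> (\<Sum>k=2..N. \<gamma> p k * h (p ^ k)) \<le> \<Gamma> / (real p)\<^sup>2"
    and \<gamma>_prod: "\<And>d. 0 < d \<Longrightarrow> prime_factors d \<subseteq> primes_in 0 W \<Longrightarrow>
      (\<Prod>p\<in>primes_in 0 W. if p dvd d then \<gamma> p (multiplicity p d) else 1) \<le> \<Gamma> * real d"
begin

text \<open>On integers with all primes up to \<open>W\<close>, this is the multiplicative function
  with value \<open>\<gamma> p k\<close> at \<open>p ^ k\<close>.\<close>

definition G :: "nat \<Rightarrow> real" where
  "G d = (\<Prod>p\<in>primes_in 0 W. if p dvd d then \<gamma> p (multiplicity p d) else 1)"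

definition divs :: "nat set" where
  "divs = {d. 0 < d \<and> real d \<le> X \<and> prime_factors d \<subseteq> primes_in 0 W}"

text \<open>Primes dividing \<open>d\<close> are excluded so that every sieving modulus is coprime
  to \<open>d\<close>.\<close>

definition Q :: "nat \<Rightarrow> nat set" where
  "Q d = {p \<in> primes_in p0 w. \<not> p dvd d}"

definition BH :: "nat \<Rightarrow> nat set set" where
  "BH d = brun_hooley_sets (log_index w) (Q d)"

text \<open>The price for primes of \<open>d\<close> missing from the sieve product and from the
  relative error term. The 2 is dictated by the square in the latter.\<close>

definition E :: "nat \<Rightarrow> real" where
  "E d = exp (\<Sum>p | p \<in> primes_in p0 W \<and> p dvd d. 2 * h p)"

text \<open>The saving expected from the sieve when no prime is excluded.\<close>

definition \<Theta> :: real where "\<Theta> = exp (- (\<Sum>p\<in>primes_in p0 w. x p * h p))"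

section \<open>Divisors and sieving moduli\<close>

lemma finite_divs: "finite divs"
proof (rule finite_subset)
  show "divs \<subseteq> {..nat \<lfloor>X\<rfloor>}" by (auto simp: divs_def le_nat_iff le_floor_iff)
qed simp

lemma card_divs: "real (card divs) \<le> X"
proof -
  have "divs \<subseteq> {1..nat \<lfloor>X\<rfloor>}" by (auto simp: divs_def le_nat_iff le_floor_iff)
  then have "card divs \<le> nat \<lfloor>X\<rfloor>" using card_mono[of "{1..nat \<lfloor>X\<rfloor>}" divs] by simp
  then show ?thesis using X by linarith
qed

lemma G_nonneg: "0 < d \<Longrightarrow> 0 \<le> G d"
  unfolding G_def using \<gamma>_nonneg
  by (intro prod_nonneg) (auto simp: primes_in_def Suc_le_eq prime_multiplicity_gt_zero_iff)

lemma finite_Q [simp]: "finite (Q d)" by (simp add: Q_def)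

lemma Q_prime: "p \<in> Q d \<Longrightarrow> prime p" by (simp add: Q_def primes_in_def)

lemma finite_BH [simp]: "finite (BH d)"
  unfolding BH_def by (intro finite_brun_hooley_sets) simp

lemma BH_subset: "S \<in> BH d \<Longrightarrow> S \<subseteq> Q d"
  by (simp add: BH_def brun_hooley_sets_def)

lemma BH_finite: "S \<in> BH d \<Longrightarrow> finite S"
  using BH_subset finite_Q finite_subset by metis

lemma BH_prime: "S \<in> BH d \<Longrightarrow> p \<in> S \<Longrightarrow> prime p"
  using BH_subset Q_prime by blast

lemma Q_prime_bounds:
  "p \<in> Q d \<Longrightarrow> 0 \<le> h p" "p \<in> Q d \<Longrightarrow> h p \<le> 1 / 2" "p \<in> Q d \<Longrightarrow> 0 \<le> x p * h p"
  "p \<in> Q d \<Longrightarrow> x p * h p \<le> h p"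
proof -
  assume p: "p \<in> Q d"
  then have "prime p" "p0 < real p" by (auto simp: Q_def primes_in_def)
  then show "0 \<le> h p" "h p \<le> 1 / 2" "0 \<le> x p * h p" "x p * h p \<le> h p"
    using h_prime_nonneg h_le_half x mult_right_mono[of "x p" 1 "h p"] by auto
qed

lemma BH_prod_pos: "S \<in> BH d \<Longrightarrow> 0 < \<Prod>S"
  using BH_prime by (intro prod_pos) (auto simp: prime_gt_0_nat)

lemma BH_prod_le: "S \<in> BH d \<Longrightarrow> real (\<Prod>S) \<le> w ^ 4"
  unfolding BH_def using wW
  by (intro brun_hooley_prod_le[of w "Q d"]) (auto simp: Q_def primes_in_def)

lemma h_BH_prod:
  assumes S: "S \<in> BH d"
  shows "h (\<Prod>S) = (\<Prod>p\<in>S. h p)"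
  using multiplicative_fun_prime_power_prod[OF h_mult BH_finite[OF S] BH_prime[OF S], of "\<lambda>_. 1"] by simp

lemma BH_coprime: "S \<in> BH d \<Longrightarrow> coprime d (\<Prod>S)"
proof (intro prod_coprime_right)
  fix p assume "S \<in> BH d" "p \<in> S"
  then have "prime p" "\<not> p dvd d" using BH_subset[of S d] by (auto simp: Q_def primes_in_def)
  then show "coprime d p" using prime_imp_coprime coprime_commute by blast
qed

text \<open>Distinct sets of primes have distinct products, and these are at most
  \<open>w ^ 4\<close>.\<close>

lemma card_BH: "real (card (BH d)) \<le> w ^ 4"
proof -
  have "inj_on (\<lambda>S. \<Prod>S) (BH d)"
  proof (rule inj_onI)
    fix S T assume S: "S \<in> BH d" "T \<in> BH d" and eq: "\<Prod>S = \<Prod>T"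
    have "p \<in> S \<longleftrightarrow> p \<in> T" if "prime p" for p
      using prime_dvd_prod_primes_iff[OF BH_finite[OF S(1)] BH_prime[OF S(1)] that]
        prime_dvd_prod_primes_iff[OF BH_finite[OF S(2)] BH_prime[OF S(2)] that] eq by simp
    then show "S = T" using S BH_prime by blast
  qed
  moreover have "(\<lambda>S. \<Prod>S) ` BH d \<subseteq> {1..nat \<lfloor>w ^ 4\<rfloor>}"
    using BH_prod_pos BH_prod_le by (auto simp: Suc_le_eq le_nat_iff le_floor_iff simp del: of_nat_prod)
  ultimately have "card (BH d) \<le> nat \<lfloor>w ^ 4\<rfloor>"
    using card_inj_on_le[of "\<lambda>S. \<Prod>S" "BH d" "{1..nat \<lfloor>w ^ 4\<rfloor>}"] by simp
  moreover have "0 \<le> w ^ 4" using wW by simp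
  ultimately show ?thesis by linarith
qed

text \<open>The members of \<open>BH d\<close> whose product divides \<open>n\<close> are exactly
  the Brun--Hooley sets of the primes in \<open>Q d\<close> dividing \<open>n\<close>.\<close>

lemma sieve_pointwise:
  assumes n: "0 < n"
  shows "(\<Prod>p | p \<in> Q d \<and> p dvd n. 1 - x p) \<le> (\<Sum>S | S \<in> BH d \<and> \<Prod>S dvd n. \<Prod>p\<in>S. - x p)"
proof -
  let ?U = "{p. p \<in> Q d \<and> p dvd n}"
  have "brun_hooley_sets (log_index w) ?U = {S \<in> BH d. \<Prod>S dvd n}"
  proof (intro set_eqI iffI)
    fix S assume S: "S \<in> brun_hooley_sets (log_index w) ?U"
    then have "S \<in> BH d" by (auto simp: BH_def brun_hooley_sets_def)
    moreover have "\<forall>p\<in>S. p dvd n" using S by (auto simp: brun_hooley_sets_def)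
    ultimately show "S \<in> {S \<in> BH d. \<Prod>S dvd n}"
      using prod_primes_dvd_iff[of S n] BH_finite BH_prime by blast
  next
    fix S assume S: "S \<in> {S \<in> BH d. \<Prod>S dvd n}"
    then have "\<forall>p\<in>S. p dvd n" using prod_primes_dvd_iff[of S n] BH_finite BH_prime by blast
    then show "S \<in> brun_hooley_sets (log_index w) ?U"
      using S by (auto simp: BH_def brun_hooley_sets_def)
  qed
  moreover have "(\<Prod>p\<in>?U. 1 - x p) \<le> (\<Sum>S\<in>brun_hooley_sets (log_index w) ?U. \<Prod>p\<in>S. - x p)"
    by (rule brun_hooley_lower) (use x Q_prime in auto)
  ultimately show ?thesis by simp
qed

lemma prod_Q_le: "(\<Prod>p\<in>Q d. 1 - x p * h p) \<le> \<Theta> * E d"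
proof -
  have split: "primes_in p0 w = Q d \<union> {p \<in> primes_in p0 w. p dvd d}" by (auto simp: Q_def)
  have "(\<Sum>p\<in>primes_in p0 w. x p * h p) =
      (\<Sum>p\<in>Q d. x p * h p) + (\<Sum>p | p \<in> primes_in p0 w \<and> p dvd d. x p * h p)"
    by (subst split, subst sum.union_disjoint) (auto simp: Q_def)
  also have "(\<Sum>p | p \<in> primes_in p0 w \<and> p dvd d. x p * h p)
      \<le> (\<Sum>p | p \<in> primes_in p0 w \<and> p dvd d. 2 * h p)"
  proof (rule sum_mono)
    fix p assume "p \<in> {p \<in> primes_in p0 w. p dvd d}"
    then have p: "prime p" by (simp add: primes_in_def)
    show "x p * h p \<le> 2 * h p" using x(2)[OF p] h_prime_nonneg[OF p] by (intro mult_right_mono) simp_all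
  qed
  also have "\<dots> \<le> (\<Sum>p | p \<in> primes_in p0 W \<and> p dvd d. 2 * h p)"
    using wW by (intro sum_mono2) (auto simp: primes_in_def h_prime_nonneg)
  finally have *: "- (\<Sum>p\<in>Q d. x p * h p) \<le>
      - (\<Sum>p\<in>primes_in p0 w. x p * h p) + (\<Sum>p | p \<in> primes_in p0 W \<and> p dvd d. 2 * h p)" by simp
  have "(\<Prod>p\<in>Q d. 1 - x p * h p) \<le> (\<Prod>p\<in>Q d. exp (- (x p * h p)))"
  proof (rule prod_mono)
    fix p assume "p \<in> Q d"
    then show "0 \<le> 1 - x p * h p \<and> 1 - x p * h p \<le> exp (- (x p * h p))"
      using Q_prime_bounds[of p d] exp_ge_add_one_self[of "- (x p * h p)"] by linarith
  qed
  also have "\<dots> = exp (- (\<Sum>p\<in>Q d. x p * h p))" by (simp add: exp_sum flip: sum_negf)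
  also have "\<dots> \<le> \<Theta> * E d" using * by (simp add: \<Theta>_def E_def flip: exp_add)
  finally show ?thesis .
qed

lemma sum_BH_main_le:
  "(\<Sum>S\<in>BH d. (\<Prod>p\<in>S. - x p) * h (\<Prod>S)) \<le> exp (exp (3 * L0)) * (\<Theta> * E d)"
proof -
  have "(\<Sum>S\<in>BH d. (\<Prod>p\<in>S. - x p) * h (\<Prod>S)) = (\<Sum>S\<in>BH d. \<Prod>p\<in>S. - (x p * h p))"
  proof (rule sum.cong)
    fix S assume S: "S \<in> BH d"
    show "(\<Prod>p\<in>S. - x p) * h (\<Prod>S) = (\<Prod>p\<in>S. - (x p * h p))"
      by (simp add: h_BH_prod[OF S] flip: prod.distrib)
  qed simp
  also have "\<dots> \<le> exp (exp (3 * L0)) * (\<Prod>p\<in>Q d. 1 - x p * h p)"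
    unfolding BH_def
  proof (rule brun_hooley_upper)
    fix p assume p: "p \<in> Q d"
    show "0 \<le> x p * h p" "x p * h p \<le> 1 / 2" using Q_prime_bounds[OF p] by auto
  next
    fix i
    have "(\<Sum>p | p \<in> Q d \<and> log_index w p = i. x p * h p) \<le> (\<Sum>p | p \<in> Q d \<and> log_index w p = i. h p)"
      using Q_prime_bounds by (intro sum_mono) auto
    also have "\<dots> \<le> (\<Sum>p | p \<in> primes_in p0 w \<and> log_index w p = i. h p)"
      by (intro sum_mono2) (auto simp: Q_def intro!: h_prime_nonneg dest: primes_in_prime)
    also have "\<dots> \<le> L0" using wW by (intro sum_h_block_le)
    finally show "(\<Sum>p | p \<in> Q d \<and> log_index w p = i. x p * h p) \<le> L0" .
  qed (use L0_pos in auto)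
  also have "\<dots> \<le> exp (exp (3 * L0)) * (\<Theta> * E d)" by (intro mult_left_mono prod_Q_le) simp
  finally show ?thesis .
qed

text \<open>With absolute values the sum over \<open>S\<close> is about \<open>exp\<close> of the
  sum of \<open>x p * h p\<close>, so it loses what the sieve should gain. The squared product is
  about \<open>exp\<close> of minus twice the sum of \<open>h p\<close>. As
  \<open>x p \<le> 1\<close>, one half of it cancels the loss and the other half still gives
  \<Theta>.\<close>

lemma sum_BH_error_le:
  assumes "w \<le> M" "0 < d" "prime_factors d \<subseteq> primes_in 0 W"
  shows "(\<Sum>S\<in>BH d. (\<Prod>p\<in>S. x p) * h (\<Prod>S) *
      (\<Prod>p | p \<in> primes_in p0 M \<and> \<not> p dvd d * \<Prod>S. (1 - h p)\<^sup>2)) \<le> exp (8 * B\<^sup>2) * (\<Theta> * E d)"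
proof -
  let ?R = "primes_in p0 M" and ?s = "\<Sum>p\<in>primes_in p0 M. 2 * h p"
  \<comment> \<open>The factor \<open>exp (2 * h p)\<close> accounts for the primes of
    \<open>S\<close>, which are missing from the squared product.\<close>
  let ?y = "\<lambda>p. x p * h p * exp (2 * h p)"
  have term_le: "(\<Prod>p\<in>S. x p) * h (\<Prod>S) * (\<Prod>p | p \<in> ?R \<and> \<not> p dvd d * \<Prod>S. (1 - h p)\<^sup>2)
      \<le> (exp (- ?s) * E d) * (\<Prod>p\<in>S. ?y p)" if S: "S \<in> BH d" for S
  proof -
    let ?V = "{p. p \<in> ?R \<and> \<not> p dvd d * \<Prod>S}"
    have "(\<Prod>p\<in>?V. (1 - h p)\<^sup>2) \<le> (\<Prod>p\<in>?V. exp (- (2 * h p)))"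
    proof (rule prod_mono)
      fix p assume "p \<in> ?V"
      then have p: "prime p" "p0 \<le> real p" by (auto simp: primes_in_def)
      have "(1 - h p)\<^sup>2 \<le> (exp (- h p))\<^sup>2"
        using exp_ge_add_one_self[of "- h p"] h_le_half[OF p] by (intro power_mono) auto
      then show "0 \<le> (1 - h p)\<^sup>2 \<and> (1 - h p)\<^sup>2 \<le> exp (- (2 * h p))"
        by (simp flip: exp_double)
    qed
    also have "\<dots> = exp (- (\<Sum>p\<in>?V. 2 * h p))" by (simp add: exp_sum flip: sum_negf)
    also have "\<dots> \<le> exp (- ?s + ((\<Sum>p | p \<in> primes_in p0 W \<and> p dvd d. 2 * h p) + (\<Sum>p\<in>S. 2 * h p)))"
    proof -
      have "?s \<le> (\<Sum>p\<in>?V \<union> ({p \<in> primes_in p0 W. p dvd d} \<union> S). 2 * h p)"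
      proof (rule sum_mono2)
        show "?R \<subseteq> ?V \<union> ({p \<in> primes_in p0 W. p dvd d} \<union> S)"
        proof
          fix p assume p: "p \<in> ?R"
          show "p \<in> ?V \<union> ({p \<in> primes_in p0 W. p dvd d} \<union> S)"
          proof (cases "p dvd d * \<Prod>S")
            case True
            have pr: "prime p" using p by (simp add: primes_in_def)
            with True consider "p dvd d" | "p dvd \<Prod>S" by (auto simp: prime_dvd_mult_iff)
            then show ?thesis
            proof cases
              case 1
              then have "p \<in> primes_in 0 W" using assms pr by (auto simp: prime_factors_dvd)
              then show ?thesis using 1 p by (auto simp: primes_in_def)
            next
              case 2
              then show ?thesis using prime_dvd_prod_primes_iff[OF BH_finite[OF S] BH_prime[OF S] pr] by simp
            qed
          qed (use p in auto)
        qed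
        fix p assume "p \<in> ?V \<union> ({p \<in> primes_in p0 W. p dvd d} \<union> S) - ?R"
        then have "prime p" using BH_prime[OF S] by (auto simp: primes_in_def)
        then show "0 \<le> 2 * h p" using h_prime_nonneg by simp
      qed (use BH_finite[OF S] in auto)
      also have "\<dots> = (\<Sum>p\<in>?V. 2 * h p) + (\<Sum>p\<in>{p \<in> primes_in p0 W. p dvd d} \<union> S. 2 * h p)"
        using BH_finite[OF S] S
        by (intro sum.union_disjoint) (auto intro: dvd_prodI dvd_mult dvd_mult2)
      also have "(\<Sum>p\<in>{p \<in> primes_in p0 W. p dvd d} \<union> S. 2 * h p) =
          (\<Sum>p | p \<in> primes_in p0 W \<and> p dvd d. 2 * h p) + (\<Sum>p\<in>S. 2 * h p)"
        using BH_finite[OF S] BH_subset[OF S] by (intro sum.union_disjoint) (auto simp: Q_def)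
      finally show ?thesis by simp
    qed
    also have "\<dots> = (exp (- ?s) * E d) * (\<Prod>p\<in>S. exp (2 * h p))"
      unfolding E_def exp_sum[OF BH_finite[OF S], symmetric] by (simp only: exp_add mult.assoc)
    finally have le: "(\<Prod>p\<in>?V. (1 - h p)\<^sup>2) \<le> (exp (- ?s) * E d) * (\<Prod>p\<in>S. exp (2 * h p))" .
    have "0 \<le> (\<Prod>p\<in>S. x p) * (\<Prod>p\<in>S. h p)"
      using BH_prime[OF S] x h_prime_nonneg by (intro mult_nonneg_nonneg prod_nonneg) auto
    from mult_left_mono[OF le this] show ?thesis
      by (simp add: h_BH_prod[OF S] prod.distrib mult_ac)
  qed
  have y0: "0 \<le> ?y p" if "prime p" for p using that x h_prime_nonneg by simp
  have "(\<Sum>S\<in>BH d. \<Prod>p\<in>S. ?y p) \<le> (\<Sum>S\<in>Pow (primes_in p0 w). \<Prod>p\<in>S. ?y p)"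
  proof (rule sum_mono2)
    show "BH d \<subseteq> Pow (primes_in p0 w)" using BH_subset by (auto simp: Q_def)
    fix S assume "S \<in> Pow (primes_in p0 w) - BH d"
    then show "0 \<le> (\<Prod>p\<in>S. ?y p)" using y0 by (intro prod_nonneg) (auto simp: primes_in_def)
  qed simp
  also have "\<dots> = (\<Prod>p\<in>primes_in p0 w. ?y p + 1)" by (subst prod_add) auto
  also have "\<dots> \<le> (\<Prod>p\<in>primes_in p0 w. exp (x p * h p + 4 * (h p)\<^sup>2))"
  proof (rule prod_mono)
    fix p assume "p \<in> primes_in p0 w"
    then have p: "prime p" "p0 \<le> real p" by (auto simp: primes_in_def)
    have hp: "0 \<le> h p" "h p \<le> 1 / 2" using p h_prime_nonneg h_le_half by auto
    have "?y p \<le> x p * h p * (1 + 4 * h p)"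
      using exp_twice_le[OF hp] x(1)[OF p(1)] hp by (intro mult_left_mono) auto
    also have "\<dots> = x p * h p + x p * (4 * (h p)\<^sup>2)" by (simp add: algebra_simps power2_eq_square)
    also have "\<dots> \<le> x p * h p + 1 * (4 * (h p)\<^sup>2)"
      using x(2)[OF p(1)] by (intro add_left_mono mult_right_mono) auto
    finally have "?y p + 1 \<le> exp (x p * h p + 4 * (h p)\<^sup>2)"
      using exp_ge_add_one_self[of "x p * h p + 4 * (h p)\<^sup>2"] by linarith
    then show "0 \<le> ?y p + 1 \<and> ?y p + 1 \<le> exp (x p * h p + 4 * (h p)\<^sup>2)"
      using y0[OF p(1)] by simp
  qed
  also have "\<dots> = exp ((\<Sum>p\<in>primes_in p0 w. x p * h p) + 4 * (\<Sum>p\<in>primes_in p0 w. (h p)\<^sup>2))"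
    by (simp add: exp_sum sum.distrib sum_distrib_left flip: exp_sum)
  also have "\<dots> \<le> exp ((\<Sum>p\<in>primes_in p0 w. x p * h p) + 8 * B\<^sup>2)"
    using sum_h_squared_le[of "primes_in p0 w" w] by simp
  finally have sum_le: "(\<Sum>S\<in>BH d. \<Prod>p\<in>S. ?y p) \<le> exp ((\<Sum>p\<in>primes_in p0 w. x p * h p) + 8 * B\<^sup>2)" .
  have "2 * (\<Sum>p\<in>primes_in p0 w. x p * h p) \<le> (\<Sum>p\<in>primes_in p0 w. 2 * h p)"
    unfolding sum_distrib_left
  proof (rule sum_mono)
    fix p assume "p \<in> primes_in p0 w"
    then have p: "prime p" by (simp add: primes_in_def)
    show "2 * (x p * h p) \<le> 2 * h p"
      using mult_right_mono[OF x(2)[OF p] h_prime_nonneg[OF p]] by simp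
  qed
  also have "\<dots> \<le> ?s"
    using assms by (intro sum_mono2) (auto simp: primes_in_def h_prime_nonneg)
  finally have s: "2 * (\<Sum>p\<in>primes_in p0 w. x p * h p) \<le> ?s" .
  have "(\<Sum>S\<in>BH d. (\<Prod>p\<in>S. x p) * h (\<Prod>S) * (\<Prod>p | p \<in> ?R \<and> \<not> p dvd d * \<Prod>S. (1 - h p)\<^sup>2))
      \<le> (exp (- ?s) * E d) * (\<Sum>S\<in>BH d. \<Prod>p\<in>S. ?y p)"
    unfolding sum_distrib_left using term_le by (intro sum_mono)
  also have "\<dots> \<le> (exp (- ?s) * E d) * exp ((\<Sum>p\<in>primes_in p0 w. x p * h p) + 8 * B\<^sup>2)"
    using sum_le by (intro mult_left_mono) (auto simp: E_def)
  also have "\<dots> = E d * exp (- ?s + (\<Sum>p\<in>primes_in p0 w. x p * h p) + 8 * B\<^sup>2)"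
    by (simp only: exp_add mult_ac)
  also have "\<dots> \<le> E d * exp (8 * B\<^sup>2 - (\<Sum>p\<in>primes_in p0 w. x p * h p))"
    using s by (intro mult_left_mono) (auto simp: E_def)
  also have "\<dots> = exp (8 * B\<^sup>2) * (\<Theta> * E d)" 
    by (simp only: \<Theta>_def diff_conv_add_uminus exp_add mult_ac)
  finally show ?thesis .
qed

section \<open>The Euler product of the divisor weights\<close>

lemma multiplicity_le_of_le:
  fixes d p :: nat
  assumes "0 < d" "prime p" "real d \<le> X"
  shows "multiplicity p d \<le> nat \<lfloor>X\<rfloor>"
proof -
  have "multiplicity p d < 2 ^ multiplicity p d" by (rule less_exp)
  also have "\<dots> \<le> p ^ multiplicity p d" using assms prime_ge_2_nat by (intro power_mono) auto
  also have "\<dots> \<le> d" using assms multiplicity_dvd[of p d] by (intro dvd_imp_le) auto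
  finally show ?thesis using assms by (simp add: le_nat_iff le_floor_iff)
qed

text \<open>All terms are nonnegative, so the sum is at most a finite Euler product. Only the first
  powers of primes above \<open>p0\<close> stay in the exponent: higher powers cost a multiple of
  \<open>1 / p\<^sup>2\<close>, the factor from \<open>E\<close> a multiple of
  \<open>(h p)\<^sup>2\<close>, and there are at most \<open>p0\<close> small primes.\<close>

lemma sum_divs_euler_le:
  "(\<Sum>d\<in>divs. G d * h d * E d) \<le>
    exp (\<Gamma> * p0 + 8 * \<Gamma> * B\<^sup>2 + 6 * \<Gamma> + (\<Sum>p\<in>primes_in p0 W. \<gamma> p 1 * h p))"
proof -
  \<comment> \<open>This bounds every exponent in a member of \<open>divs\<close>, because
    \<open>k < 2 ^ k\<close>.\<close>
  define N where "N = nat \<lfloor>X\<rfloor>"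
  define \<eta> where "\<eta> p = (if p0 < real p then exp (2 * h p) else 1)" for p
  define t where "t p k = (if k = 0 then 1 else \<gamma> p k * h (p ^ k) * \<eta> p)" for p k
  let ?P = "primes_in 0 W" and ?N = "\<Prod>p\<in>primes_in 0 W. p ^ N"
  have P: "finite ?P" "\<And>p. p \<in> ?P \<Longrightarrow> prime p" by (auto simp: primes_in_prime)
  have \<eta>: "0 < \<eta> p" for p by (simp add: \<eta>_def)
  have t0: "0 \<le> t p k" if "prime p" for p k
    using that \<gamma>_nonneg[of p k] h_nonneg[of "p ^ k"] \<eta>[of p] by (simp add: t_def prime_gt_0_nat)
  have eq: "G d * h d * E d = (\<Prod>p\<in>?P. t p (multiplicity p d))"
    if "0 < d" "prime_factors d \<subseteq> ?P" for d
  proof -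
    have "h d = (\<Prod>p\<in>?P. h (p ^ multiplicity p d))"
      using that P by (intro multiplicative_fun_eq_prod h_mult) auto
    moreover have "E d = (\<Prod>p\<in>?P. if p dvd d then \<eta> p else 1)"
    proof -
      have "E d = (\<Prod>p | p \<in> primes_in p0 W \<and> p dvd d. exp (2 * h p))" by (simp add: E_def exp_sum)
      also have "\<dots> = (\<Prod>p | p \<in> primes_in p0 W \<and> p dvd d. if p dvd d then \<eta> p else 1)"
        by (intro prod.cong) (auto simp: \<eta>_def primes_in_def)
      also have "\<dots> = (\<Prod>p\<in>?P. if p dvd d then \<eta> p else 1)"
        using p0 by (intro prod.mono_neutral_left finite_primes_in) (auto simp: \<eta>_def primes_in_def)
      finally show ?thesis .
    qed
    ultimately have "G d * h d * E d = (\<Prod>p\<in>?P. (if p dvd d then \<gamma> p (multiplicity p d) else 1) *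
        h (p ^ multiplicity p d) * (if p dvd d then \<eta> p else 1))"
      by (simp add: G_def prod.distrib)
    also have "\<dots> = (\<Prod>p\<in>?P. t p (multiplicity p d))"
    proof (rule prod.cong)
      fix p assume "p \<in> ?P"
      then have "p dvd d \<longleftrightarrow> multiplicity p d \<noteq> 0"
        using that P prime_multiplicity_gt_zero_iff[of p d] by auto
      then show "(if p dvd d then \<gamma> p (multiplicity p d) else 1) *
        h (p ^ multiplicity p d) * (if p dvd d then \<eta> p else 1) = t p (multiplicity p d)"
        using h_mult by (simp add: t_def multiplicative_fun_def)
    qed simp
    finally show ?thesis .
  qed
  have "(\<Sum>d\<in>divs. G d * h d * E d) = (\<Sum>d\<in>divs. \<Prod>p\<in>?P. t p (multiplicity p d))"
    using eq by (intro sum.cong) (auto simp: divs_def)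
  also have "\<dots> \<le> (\<Sum>d | d dvd ?N. \<Prod>p\<in>?P. t p (multiplicity p d))"
  proof (rule sum_mono2)
    have "0 < ?N" using P by (intro prime_power_prod_pos) auto
    then show "finite {d. d dvd ?N}" by simp
    show "divs \<subseteq> {d. d dvd ?N}"
    proof
      fix d assume d: "d \<in> divs"
      have "d dvd ?N"
      proof (rule prime_power_prod_dvd)
        fix p :: nat assume p: "prime p"
        show "multiplicity p d \<le> multiplicity p ?N"
        proof (cases "p \<in> ?P")
          case True
          then show ?thesis
            using d p multiplicity_le_of_le[of d p] P by (simp add: divs_def N_def multiplicity_prod_prime_powers)
        next
          case False
          then have "\<not> p dvd d" using d p by (auto simp: divs_def prime_factors_dvd)
          then show ?thesis by (simp add: not_dvd_imp_multiplicity_0)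
        qed
      qed (use d \<open>0 < ?N\<close> in \<open>auto simp: divs_def\<close>)
      then show "d \<in> {d. d dvd ?N}" by simp
    qed
    show "0 \<le> (\<Prod>p\<in>?P. t p (multiplicity p d))" for d
      using P t0 by (intro prod_nonneg) auto
  qed
  also have "\<dots> = (\<Prod>p\<in>?P. \<Sum>k\<le>N. t p k)"
    using sum_divisors_prime_power_prod[OF P, of t "\<lambda>_. N"] by simp
  also have "\<dots> \<le> (\<Prod>p\<in>?P. exp (\<Sum>k=1..N. t p k))"
  proof (rule prod_mono)
    fix p assume "p \<in> ?P"
    then have p: "prime p" using P by simp
    have "{..N} = insert 0 {1..N}" by auto
    then have "(\<Sum>k\<le>N. t p k) = 1 + (\<Sum>k=1..N. t p k)" by (simp add: t_def)
    moreover have "0 \<le> (\<Sum>k\<le>N. t p k)" using t0[OF p] by (intro sum_nonneg) auto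
    ultimately show "0 \<le> (\<Sum>k\<le>N. t p k) \<and> (\<Sum>k\<le>N. t p k) \<le> exp (\<Sum>k=1..N. t p k)" by simp
  qed
  also have "\<dots> = exp (\<Sum>p\<in>?P. \<Sum>k=1..N. t p k)" using P by (simp add: exp_sum)
  also have "(\<Sum>p\<in>?P. \<Sum>k=1..N. t p k) \<le>
      (\<Sum>p\<in>primes_in 0 p0 \<union> primes_in p0 W. \<Sum>k=1..N. t p k)"
    by (intro sum_mono2 finite_UnI finite_primes_in) (auto simp: primes_in_def intro!: sum_nonneg t0)
  also have "\<dots> = (\<Sum>p\<in>primes_in 0 p0. \<Sum>k=1..N. t p k) + (\<Sum>p\<in>primes_in p0 W. \<Sum>k=1..N. t p k)"
    by (intro sum.union_disjoint finite_primes_in) (auto simp: primes_in_def)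
  also have "(\<Sum>p\<in>primes_in 0 p0. \<Sum>k=1..N. t p k) \<le> \<Gamma> * p0"
  proof -
    have "(\<Sum>p\<in>primes_in 0 p0. \<Sum>k=1..N. t p k) \<le> real (card (primes_in 0 p0)) * \<Gamma>"
    proof (rule sum_bounded_above)
      fix p assume p: "p \<in> primes_in 0 p0"
      have "(\<Sum>k=1..N. t p k) = (\<Sum>k=1..N. \<gamma> p k * h (p ^ k))"
        using p by (intro sum.cong) (auto simp: t_def \<eta>_def primes_in_def)
      then show "(\<Sum>k=1..N. t p k) \<le> \<Gamma>" using \<gamma>_small[OF p] by simp
    qed
    also have "\<dots> \<le> p0 * \<Gamma>"
    proof (rule mult_right_mono)
      show "real (card (primes_in 0 p0)) \<le> p0" using p0 by (intro card_primes_in_le) simp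
    qed (use \<Gamma> in simp)
    finally show ?thesis by (simp add: mult.commute)
  qed
  also have "(\<Sum>p\<in>primes_in p0 W. \<Sum>k=1..N. t p k) \<le>
      (\<Sum>p\<in>primes_in p0 W. \<gamma> p 1 * h p + 4 * \<Gamma> * (h p)\<^sup>2 + 3 * \<Gamma> * (1 / (real p)\<^sup>2))"
  proof (rule sum_mono)
    fix p assume p': "p \<in> primes_in p0 W"
    then have p: "prime p" "p0 \<le> real p" "p0 < real p" by (auto simp: primes_in_def)
    have hp: "0 \<le> h p" "h p \<le> 1 / 2" using p h_prime_nonneg h_le_half by auto
    have g: "0 \<le> \<gamma> p 1" "\<gamma> p 1 \<le> \<Gamma>" using p \<gamma>_nonneg \<gamma>_1[OF p'] by auto
    have e: "\<eta> p \<le> 1 + 4 * h p" "\<eta> p \<le> 3"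
      using exp_twice_le[OF hp] hp by (auto simp: \<eta>_def)
    have "(\<Sum>k=1..N. t p k) \<le> (\<Sum>k\<in>insert 1 {2..N}. t p k)"
      using t0[OF p(1)] by (intro sum_mono2) auto
    also have "\<dots> = \<gamma> p 1 * h p * \<eta> p + (\<Sum>k=2..N. \<gamma> p k * h (p ^ k)) * \<eta> p"
      unfolding sum_distrib_right by (subst sum.insert) (auto simp: t_def intro!: sum.cong)
    also have "\<dots> \<le> \<gamma> p 1 * h p * (1 + 4 * h p) + (\<Gamma> / (real p)\<^sup>2) * 3"
    proof (intro add_mono mult_mono e \<gamma>_ge2[OF p'])
      show "0 \<le> \<eta> p" using \<eta>[of p] by simp
    qed (use g hp \<Gamma> \<eta>[of p] in auto)
    also have "\<gamma> p 1 * h p * (1 + 4 * h p) = \<gamma> p 1 * h p + \<gamma> p 1 * (4 * (h p)\<^sup>2)"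
      by (simp add: algebra_simps power2_eq_square)
    also have "\<gamma> p 1 * (4 * (h p)\<^sup>2) \<le> \<Gamma> * (4 * (h p)\<^sup>2)" using g by (intro mult_right_mono) auto
    finally show "(\<Sum>k=1..N. t p k) \<le>
        \<gamma> p 1 * h p + 4 * \<Gamma> * (h p)\<^sup>2 + 3 * \<Gamma> * (1 / (real p)\<^sup>2)" by (simp add: mult_ac)
  qed
  also have "\<dots> = (\<Sum>p\<in>primes_in p0 W. \<gamma> p 1 * h p) + 4 * \<Gamma> * (\<Sum>p\<in>primes_in p0 W. (h p)\<^sup>2)
      + 3 * \<Gamma> * (\<Sum>p\<in>primes_in p0 W. 1 / (real p)\<^sup>2)"
    by (simp only: sum.distrib sum_distrib_left)
  also have "\<dots> \<le> (\<Sum>p\<in>primes_in p0 W. \<gamma> p 1 * h p) + 4 * \<Gamma> * (2 * B\<^sup>2) + 3 * \<Gamma> * 2"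
    using \<Gamma> sum_h_squared_le[of "primes_in p0 W" W] sum_inverse_squares_le[of "primes_in p0 W"]
    by (intro add_mono mult_left_mono order_refl) (auto simp: primes_in_prime)
  finally show ?thesis by (simp add: algebra_simps)
qed

text \<open>
  The square in the relative error term of \<open>equi\<close> compensates the loss from taking absolute values
  of the sieve coefficients.
\<close>

theorem sieve_bound:
  fixes I :: "'b set" and \<mu> :: "'b \<Rightarrow> real" and c :: "'b \<Rightarrow> nat"
  assumes I: "finite I" "\<And>a. a \<in> I \<Longrightarrow> 0 \<le> \<mu> a" "\<And>a. a \<in> I \<Longrightarrow> 0 < c a"
    and M: "w \<le> M" and E12: "0 \<le> E1" "0 \<le> E2" "0 \<le> V" and Z: "X * w ^ 4 \<le> Z"
    and equi: "\<And>d. 0 < d \<Longrightarrow> real d \<le> Z \<Longrightarrow>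
      \<exists>u v. \<bar>u\<bar> \<le> E1 * (\<Prod>p | p \<in> primes_in p0 M \<and> \<not> p dvd d. (1 - h p)\<^sup>2) \<and>
        \<bar>v\<bar> \<le> E2 * V \<and> (\<Sum>a | a \<in> I \<and> d dvd c a. \<mu> a) = h d * M * (1 + u) + v"
  shows "(\<Sum>a\<in>I. \<mu> a * (\<Sum>d | d \<in> divs \<and> d dvd c a. G d * (\<Prod>p | p \<in> Q d \<and> p dvd c a. 1 - x p)))
    \<le> (exp (exp (3 * L0)) + E1 * exp (8 * B\<^sup>2)) * exp (\<Gamma> * p0 + 8 * \<Gamma> * B\<^sup>2 + 6 * \<Gamma>) * M *
        exp ((\<Sum>p\<in>primes_in p0 W. \<gamma> p 1 * h p) - (\<Sum>p\<in>primes_in p0 w. x p * h p))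
      + E2 * \<Gamma> * V * X\<^sup>2 * w ^ 4"
proof -
  let ?f = "\<lambda>S. \<Prod>p\<in>S. - x p"
  let ?C = "\<lambda>d. \<Sum>a | a \<in> I \<and> d dvd c a. \<mu> a"
  let ?K = "exp (exp (3 * L0)) + E1 * exp (8 * B\<^sup>2)"
  have M0: "0 \<le> M" using M wW by simp
  have "(\<Sum>a\<in>I. \<mu> a * (\<Sum>d | d \<in> divs \<and> d dvd c a. G d * (\<Prod>p | p \<in> Q d \<and> p dvd c a. 1 - x p)))
    \<le> (\<Sum>a\<in>I. \<mu> a * (\<Sum>d | d \<in> divs \<and> d dvd c a. G d * (\<Sum>S | S \<in> BH d \<and> \<Prod>S dvd c a. ?f S)))"
    using I sieve_pointwise G_nonneg by (intro sum_mono mult_left_mono) (auto simp: divs_def)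
  also have "\<dots> = (\<Sum>a\<in>I. \<Sum>d\<in>divs. \<Sum>S\<in>BH d. if d * \<Prod>S dvd c a then \<mu> a * (G d * ?f S) else 0)"
  proof (rule sum.cong)
    fix a assume "a \<in> I"
    have "\<mu> a * (\<Sum>d | d \<in> divs \<and> d dvd c a. G d * (\<Sum>S | S \<in> BH d \<and> \<Prod>S dvd c a. ?f S)) =
        (\<Sum>d\<in>divs. if d dvd c a then \<mu> a * (G d * (\<Sum>S\<in>BH d. if \<Prod>S dvd c a then ?f S else 0)) else 0)"
      using finite_divs by (simp add: sum_distrib_left sum.inter_filter)
        (auto simp: sum_distrib_left intro!: sum.cong)
    also have "\<dots> = (\<Sum>d\<in>divs. \<Sum>S\<in>BH d. if d * \<Prod>S dvd c a then \<mu> a * (G d * ?f S) else 0)"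
    proof (rule sum.cong)
      fix d
      \<comment> \<open>Coprimality merges the two divisibility conditions into one, to which the
        equidistribution estimate applies.\<close>
      have "d * \<Prod>S dvd c a \<longleftrightarrow> d dvd c a \<and> \<Prod>S dvd c a" if "S \<in> BH d" for S
        using BH_coprime[OF that] by (auto intro: divides_mult dest: dvd_mult_left dvd_mult_right)
      then show "(if d dvd c a then \<mu> a * (G d * (\<Sum>S\<in>BH d. if \<Prod>S dvd c a then ?f S else 0)) else 0) =
          (\<Sum>S\<in>BH d. if d * \<Prod>S dvd c a then \<mu> a * (G d * ?f S) else 0)"
        by (cases "d dvd c a") (auto simp: sum_distrib_left intro!: sum.cong)
    qed simp
    finally show "\<mu> a * (\<Sum>d | d \<in> divs \<and> d dvd c a. G d * (\<Sum>S | S \<in> BH d \<and> \<Prod>S dvd c a. ?f S)) =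
      (\<Sum>d\<in>divs. \<Sum>S\<in>BH d. if d * \<Prod>S dvd c a then \<mu> a * (G d * ?f S) else 0)" .
  qed simp
  also have "\<dots> = (\<Sum>d\<in>divs. \<Sum>a\<in>I. \<Sum>S\<in>BH d. if d * \<Prod>S dvd c a then \<mu> a * (G d * ?f S) else 0)"
    by (rule sum.swap)
  also have "\<dots> = (\<Sum>d\<in>divs. \<Sum>S\<in>BH d. \<Sum>a\<in>I. if d * \<Prod>S dvd c a then \<mu> a * (G d * ?f S) else 0)"
    by (intro sum.cong refl sum.swap)
  also have "\<dots> = (\<Sum>d\<in>divs. G d * (\<Sum>S\<in>BH d. ?f S * ?C (d * \<Prod>S)))"
    using I(1) by (intro sum.cong refl) (simp add: sum_distrib_left sum.inter_filter mult_ac if_distrib cong: if_cong)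
  also have "\<dots> \<le> (\<Sum>d\<in>divs. G d * (h d * M * (?K * (\<Theta> * E d)) + E2 * V * w ^ 4))"
  proof (intro sum_mono mult_left_mono)
    fix d assume d: "d \<in> divs"
    have d0: "0 < d" and dX: "real d \<le> X" and dP: "prime_factors d \<subseteq> primes_in 0 W"
      using d by (auto simp: divs_def)
    have hd: "0 \<le> h d" using d0 by (rule h_nonneg)
    let ?R = "\<lambda>S. \<Prod>p | p \<in> primes_in p0 M \<and> \<not> p dvd d * \<Prod>S. (1 - h p)\<^sup>2"
    have "?f S * ?C (d * \<Prod>S) \<le> h d * M * (?f S * h (\<Prod>S)) +
        h d * M * E1 * ((\<Prod>p\<in>S. x p) * h (\<Prod>S) * ?R S) + E2 * V" if S: "S \<in> BH d" for S
    proof -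
      have "real (d * \<Prod>S) \<le> X * w ^ 4"
        unfolding of_nat_mult using dX X BH_prod_le[OF S] by (intro mult_mono) (auto simp del: of_nat_prod)
      with Z have "real (d * \<Prod>S) \<le> Z" by linarith
      then obtain u v where uv: "\<bar>u\<bar> \<le> E1 * ?R S" "\<bar>v\<bar> \<le> E2 * V"
        "?C (d * \<Prod>S) = h (d * \<Prod>S) * M * (1 + u) + v"
        using equi[of "d * \<Prod>S"] d0 BH_prod_pos[OF S] by auto
      have "h (d * \<Prod>S) = h d * h (\<Prod>S)"
        using h_mult BH_coprime[OF S] d0 BH_prod_pos[OF S] by (simp add: multiplicative_fun_def Suc_le_eq)
      then have eq: "?f S * ?C (d * \<Prod>S) = h d * M * (?f S * h (\<Prod>S)) +
          h d * M * h (\<Prod>S) * (?f S * u) + ?f S * v"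
        by (simp add: uv(3) algebra_simps)
      have abs: "\<bar>?f S\<bar> = (\<Prod>p\<in>S. x p)"
        using BH_prime[OF S] x by (simp add: abs_prod)
      have le1: "(\<Prod>p\<in>S. x p) \<le> 1" "0 \<le> (\<Prod>p\<in>S. x p)"
        using BH_prime[OF S] x by (auto intro!: prod_le_1 prod_nonneg)
      have "?f S * u \<le> \<bar>?f S\<bar> * \<bar>u\<bar>" by (metis abs_ge_self abs_mult)
      also have "\<dots> \<le> (\<Prod>p\<in>S. x p) * (E1 * ?R S)"
        unfolding abs using uv(1) le1 by (intro mult_left_mono)
      finally have u: "?f S * u \<le> (\<Prod>p\<in>S. x p) * (E1 * ?R S)" .
      have "?f S * v \<le> \<bar>?f S\<bar> * \<bar>v\<bar>" by (metis abs_ge_self abs_mult)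
      also have "\<dots> \<le> 1 * (E2 * V)"
        unfolding abs using uv(2) le1 by (intro mult_mono) auto
      finally have v: "?f S * v \<le> E2 * V" by simp
      have "0 \<le> h d * M * h (\<Prod>S)"
        using hd M0 h_nonneg[OF BH_prod_pos[OF S]] by simp
      from mult_left_mono[OF u this] show ?thesis using v unfolding eq by (simp add: mult_ac)
    qed
    then have "(\<Sum>S\<in>BH d. ?f S * ?C (d * \<Prod>S)) \<le> (\<Sum>S\<in>BH d. h d * M * (?f S * h (\<Prod>S)) +
        h d * M * E1 * ((\<Prod>p\<in>S. x p) * h (\<Prod>S) * ?R S) + E2 * V)" by (rule sum_mono)
    also have "\<dots> = h d * M * (\<Sum>S\<in>BH d. ?f S * h (\<Prod>S)) +
        h d * M * E1 * (\<Sum>S\<in>BH d. (\<Prod>p\<in>S. x p) * h (\<Prod>S) * ?R S) + real (card (BH d)) * (E2 * V)"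
      by (simp only: sum.distrib sum_distrib_left sum_constant)
    also have "\<dots> \<le> h d * M * (exp (exp (3 * L0)) * (\<Theta> * E d)) +
        h d * M * E1 * (exp (8 * B\<^sup>2) * (\<Theta> * E d)) + w ^ 4 * (E2 * V)"
      using hd M0 E12 sum_BH_main_le sum_BH_error_le[OF M d0 dP] card_BH
      by (intro add_mono mult_left_mono mult_right_mono mult_nonneg_nonneg) auto
    also have "\<dots> = h d * M * (?K * (\<Theta> * E d)) + E2 * V * w ^ 4" by (simp add: algebra_simps)
    finally show "(\<Sum>S\<in>BH d. ?f S * ?C (d * \<Prod>S)) \<le> h d * M * (?K * (\<Theta> * E d)) + E2 * V * w ^ 4" .
    show "0 \<le> G d" using d0 by (rule G_nonneg)
  qed
  also have "\<dots> = M * ?K * \<Theta> * (\<Sum>d\<in>divs. G d * h d * E d) + E2 * V * w ^ 4 * (\<Sum>d\<in>divs. G d)"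
    by (simp add: sum_distrib_left sum.distrib algebra_simps)
  \<comment> \<open>The main part is the Euler product. The remainder is estimated trivially: at
    most \<open>X\<close> divisors, each with \<open>G d \<le> \<Gamma> * X\<close>.\<close>
  also have "\<dots> \<le> M * ?K * \<Theta> *
      exp (\<Gamma> * p0 + 8 * \<Gamma> * B\<^sup>2 + 6 * \<Gamma> + (\<Sum>p\<in>primes_in p0 W. \<gamma> p 1 * h p)) + E2 * V * w ^ 4 * (X * (\<Gamma> * X))"
  proof (intro add_mono mult_left_mono sum_divs_euler_le)
    have "(\<Sum>d\<in>divs. G d) \<le> real (card divs) * (\<Gamma> * X)"
    proof (rule sum_bounded_above)
      fix d assume d: "d \<in> divs"
      have "G d \<le> \<Gamma> * real d" using d \<gamma>_prod by (simp add: G_def divs_def)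
      also have "\<dots> \<le> \<Gamma> * X" using d \<Gamma> by (intro mult_left_mono) (auto simp: divs_def)
      finally show "G d \<le> \<Gamma> * X" .
    qed
    also have "\<dots> \<le> X * (\<Gamma> * X)" using card_divs \<Gamma> X by (intro mult_right_mono) auto
    finally show "(\<Sum>d\<in>divs. G d) \<le> X * (\<Gamma> * X)" .
  qed (use M0 E12 wW in \<open>auto simp: \<Theta>_def\<close>)
  also have "\<dots> = ?K * exp (\<Gamma> * p0 + 8 * \<Gamma> * B\<^sup>2 + 6 * \<Gamma>) * M *
        exp ((\<Sum>p\<in>primes_in p0 W. \<gamma> p 1 * h p) - (\<Sum>p\<in>primes_in p0 w. x p * h p))
      + E2 * \<Gamma> * V * X\<^sup>2 * w ^ 4"
    by (simp add: \<Theta>_def exp_add exp_diff exp_minus power2_eq_square field_simps)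
  finally show ?thesis .
qed

end

section \<open>Majorants of multiplicative functions\<close>

text \<open>The size of \<epsilon> leaves half of the decay of \<open>h (p ^ k)\<close> after
  multiplying by \<open>F (p ^ k)\<close> and by a Rankin factor with exponent at most \<epsilon>.
  At small primes \<open>A0 ^ k * h (p ^ k)\<close> need not be summable over \<open>k\<close>,
  hence the bound with \<open>Ce\<close>; above \<open>p0\<close>, the last assumption turns
  \<open>A0 ^ k\<close> into \<open>p powr (k * \<epsilon>)\<close>.\<close>

locale weighted_density = density +
  fixes F :: "nat \<Rightarrow> real" and A0 Ce \<epsilon> :: real
  assumes F_mult: "multiplicative_fun F" and F_nonneg: "\<And>n. 0 < n \<Longrightarrow> 0 \<le> F n"
    and A0: "1 \<le> A0" and F_pow: "\<And>p k. prime p \<Longrightarrow> F (p ^ k) \<le> A0 ^ k"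
    and \<epsilon>: "0 < \<epsilon>" "4 * \<epsilon> \<le> lam1" "4 * \<epsilon> \<le> 1"
    and Ce: "1 \<le> Ce" and F_le: "\<And>n. 0 < n \<Longrightarrow> F n \<le> Ce * real n powr \<epsilon>"
    and A0_p0: "A0 \<le> p0 powr \<epsilon>"
begin

text \<open>
  The weights are chosen so that \<open>F (p ^ k) * p powr (k * \<beta>)\<close> is at most
  \<open>1 - sieve_x p\<close> plus the sum of \<open>gam w \<beta> p j\<close> over \<open>1 \<le> j \<le> k\<close>, for every prime \<open>p > p0\<close>
  with \<open>p \<le> w\<close>. A prime thus contributes either to the convolution factor or to the sieve, which
  makes the divisors and the sieving moduli coprime.
\<close>

definition sieve_x :: "nat \<Rightarrow> real" where
  "sieve_x p = max (1 - F p) 0"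

definition gam :: "real \<Rightarrow> real \<Rightarrow> nat \<Rightarrow> nat \<Rightarrow> real" where
  "gam w \<beta> p k =
    (if real p \<le> p0 then Ce * real p powr (real k * (\<epsilon> + \<beta>))
     else if k = 1 then (if real p \<le> w then F p * real p powr \<beta> - min (F p) 1 else real p powr \<beta>)
     else A0 ^ k * real p powr (real k * \<beta>))"

text \<open>The ratio of the geometric series that dominates the weighted prime powers; the worst
  prime is 2.\<close>

definition \<sigma> :: real where "\<sigma> = 2 powr (- lam1 / 2)"

text \<open>From this exponent on, \<open>k * lam1 / 2 \<ge> lam2 + 2\<close>, so the power bound on
  \<open>h (p ^ k)\<close> alone gives the decay \<open>1 / p\<^sup>2\<close>.\<close>

definition k0 :: nat where "k0 = nat \<lceil>2 * (lam2 + 2) / lam1\<rceil>"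

text \<open>One summand for each bound on \<Gamma> required by \<open>sieve_weights\<close>, in the
  order of its axioms. Here \<open>Y\<close> bounds the Rankin factor \<open>p powr \<beta>\<close>
  of a single prime.\<close>

definition Gam :: "real \<Rightarrow> real" where
  "Gam Y = 1 + Ce * p0 powr lam2 * (1 / (1 - \<sigma>)) + A0 * Y
     + (real k0 * ((A0 * Y) ^ k0 * C) + 2 powr (lam2 + 2) * (1 / (1 - \<sigma>))) + Ce powr p0"

lemma \<sigma>: "0 < \<sigma>" "\<sigma> < 1"
  using pos by (auto simp: \<sigma>_def powr_less_one)

lemma sum_\<sigma>_le:
  assumes "finite A"
  shows "(\<Sum>k\<in>A. \<sigma> ^ k) \<le> 1 / (1 - \<sigma>)"
proof -
  have "(\<Sum>k\<in>A. \<sigma> ^ k) \<le> (\<Sum>k. \<sigma> ^ k)"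
    using \<sigma> assms by (intro sum_le_suminf summable_geometric) auto
  then show ?thesis using \<sigma> by (simp add: suminf_geometric)
qed

lemma \<sigma>_pow: "\<sigma> ^ k = 2 powr (- (real k * lam1 / 2))"
  by (simp add: \<sigma>_def powr_power)

lemma powr_le_\<sigma>_pow:
  assumes "prime p"
  shows "real p powr (- (real k * lam1 / 2)) \<le> \<sigma> ^ k"
proof -
  have "real p powr (- (real k * lam1 / 2)) \<le> 2 powr (- (real k * lam1 / 2))"
    using prime_ge_2_nat[OF assms] pos by (intro powr_mono2') auto
  then show ?thesis by (simp add: \<sigma>_pow)
qed

lemma F_prime_nonneg: "prime p \<Longrightarrow> 0 \<le> F (p ^ k)"
  by (simp add: F_nonneg prime_gt_0_nat)

lemma F_prime_nonneg': "prime p \<Longrightarrow> 0 \<le> F p"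
  by (simp add: F_nonneg prime_gt_0_nat)

lemma F_prime_le: "prime p \<Longrightarrow> F p \<le> A0"
  using F_pow[of p 1] by simp

lemma gam_nonneg:
  assumes "prime p" "0 \<le> \<beta>"
  shows "0 \<le> gam w \<beta> p k"
proof -
  have "1 \<le> real p powr \<beta>" using prime_ge_1_nat[OF assms(1)] assms(2) by (intro ge_one_powr_ge_zero) auto
  then have "F p * 1 \<le> F p * real p powr \<beta>" using F_prime_nonneg'[OF assms(1)] by (intro mult_left_mono)
  then show ?thesis using A0 Ce by (auto simp: gam_def)
qed

lemma A0_le_powr:
  assumes "p0 < real p"
  shows "A0 \<le> real p powr \<epsilon>"
proof -
  have "p0 powr \<epsilon> \<le> real p powr \<epsilon>" using assms p0 \<epsilon> by (intro powr_mono2) auto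
  then show ?thesis using A0_p0 by simp
qed

lemma A0_pow_le_powr:
  assumes "p0 < real p"
  shows "A0 ^ k \<le> real p powr (real k * \<epsilon>)"
proof -
  have "A0 ^ k \<le> (real p powr \<epsilon>) ^ k" using A0 A0_le_powr[OF assms] by (intro power_mono) auto
  also have "\<dots> = real p powr (real k * \<epsilon>)"
    using assms p0 by (simp add: powr_power mult.commute)
  finally show ?thesis .
qed

lemma gam_le_powr:
  assumes "prime p" "0 \<le> \<beta>" "1 \<le> k"
  shows "gam w \<beta> p k \<le> (if real p \<le> p0 then Ce else 1) * real p powr (real k * (\<epsilon> + \<beta>))"
proof (cases "real p \<le> p0")
  case True
  then show ?thesis by (simp add: gam_def)
next
  case False
  then have p: "p0 < real p" by simp
  have p1: "1 \<le> real p" using prime_ge_1_nat[OF assms(1)] by simp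
  have *: "A0 ^ k * real p powr (real k * \<beta>) \<le> real p powr (real k * (\<epsilon> + \<beta>))"
  proof -
    have "A0 ^ k * real p powr (real k * \<beta>) \<le> real p powr (real k * \<epsilon>) * real p powr (real k * \<beta>)"
      using A0_pow_le_powr[OF p] by (intro mult_right_mono) auto
    then show ?thesis by (simp add: powr_add algebra_simps)
  qed
  have "gam w \<beta> p 1 \<le> A0 * real p powr \<beta>"
  proof -
    have "F p * real p powr \<beta> \<le> A0 * real p powr \<beta>"
      using F_prime_le[OF assms(1)] by (intro mult_right_mono) auto
    moreover have "1 * real p powr \<beta> \<le> A0 * real p powr \<beta>"
      using A0 by (intro mult_right_mono) auto
    ultimately show ?thesis using False F_prime_nonneg'[OF assms(1)] by (auto simp: gam_def)
  qed
  then have "gam w \<beta> p k \<le> A0 ^ k * real p powr (real k * \<beta>)"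
    using False by (cases "k = 1") (auto simp: gam_def)
  with * False show ?thesis by simp
qed

text \<open>The constant depends on \<open>W\<close> and \<beta> only through \<open>Y\<close>. In
  the ranges used later \<open>W powr \<beta>\<close> is bounded, so \<open>Gam Y\<close> does not
  grow with \<open>M\<close>.\<close>

lemma sieve_weights_gam:
  assumes w: "1 \<le> w" "w \<le> W" and X: "1 \<le> X" and \<beta>: "0 \<le> \<beta>" "\<beta> \<le> \<epsilon>" and Y: "W powr \<beta> \<le> Y"
  shows "sieve_weights \<kappa> lam1 lam2 B K C p0 h w W X (Gam Y) (gam w \<beta>) sieve_x"
proof
  have W: "1 \<le> W" using w by simp
  have Y1: "1 \<le> Y" using ge_one_powr_ge_zero[OF W \<beta>(1)] Y by simp
  have pos_parts: "0 \<le> Ce * p0 powr lam2 * (1 / (1 - \<sigma>))" "0 \<le> A0 * Y"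
      "0 \<le> real k0 * ((A0 * Y) ^ k0 * C) + 2 powr (lam2 + 2) * (1 / (1 - \<sigma>))" "0 \<le> Ce powr p0"
    using Ce A0 Y1 \<sigma> pos by (auto intro!: add_nonneg_nonneg mult_nonneg_nonneg)
  show Gam1: "1 \<le> Gam Y" using pos_parts unfolding Gam_def by linarith
  show "1 \<le> w" "w \<le> W" "1 \<le> X" by fact+
  show "0 \<le> sieve_x p" "prime p \<Longrightarrow> sieve_x p \<le> 1" for p
    using F_prime_nonneg' by (auto simp: sieve_x_def)
  show "0 \<le> gam w \<beta> p k" if "prime p" for p k using that \<beta> by (intro gam_nonneg)
  have pY: "real p powr \<beta> \<le> Y" if "real p \<le> W" for p
    using powr_mono2[OF \<beta>(1) _ that] Y by simp
  have exp_le: "real k * (\<epsilon> + \<beta>) \<le> real k * lam1 / 2" for k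
    using mult_left_mono[of "\<epsilon> + \<beta>" "lam1 / 2" "real k"] \<beta> \<epsilon> by simp
  show "(\<Sum>k = 1..N. gam w \<beta> p k * h (p ^ k)) \<le> Gam Y" if "p \<in> primes_in 0 p0" for p N
  proof -
    have p: "prime p" "real p \<le> p0" "1 \<le> real p"
      using that prime_ge_1_nat[of p] by (auto simp: primes_in_def)
    have "(\<Sum>k = 1..N. gam w \<beta> p k * h (p ^ k)) \<le> (\<Sum>k = 1..N. Ce * p0 powr lam2 * \<sigma> ^ k)"
    proof (rule sum_mono)
      fix k assume "k \<in> {1..N}"
      then have k: "1 \<le> k" by simp
      have "gam w \<beta> p k * h (p ^ k) \<le>
          (Ce * real p powr (real k * (\<epsilon> + \<beta>))) * real p powr (- real k * lam1 + lam2)"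
        using p k Ce h_pow_le[OF p(1) k] by (simp add: gam_def mult_left_mono)
      also have "\<dots> = Ce * real p powr (real k * (\<epsilon> + \<beta>) + (- real k * lam1 + lam2))"
        using p by (simp add: powr_add)
      also have "\<dots> \<le> Ce * real p powr (lam2 + - (real k * lam1 / 2))"
        using p Ce exp_le[of k] by (intro mult_left_mono powr_mono) auto
      also have "\<dots> = Ce * (real p powr lam2 * real p powr (- (real k * lam1 / 2)))"
        using p by (simp only: powr_add)
      also have "\<dots> \<le> Ce * (p0 powr lam2 * \<sigma> ^ k)"
        using p Ce pos by (intro mult_left_mono mult_mono powr_mono2 powr_le_\<sigma>_pow) auto
      finally show "gam w \<beta> p k * h (p ^ k) \<le> Ce * p0 powr lam2 * \<sigma> ^ k" by simp
    qed
    also have "\<dots> = Ce * p0 powr lam2 * (\<Sum>k = 1..N. \<sigma> ^ k)" by (simp add: sum_distrib_left)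
    also have "\<dots> \<le> Ce * p0 powr lam2 * (1 / (1 - \<sigma>))"
      using Ce by (intro mult_left_mono sum_\<sigma>_le) auto
    also have "\<dots> \<le> Gam Y" using pos_parts unfolding Gam_def by linarith
    finally show ?thesis .
  qed
  show "gam w \<beta> p 1 \<le> Gam Y" if "p \<in> primes_in p0 W" for p
  proof -
    have p: "prime p" "p0 < real p" "real p \<le> W" using that by (auto simp: primes_in_def)
    have "F p * real p powr \<beta> \<le> A0 * Y"
      using F_prime_le[OF p(1)] pY[OF p(3)] A0 by (intro mult_mono) auto
    moreover have "1 * real p powr \<beta> \<le> A0 * Y" using pY[OF p(3)] A0 by (intro mult_mono) auto
    ultimately have "gam w \<beta> p 1 \<le> A0 * Y" using p F_prime_nonneg'[OF p(1)] by (auto simp: gam_def)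
    also have "\<dots> \<le> Gam Y" using pos_parts unfolding Gam_def by linarith
    finally show ?thesis .
  qed
  show "(\<Sum>k = 2..N. gam w \<beta> p k * h (p ^ k)) \<le> Gam Y / (real p)\<^sup>2" if "p \<in> primes_in p0 W" for p N
  proof -
    have p: "prime p" "p0 < real p" "real p \<le> W" using that by (auto simp: primes_in_def)
    have p2: "2 \<le> real p" using prime_ge_2_nat[OF p(1)] by simp
    let ?b = "(A0 * Y) ^ k0 * C"
    have b: "0 \<le> ?b" using A0 Y1 pos by simp
    have "(\<Sum>k = 2..N. gam w \<beta> p k * h (p ^ k)) \<le>
        (\<Sum>k = 2..N. ((if k < k0 then ?b else 0) + 2 powr (lam2 + 2) * \<sigma> ^ k) * (1 / (real p)\<^sup>2))"
    proof (rule sum_mono)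
      fix k assume "k \<in> {2..N}"
      then have k: "2 \<le> k" by simp
      have hk: "0 \<le> h (p ^ k)" using p by (simp add: h_nonneg prime_gt_0_nat)
      show "gam w \<beta> p k * h (p ^ k) \<le>
          ((if k < k0 then ?b else 0) + 2 powr (lam2 + 2) * \<sigma> ^ k) * (1 / (real p)\<^sup>2)"
      \<comment> \<open>Below \<open>k0\<close> the weight is bounded and \<open>h_sq\<close>
        supplies the decay in \<open>p\<close>; from \<open>k0\<close> on, the decay comes from
        \<open>h_pow_le\<close>.\<close>
      proof (cases "k < k0")
        case True
        have "gam w \<beta> p k = A0 ^ k * (real p powr \<beta>) ^ k"
          using p k p2 by (simp add: gam_def powr_power mult.commute)
        also have "\<dots> = (A0 * real p powr \<beta>) ^ k" by (simp add: power_mult_distrib)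
        also have "\<dots> \<le> (A0 * Y) ^ k"
          using A0 pY[OF p(3)] by (intro power_mono mult_left_mono) auto
        also have "\<dots> \<le> (A0 * Y) ^ k0"
          using True A0 Y1 mult_mono[of 1 A0 1 Y] by (intro power_increasing) auto
        finally have "gam w \<beta> p k * h (p ^ k) \<le> (A0 * Y) ^ k0 * (C / (real p)\<^sup>2)"
          using h_sq[OF p(1) k] hk A0 Y1 by (intro mult_mono) auto
        also have "\<dots> \<le> (?b + 2 powr (lam2 + 2) * \<sigma> ^ k) * (1 / (real p)\<^sup>2)"
        proof -
          have "?b * (1 / (real p)\<^sup>2) \<le> (?b + 2 powr (lam2 + 2) * \<sigma> ^ k) * (1 / (real p)\<^sup>2)"
            using \<sigma> by (intro mult_right_mono) auto
          then show ?thesis by simp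
        qed
        finally show ?thesis using True by simp
      next
        case False
        have e: "0 \<le> real k * lam1 / 2 - (lam2 + 2)"
        proof -
          have "2 * (lam2 + 2) / lam1 \<le> real k0" unfolding k0_def by linarith
          also have "\<dots> \<le> real k" using False by simp
          finally show ?thesis using pos by (simp add: field_simps)
        qed
        have "gam w \<beta> p k * h (p ^ k) \<le>
            real p powr (real k * (\<epsilon> + \<beta>)) * real p powr (- real k * lam1 + lam2)"
          using gam_le_powr[OF p(1) \<beta>(1), of k w] p k hk h_pow_le[OF p(1), of k]
          by (intro mult_mono) auto
        also have "\<dots> = real p powr (real k * (\<epsilon> + \<beta>) + (- real k * lam1 + lam2))"
          using p2 by (simp add: powr_add)
        also have "\<dots> \<le> real p powr (- (real k * lam1 / 2 - (lam2 + 2)) + - 2)"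
          using p2 exp_le[of k] by (intro powr_mono) auto
        also have "\<dots> = real p powr (- (real k * lam1 / 2 - (lam2 + 2))) * (1 / (real p)\<^sup>2)"
        proof -
          have "real p powr - 2 = 1 / (real p)\<^sup>2" using p2 by (simp add: powr_minus divide_inverse)
          then show ?thesis by (simp only: powr_add)
        qed
        also have "\<dots> \<le> 2 powr (- (real k * lam1 / 2 - (lam2 + 2))) * (1 / (real p)\<^sup>2)"
          using p2 e by (intro mult_right_mono powr_mono2') auto
        also have "2 powr (- (real k * lam1 / 2 - (lam2 + 2))) = 2 powr (lam2 + 2) * \<sigma> ^ k"
          by (simp add: \<sigma>_pow flip: powr_add)
        finally show ?thesis using False by simp
      qed
    qed
    also have "\<dots> = ((\<Sum>k = 2..N. if k < k0 then ?b else 0) + 2 powr (lam2 + 2) * (\<Sum>k = 2..N. \<sigma> ^ k)) * (1 / (real p)\<^sup>2)"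
      unfolding sum_distrib_left sum.distrib[symmetric] sum_distrib_right ..
    also have "\<dots> \<le> (real k0 * ?b + 2 powr (lam2 + 2) * (1 / (1 - \<sigma>))) * (1 / (real p)\<^sup>2)"
    proof (intro mult_right_mono add_mono mult_left_mono sum_\<sigma>_le)
      have "(\<Sum>k = 2..N. if k < k0 then ?b else 0) \<le> (\<Sum>k<N + k0 + 1. if k < k0 then ?b else 0)"
        using b by (intro sum_mono2) auto
      also have "\<dots> = (\<Sum>k<k0. ?b)"
        by (intro sum.mono_neutral_cong_right) auto
      finally show "(\<Sum>k = 2..N. if k < k0 then ?b else 0) \<le> real k0 * ?b" by simp
    qed auto
    also have "\<dots> \<le> Gam Y * (1 / (real p)\<^sup>2)"
      using pos_parts unfolding Gam_def by (intro mult_right_mono) auto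
    finally show ?thesis by simp
  qed
  show "(\<Prod>p\<in>primes_in 0 W. if p dvd d then gam w \<beta> p (multiplicity p d) else 1) \<le> Gam Y * real d"
    if d: "0 < d" "prime_factors d \<subseteq> primes_in 0 W" for d
  proof -
    let ?P = "primes_in 0 W"
    have "(\<Prod>p\<in>?P. if p dvd d then gam w \<beta> p (multiplicity p d) else 1) \<le>
        (\<Prod>p\<in>?P. (if real p \<le> p0 then Ce else 1) * real (p ^ multiplicity p d))"
    proof (rule prod_mono)
      fix p assume "p \<in> ?P"
      then have p: "prime p" by (rule primes_in_prime)
      have p1: "1 \<le> real p" using prime_ge_1_nat[OF p] by simp
      let ?k = "multiplicity p d"
      have "gam w \<beta> p ?k \<le> (if real p \<le> p0 then Ce else 1) * real (p ^ ?k)" if "p dvd d"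
      proof -
        have k: "1 \<le> ?k" using that p d by (simp add: Suc_le_eq prime_multiplicity_gt_zero_iff)
        have "real p powr (real ?k * (\<epsilon> + \<beta>)) \<le> real p powr (real ?k)"
          using p1 \<beta> \<epsilon> mult_left_le[of "\<epsilon> + \<beta>" "real ?k"] by (intro powr_mono) auto
        also have "\<dots> = real (p ^ ?k)" using p1 by (simp add: powr_realpow)
        finally have "(if real p \<le> p0 then Ce else 1) * real p powr (real ?k * (\<epsilon> + \<beta>)) \<le>
            (if real p \<le> p0 then Ce else 1) * real (p ^ ?k)" using Ce by (intro mult_left_mono) auto
        with gam_le_powr[OF p \<beta>(1) k, of w] show ?thesis by linarith
      qed
      moreover have "1 \<le> (if real p \<le> p0 then Ce else 1) * real (p ^ ?k)"
        using mult_mono[of 1 "if real p \<le> p0 then Ce else 1" 1 "real (p ^ ?k)"] Ce p1 by auto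
      ultimately show "0 \<le> (if p dvd d then gam w \<beta> p ?k else 1) \<and> (if p dvd d then gam w \<beta> p ?k else 1)
          \<le> (if real p \<le> p0 then Ce else 1) * real (p ^ ?k)"
        using gam_nonneg[OF p \<beta>(1)] by auto
    qed
    also have "\<dots> = (\<Prod>p\<in>?P. if real p \<le> p0 then Ce else 1) * real (\<Prod>p\<in>?P. p ^ multiplicity p d)"
      by (simp add: prod.distrib)
    also have "(\<Prod>p\<in>?P. p ^ multiplicity p d) = d"
      using d by (intro prime_power_prod_eq) (auto simp: primes_in_prime)
    also have "(\<Prod>p\<in>?P. if real p \<le> p0 then Ce else 1) \<le> Ce powr p0"
    proof -
      have "(\<Prod>p\<in>?P. if real p \<le> p0 then Ce else 1) = (\<Prod>p | p \<in> ?P \<and> real p \<le> p0. Ce)"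
        by (subst prod.inter_filter) simp_all
      also have "\<dots> = Ce ^ card {p \<in> ?P. real p \<le> p0}" by (rule prod_constant)
      also have "\<dots> = Ce powr real (card {p \<in> ?P. real p \<le> p0})" using Ce by (simp add: powr_realpow)
      also have "\<dots> \<le> Ce powr p0"
      proof (intro powr_mono)
        have "card {p \<in> ?P. real p \<le> p0} \<le> card (primes_in 0 p0)"
          by (intro card_mono finite_primes_in) (auto simp: primes_in_def)
        moreover have "real (card (primes_in 0 p0)) \<le> p0" using p0 by (intro card_primes_in_le) simp
        ultimately show "real (card {p \<in> ?P. real p \<le> p0}) \<le> p0" by linarith
      qed (use Ce in auto)
      finally show ?thesis .
    qed
    then have "(\<Prod>p\<in>?P. if real p \<le> p0 then Ce else 1) * real d \<le> Ce powr p0 * real d"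
      by (intro mult_right_mono) auto
    also have "\<dots> \<le> Gam Y * real d"
      using pos_parts unfolding Gam_def by (intro mult_right_mono) auto
    finally show ?thesis .
  qed
qed

text \<open>Prime by prime, the left factor is at most the sum of the local factors
  \<open>t p k\<close> over exponents \<open>k\<close> up to that of \<open>D\<close>; multiplying
  out gives a sum over the divisors of \<open>D\<close>. As \<open>D\<close> contains the whole
  \<open>w\<close>-smooth part, its exponents at primes up to \<open>w\<close> are those of
  \<open>n\<close>.\<close>

lemma sieve_majorant:
  assumes sw: "sieve_weights \<kappa> lam1 lam2 B K C p0 h w W X \<Gamma> (gam w \<beta>) sieve_x"
    and \<beta>: "0 \<le> \<beta>" and n: "0 < n"
    and D: "D dvd n" "smooth_part w n dvd D" "prime_factors D \<subseteq> primes_in 0 W" "real D \<le> X"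
  shows "F (smooth_part w n) * real D powr \<beta> \<le>
    (\<Sum>d | d \<in> sieve_weights.divs W X \<and> d dvd n.
      sieve_weights.G W (gam w \<beta>) d * (\<Prod>p | p \<in> sieve_weights.Q p0 w d \<and> p dvd n. 1 - sieve_x p))"
proof -
  interpret sieve_weights \<kappa> lam1 lam2 B K C p0 h w W X \<Gamma> "gam w \<beta>" sieve_x by (rule sw)
  let ?P = "primes_in 0 W" and ?e = "\<lambda>p. multiplicity p D" and ?m = "\<lambda>p. multiplicity p n"
  \<comment> \<open>The local factors of the right side: with exponent 0 the prime is left to the
    sieve, with a positive exponent it belongs to the divisor.\<close>
  define t where "t p k = (if k = 0 then (if p \<in> primes_in p0 w \<and> p dvd n then 1 - sieve_x p else 1)
    else gam w \<beta> p k)" for p k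
  have P: "finite ?P" "\<And>p. p \<in> ?P \<Longrightarrow> prime p" by (auto simp: primes_in_prime)
  have D0: "0 < D" using D(1) n by (rule dvd_pos_nat[rotated])
  have Dprod: "(\<Prod>p\<in>?P. p ^ ?e p) = D" using P D D0 by (intro prime_power_prod_eq) auto
  have t0: "0 \<le> t p k" if "prime p" for p k
    using that x gam_nonneg[OF that \<beta>] by (auto simp: t_def)
  have F1: "F 1 = 1" using F_mult by (simp add: multiplicative_fun_def)
  have "smooth_part w n = (\<Prod>p\<in>?P. p ^ (if real p \<le> w then ?m p else 0))"
    unfolding smooth_part_def using wW by (intro prod.mono_neutral_cong_left finite_primes_in) (auto simp: primes_in_def)
  then have "F (smooth_part w n) = (\<Prod>p\<in>?P. F (p ^ (if real p \<le> w then ?m p else 0)))"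
    using multiplicative_fun_prime_power_prod[OF F_mult P] by metis
  moreover have "real D powr \<beta> = (\<Prod>p\<in>?P. real p powr (\<beta> * real (?e p)))"
  proof -
    have "real D powr \<beta> = real (\<Prod>p\<in>?P. p ^ ?e p) powr \<beta>" by (simp only: Dprod)
    also have "\<dots> = (\<Prod>p\<in>?P. real (p ^ ?e p) powr \<beta>)"
      unfolding of_nat_prod by (rule prod_powr_distrib)
    also have "\<dots> = (\<Prod>p\<in>?P. real p powr (\<beta> * real (?e p)))"
    proof (rule prod.cong)
      fix p assume "p \<in> ?P"
      then have "0 < real p" using P prime_gt_0_nat by auto
      then show "real (p ^ ?e p) powr \<beta> = real p powr (\<beta> * real (?e p))"
        by (simp add: powr_powr mult.commute flip: powr_realpow)
    qed simp
    finally show ?thesis .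
  qed
  ultimately have "F (smooth_part w n) * real D powr \<beta> =
      (\<Prod>p\<in>?P. F (p ^ (if real p \<le> w then ?m p else 0)) * real p powr (\<beta> * real (?e p)))"
    by (simp add: prod.distrib)
  also have "\<dots> \<le> (\<Prod>p\<in>?P. \<Sum>k\<le>?e p. t p k)"
  proof (rule prod_mono)
    fix p assume pP: "p \<in> ?P"
    then have p: "prime p" using P by simp
    have p1: "1 \<le> real p" using prime_ge_1_nat[OF p] by simp
    let ?v = "F (p ^ (if real p \<le> w then ?m p else 0)) * real p powr (\<beta> * real (?e p))"
    have em: "?m p = ?e p" if "real p \<le> w"
    proof (rule antisym)
      show "?m p \<le> ?e p"
        using dvd_imp_multiplicity_le[OF D(2), of p] D0 p that by (simp add: multiplicity_smooth_part)
      show "?e p \<le> ?m p" using dvd_imp_multiplicity_le[OF D(1), of p] n by simp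
    qed
    have single: "t p k \<le> (\<Sum>k\<le>?e p. t p k)" if "k \<le> ?e p" for k
      using that t0[OF p] by (intro member_le_sum) auto
    have "?v \<le> (\<Sum>k\<le>?e p. t p k)"
    proof (cases "?e p = 0")
      case True
      have "t p 0 = 1"
      proof (cases "p \<in> primes_in p0 w")
        case True
        then have "?m p = 0" using em \<open>?e p = 0\<close> by (simp add: primes_in_def)
        then have "\<not> p dvd n" using p n prime_multiplicity_gt_zero_iff[of p n] by auto
        then show ?thesis by (simp add: t_def)
      qed (simp add: t_def)
      then show ?thesis using True em F1 p1 by auto
    next
      case False
      then have e1: "1 \<le> ?e p" by simp
      define u where "u = F (p ^ (if real p \<le> w then ?e p else 0))"
      have v: "?v = u * real p powr (real (?e p) * \<beta>)" using em by (auto simp: u_def mult.commute)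
      have pw: "1 \<le> real p powr (real (?e p) * \<epsilon>)" using p1 \<epsilon> by (intro ge_one_powr_ge_zero) auto
      \<comment> \<open>Only the second case needs two summands: \<open>t p 0 + t p 1\<close> equals
        \<open>F p * p powr \<beta>\<close>, as the minimum cancels. In the others a single summand
        is a majorant.\<close>
      consider "real p \<le> p0" | "p0 < real p" "?e p = 1" "real p \<le> w"
        | "p0 < real p" "?e p = 1" "w < real p" | "p0 < real p" "2 \<le> ?e p" using e1 by linarith
      then show ?thesis
      proof cases
        case 1
        have "u \<le> Ce * real p powr (real (?e p) * \<epsilon>)"
        proof (cases "real p \<le> w")
          case True
          have "F (p ^ ?e p) \<le> Ce * real (p ^ ?e p) powr \<epsilon>" using p by (intro F_le) (simp add: prime_gt_0_nat)
          also have "real (p ^ ?e p) powr \<epsilon> = real p powr (real (?e p) * \<epsilon>)"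
            using p1 by (simp add: powr_powr flip: powr_realpow)
          finally show ?thesis using True by (simp add: u_def)
        next
          case False
          then show ?thesis using F1 Ce pw mult_mono[of 1 Ce 1 "real p powr (real (?e p) * \<epsilon>)"] by (simp add: u_def)
        qed
        then have "u * real p powr (real (?e p) * \<beta>) \<le>
            Ce * real p powr (real (?e p) * \<epsilon>) * real p powr (real (?e p) * \<beta>)"
          by (intro mult_right_mono) auto
        also have "\<dots> = t p (?e p)" using 1 False by (simp add: t_def gam_def powr_add algebra_simps)
        also have "\<dots> \<le> (\<Sum>k\<le>?e p. t p k)" by (rule single) simp
        finally show ?thesis unfolding v .
      next
        case 2
        have "p \<in> primes_in p0 w" "p dvd n"
          using 2 p em[OF 2(3)] n prime_multiplicity_gt_zero_iff[of p n] by (auto simp: primes_in_def)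
        then have "t p 0 = min (F p) 1" by (auto simp: t_def sieve_x_def)
        moreover have "t p 1 = F p * real p powr \<beta> - min (F p) 1" using 2 by (simp add: t_def gam_def)
        moreover have "{..?e p} = {0, 1}" using 2 by auto
        ultimately show ?thesis unfolding v using 2 by (simp add: u_def)
      next
        case 3
        have "?v = t p 1" unfolding v using 3 F1 by (simp add: u_def t_def gam_def)
        then show ?thesis using single[of 1] 3 by simp
      next
        case 4
        have "1 \<le> A0 ^ ?e p" using A0 by simp
        then have "u \<le> A0 ^ ?e p" using F_pow[OF p, of "?e p"] F1 by (simp add: u_def)
        then have "u * real p powr (real (?e p) * \<beta>) \<le> A0 ^ ?e p * real p powr (real (?e p) * \<beta>)"
          by (intro mult_right_mono) auto
        also have "\<dots> = t p (?e p)" using 4 by (simp add: t_def gam_def)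
        also have "\<dots> \<le> (\<Sum>k\<le>?e p. t p k)" by (rule single) simp
        finally show ?thesis unfolding v .
      qed
    qed
    moreover have "0 \<le> ?v" using F_prime_nonneg[OF p] by simp
    ultimately show "0 \<le> ?v \<and> ?v \<le> (\<Sum>k\<le>?e p. t p k)" by simp
  qed
  also have "\<dots> = (\<Sum>d | d dvd D. \<Prod>p\<in>?P. t p (multiplicity p d))"
    using sum_divisors_prime_power_prod[OF P, of t ?e] by (simp add: Dprod)
  also have "\<dots> = (\<Sum>d | d dvd D. G d * (\<Prod>p | p \<in> Q d \<and> p dvd n. 1 - sieve_x p))"
  proof (rule sum.cong)
    fix d assume "d \<in> {d. d dvd D}"
    then have d0: "0 < d" using D0 by (auto intro: dvd_pos_nat)
    have "(\<Prod>p\<in>?P. t p (multiplicity p d)) = (\<Prod>p\<in>?P. (if p dvd d then gam w \<beta> p (multiplicity p d) else 1) *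
        (if p \<in> Q d \<and> p dvd n then 1 - sieve_x p else 1))"
    proof (rule prod.cong)
      fix p assume "p \<in> ?P"
      then have "p dvd d \<longleftrightarrow> multiplicity p d \<noteq> 0"
        using P d0 prime_multiplicity_gt_zero_iff[of p d] by auto
      then show "t p (multiplicity p d) = (if p dvd d then gam w \<beta> p (multiplicity p d) else 1) *
        (if p \<in> Q d \<and> p dvd n then 1 - sieve_x p else 1)"
        by (auto simp: t_def Q_def)
    qed simp
    also have "\<dots> = G d * (\<Prod>p\<in>?P. if p \<in> Q d \<and> p dvd n then 1 - sieve_x p else 1)"
      by (simp add: prod.distrib G_def)
    also have "(\<Prod>p\<in>?P. if p \<in> Q d \<and> p dvd n then 1 - sieve_x p else 1) =
        (\<Prod>p | p \<in> Q d \<and> p dvd n. 1 - sieve_x p)"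
    proof (rule prod.mono_neutral_cong_right)
      show "{p. p \<in> Q d \<and> p dvd n} \<subseteq> ?P" using wW p0 by (auto simp: Q_def primes_in_def)
    qed auto
    finally show "(\<Prod>p\<in>?P. t p (multiplicity p d)) = G d * (\<Prod>p | p \<in> Q d \<and> p dvd n. 1 - sieve_x p)" .
  qed simp
  \<comment> \<open>The choice of \<open>D\<close> varies with \<open>n\<close>. Adding nonnegative
    terms removes \<open>D\<close>, so that the majorant can be summed over the sequence.\<close>
  also have "\<dots> \<le> (\<Sum>d | d \<in> divs \<and> d dvd n. G d * (\<Prod>p | p \<in> Q d \<and> p dvd n. 1 - sieve_x p))"
  proof (rule sum_mono2)
    show "{d. d dvd D} \<subseteq> {d. d \<in> divs \<and> d dvd n}"
    proof
      fix d assume "d \<in> {d. d dvd D}"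
      then have d: "d dvd D" by simp
      have "real d \<le> X" using dvd_imp_le[OF d D0] D(4) by linarith
      moreover have "prime_factors d \<subseteq> ?P" using dvd_prime_factors[OF _ d] D0 D(3) by auto
      ultimately show "d \<in> {d. d \<in> divs \<and> d dvd n}"
        using d D0 D(1) by (auto simp: divs_def intro: dvd_trans dvd_pos_nat)
    qed
    show "finite {d. d \<in> divs \<and> d dvd n}" using finite_divs by simp
    fix d assume "d \<in> {d. d \<in> divs \<and> d dvd n} - {d. d dvd D}"
    then have "0 < d" by (simp add: divs_def)
    then show "0 \<le> G d * (\<Prod>p | p \<in> Q d \<and> p dvd n. 1 - sieve_x p)"
      using G_nonneg x Q_prime by (intro mult_nonneg_nonneg prod_nonneg) auto
  qed
  finally show ?thesis .
qed

end

section \<open>The mean value bound\<close>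

text \<open>Raise \<open>y / m \<le> exp (y / m)\<close> to the power \<open>m\<close>.\<close>

lemma powr_mult_exp_minus_le:
  fixes y m :: real
  assumes "0 < y" "0 < m"
  shows "y powr m * exp (- y) \<le> m powr m"
proof -
  have "y / m \<le> exp (y / m)" using exp_ge_add_one_self[of "y / m"] by linarith
  then have "(y / m) powr m \<le> exp (y / m) powr m" using assms by (intro powr_mono2) auto
  also have "\<dots> = exp y" using assms by (simp add: powr_def)
  finally have "y powr m \<le> m powr m * exp y" using assms by (simp add: powr_divide field_simps)
  then show ?thesis by (simp add: exp_minus field_simps)
qed

text \<open>One fixed \<open>T\<close>: \<open>I\<close> is the support of the weights and
  \<open>M\<close> a number. The exponent in \<open>F_le_Ct\<close> is such that
  \<open>n \<le> M powr (2 * \<alpha>)\<close> implies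
  \<open>F n \<le> Ct * M powr (\<tau> * \<epsilon> / 4)\<close>, with \<tau> as defined
  below.\<close>

locale sieve_problem = weighted_density +
  fixes I :: "'b set" and \<mu> :: "'b \<Rightarrow> real" and c :: "'b \<Rightarrow> nat"
    and M \<theta> \<xi> \<alpha> Bt E1 E2 Ct :: real
  assumes I: "finite I" "\<And>a. a \<in> I \<Longrightarrow> 0 \<le> \<mu> a" "\<And>a. a \<in> I \<Longrightarrow> 0 < c a"
    and E12: "0 \<le> E1" "0 \<le> E2"
    and exponents: "0 < \<theta>" "\<theta> < 1" "0 < \<xi>" "\<xi> < 1" "0 < \<alpha>"
    and equi: "\<And>d. 0 < d \<Longrightarrow> real d \<le> M powr \<theta> \<Longrightarrow>
      \<exists>u v. \<bar>u\<bar> \<le> E1 * (\<Prod>p | p \<in> primes_in p0 M \<and> \<not> p dvd d. (1 - h p)\<^sup>2) \<and>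
        \<bar>v\<bar> \<le> E2 * M powr (1 - \<xi>) \<and> (\<Sum>a | a \<in> I \<and> d dvd c a. \<mu> a) = h d * M * (1 + u) + v"
    and c_le: "\<And>a. a \<in> I \<Longrightarrow> real (c a) \<le> Bt * M powr \<alpha>"
    and F_le_Ct: "\<And>n. 0 < n \<Longrightarrow> F n \<le> Ct * real n powr ((min \<theta> \<xi> / 8) * \<epsilon> / (8 * \<alpha>))"
    and Ct: "0 \<le> Ct"
begin

text \<open>With divisors up to \<open>M powr \<tau>\<close> and sieving limit at most
  \<open>M powr (\<tau> / 2)\<close>, the moduli stay below \<open>M powr (3 * \<tau>)\<close> and
  the remainders lose \<open>M powr (4 * \<tau>)\<close>. The 8 keeps the former below
  \<open>M powr \<theta>\<close> and the latter below half of the saving \<xi>.\<close>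

definition \<tau> :: real where "\<tau> = min \<theta> \<xi> / 8"
text \<open>An integer up to \<open>M powr (2 * \<alpha>)\<close> has at most
  \<open>\<rho> * 2 ^ j\<close> prime factors above \<open>w j\<close>.\<close>

definition \<rho> :: real where "\<rho> = 4 * \<alpha> / \<tau>"
text \<open>Chosen so that \<open>b * 2 ^ j\<close> exceeds
  \<open>\<rho> * ln A0 * 2 ^ Suc j\<close> by exactly \<open>2 ^ Suc j\<close>.\<close>

definition b :: real where "b = 2 * (\<rho> * ln A0 + 1)"
text \<open>Above this threshold the Rankin exponent \<open>b / ln (w j)\<close> is at most
  \<epsilon>.\<close>

definition W0 :: real where "W0 = p0 * exp (b / \<epsilon>)"
definition X :: real where "X = M powr \<tau>"
definition w :: "nat \<Rightarrow> real" where "w j = M powr (\<tau> / 2 / 2 ^ j)"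
definition weight :: real where "weight = exp (\<Sum>p\<in>primes_in p0 M. (F p - 1) * h p)"
text \<open>The constant with which \<open>M powr (- \<delta>)\<close> is absorbed into
  \<open>weight\<close>.\<close>

definition decay :: "real \<Rightarrow> real" where "decay \<delta> = exp K * (2 * \<kappa> / \<delta>) powr \<kappa>"
definition K1 :: "real \<Rightarrow> real" where
  "K1 Y = (exp (exp (3 * L0)) + E1 * exp (8 * B\<^sup>2)) * exp (Gam Y * p0 + 8 * Gam Y * B\<^sup>2 + 6 * Gam Y)"
definition K2 :: real where
  "K2 = K1 (exp b) * exp (A0 * (2 * (b * exp b * L0)) + exp b * L0 + K) + E2 * Gam (exp b) * decay (\<xi> / 2)"
definition Yt :: real where "Yt = W0\<^sup>2 powr \<epsilon>"
definition K3 :: real where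
  "K3 = K1 Yt * exp (Yt * (\<kappa> * ln (2 * ln (W0\<^sup>2) / ln p0) + K)) + E2 * Gam Yt"
text \<open>The summands belong to the smooth part at \<open>w 0\<close> being at most
  \<open>X\<close>, to the intermediate scales, and to the range where \<open>w j\<close> is
  bounded. The factor \<open>2 * (\<kappa> + 1) powr (\<kappa> + 1)\<close> bounds the sum over
  \<open>j\<close> of \<open>exp (- y) * y powr \<kappa>\<close> with
  \<open>y = 2 ^ Suc j\<close>.\<close>

definition K4 :: real where
  "K4 = exp (\<rho> * ln A0) * K2 * (4 / \<tau>) powr \<kappa>
     + K2 * (4 / \<tau>) powr \<kappa> * (2 * (\<kappa> + 1) powr (\<kappa> + 1)) + Ct * K3 * decay (\<tau> * \<epsilon> / 4)"

text \<open>Here \<open>v\<close> is the sieving limit, \<open>W\<close> bounds the primes of the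
  divisors and \<beta> is the Rankin exponent.\<close>

definition maj :: "real \<Rightarrow> real \<Rightarrow> real \<Rightarrow> nat \<Rightarrow> real" where
  "maj v W \<beta> n = (\<Sum>d | d \<in> sieve_weights.divs W X \<and> d dvd n.
      sieve_weights.G W (gam v \<beta>) d * (\<Prod>p | p \<in> sieve_weights.Q p0 v d \<and> p dvd n. 1 - sieve_x p))"

lemma \<tau>: "0 < \<tau>" "8 * \<tau> \<le> \<theta>" "8 * \<tau> \<le> \<xi>"
  using exponents by (auto simp: \<tau>_def)

lemma \<rho>_nonneg: "0 \<le> \<rho> * ln A0"
  using \<tau> exponents A0 by (simp add: \<rho>_def)

lemma b: "2 \<le> b"
  using \<rho>_nonneg by (simp add: b_def)

lemma W0: "p0 \<le> W0" "b / \<epsilon> \<le> ln W0" "3 \<le> W0"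
proof -
  have e: "0 \<le> b / \<epsilon>" using b \<epsilon> by simp
  show "p0 \<le> W0" using e p0 mult_left_mono[of 1 "exp (b / \<epsilon>)" p0] by (simp add: W0_def)
  then show "3 \<le> W0" using p0 by simp
  have "ln W0 = ln p0 + b / \<epsilon>" using p0 by (simp add: W0_def ln_mult)
  then show "b / \<epsilon> \<le> ln W0" using p0 by simp
qed

text \<open>The second condition simplifies the bound on \<open>c a\<close> to
  \<open>M powr (2 * \<alpha>)\<close>; the third puts the first scale above \<open>W0\<close>.
  Smaller \<open>M\<close> are treated by trivial bounds in the tail estimates.\<close>

context
  assumes M_large: "1 < M" "Bt \<le> M powr \<alpha>" "W0 \<le> M powr (\<tau> / 2)"
begin

lemma X_ge: "1 \<le> X"
  unfolding X_def using M_large \<tau> by (intro ge_one_powr_ge_zero) auto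

lemma M_powr_half_le: "M powr (\<tau> / 2) \<le> M"
proof -
  have "M powr (\<tau> / 2) \<le> M powr 1" using M_large \<tau> exponents by (intro powr_mono) auto
  then show ?thesis using M_large by simp
qed

lemma M_ge_W0: "W0 \<le> M"
  using M_powr_half_le M_large by simp

lemma ln_M: "1 \<le> ln M"
proof -
  have "3 \<le> M" using M_ge_W0 W0 by simp
  then show ?thesis using exp_le by (simp add: ln_ge_iff)
qed

section \<open>Comparison with the Euler product\<close>

lemma ln_p0: "1 \<le> ln p0"
  using p0 exp_le by (simp add: ln_ge_iff)

text \<open>As \<open>F p - 1 \<ge> - 1\<close>, omitting the primes between \<open>v\<close> and
  \<open>M\<close> costs at most \<open>exp\<close> of the sum of \<open>h\<close> over
  them.\<close>

lemma sum_F_h_le: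
  assumes v: "p0 \<le> v" "v \<le> M"
  shows "exp (\<Sum>p\<in>primes_in p0 v. (F p - 1) * h p) \<le> weight * (exp K * (2 * ln M / ln v) powr \<kappa>)"
proof -
  have lv: "0 < ln v" "ln v \<le> ln M" using v p0 by auto
  have "primes_in p0 M = primes_in p0 v \<union> primes_in v M" using v by (auto simp: primes_in_def)
  then have "(\<Sum>p\<in>primes_in p0 M. (F p - 1) * h p) =
      (\<Sum>p\<in>primes_in p0 v. (F p - 1) * h p) + (\<Sum>p\<in>primes_in v M. (F p - 1) * h p)"
    by (simp add: sum.union_disjoint primes_in_def disjoint_iff)
  moreover have "(\<Sum>p\<in>primes_in v M. - h p) \<le> (\<Sum>p\<in>primes_in v M. (F p - 1) * h p)"
  proof (rule sum_mono)
    fix p assume "p \<in> primes_in v M"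
    then have p: "prime p" by (rule primes_in_prime)
    have "- 1 * h p \<le> (F p - 1) * h p"
      using F_prime_nonneg'[OF p] h_prime_nonneg[OF p] by (intro mult_right_mono) auto
    then show "- h p \<le> (F p - 1) * h p" by simp
  qed
  ultimately have "(\<Sum>p\<in>primes_in p0 v. (F p - 1) * h p) \<le>
      (\<Sum>p\<in>primes_in p0 M. (F p - 1) * h p) + (\<Sum>p\<in>primes_in v M. h p)"
    by (simp add: sum_negf)
  also have "\<dots> \<le> (\<Sum>p\<in>primes_in p0 M. (F p - 1) * h p) + (\<kappa> * ln (2 * ln M / ln v) + K)"
    using sum_h_le[OF v] by simp
  finally have "exp (\<Sum>p\<in>primes_in p0 v. (F p - 1) * h p) \<le>
      exp ((\<Sum>p\<in>primes_in p0 M. (F p - 1) * h p) + (\<kappa> * ln (2 * ln M / ln v) + K))" by simp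
  also have "\<dots> = weight * (exp K * (2 * ln M / ln v) powr \<kappa>)"
    using lv by (simp add: weight_def exp_add powr_def)
  finally show ?thesis .
qed

text \<open>The previous lemma with \<open>v = p0\<close>, where the sum is empty, shows that
  \<open>weight\<close> is at least a constant times \<open>ln M powr (- \<kappa>)\<close>.\<close>

lemma powr_minus_le_weight:
  assumes \<delta>: "0 < \<delta>"
  shows "M powr (- \<delta>) \<le> decay \<delta> * weight"
proof -
  have "exp (\<Sum>p\<in>primes_in p0 p0. (F p - 1) * h p) \<le> weight * (exp K * (2 * ln M / ln p0) powr \<kappa>)"
    using M_ge_W0 W0 by (intro sum_F_h_le) auto
  moreover have "primes_in p0 p0 = {}" by (auto simp: primes_in_def)
  ultimately have "1 \<le> weight * (exp K * (2 * ln M / ln p0) powr \<kappa>)" by simp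
  also have "\<dots> \<le> weight * (exp K * (2 * \<kappa> / \<delta> * M powr (\<delta> / \<kappa>)) powr \<kappa>)"
  proof (intro mult_left_mono powr_mono2)
    have "2 * ln M / ln p0 \<le> 2 * ln M / 1" using ln_p0 ln_M by (intro divide_left_mono) auto
    also have "ln M \<le> M powr (\<delta> / \<kappa>) / (\<delta> / \<kappa>)"
      using M_large \<delta> pos by (intro ln_powr_bound) auto
    finally show "2 * ln M / ln p0 \<le> 2 * \<kappa> / \<delta> * M powr (\<delta> / \<kappa>)" by (simp add: field_simps)
  qed (use ln_p0 ln_M pos in \<open>auto simp: weight_def\<close>)
  also have "\<dots> = decay \<delta> * weight * M powr \<delta>"
  proof -
    have "(2 * \<kappa> / \<delta> * M powr (\<delta> / \<kappa>)) powr \<kappa> = (2 * \<kappa> / \<delta>) powr \<kappa> * M powr \<delta>"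
      using \<delta> pos by (subst powr_mult) (simp_all add: powr_powr)
    then show ?thesis by (simp add: decay_def)
  qed
  finally show ?thesis using M_large by (simp add: powr_minus field_simps)
qed

section \<open>Mean values of the majorants\<close>

lemma maj_nonneg:
  assumes "sieve_weights \<kappa> lam1 lam2 B K C p0 h v W X \<Gamma> (gam v \<beta>) sieve_x"
  shows "0 \<le> maj v W \<beta> n"
proof -
  interpret sieve_weights \<kappa> lam1 lam2 B K C p0 h v W X \<Gamma> "gam v \<beta>" sieve_x by (rule assms)
  show ?thesis
    unfolding maj_def using G_nonneg x Q_prime
    by (intro sum_nonneg mult_nonneg_nonneg prod_nonneg) (auto simp: divs_def)
qed

lemma sum_maj_le:
  assumes v: "1 \<le> v" "v \<le> M powr (\<tau> / 2)"
    and sw: "sieve_weights \<kappa> lam1 lam2 B K C p0 h v W X (Gam Y) (gam v \<beta>) sieve_x"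
  shows "(\<Sum>a\<in>I. \<mu> a * maj v W \<beta> (c a)) \<le>
    K1 Y * M * exp ((\<Sum>p\<in>primes_in p0 W. gam v \<beta> p 1 * h p) - (\<Sum>p\<in>primes_in p0 v. sieve_x p * h p))
    + E2 * Gam Y * M * M powr (- (\<xi> / 2))"
proof -
  interpret sw: sieve_weights \<kappa> lam1 lam2 B K C p0 h v W X "Gam Y" "gam v \<beta>" sieve_x by (rule sw)
  have "v ^ 4 \<le> (M powr (\<tau> / 2)) ^ 4" using v by (intro power_mono) auto
  also have "\<dots> = M powr (2 * \<tau>)" using M_large by (simp add: powr_power mult.commute)
  finally have v4: "v ^ 4 \<le> M powr (2 * \<tau>)" .
  have "X * v ^ 4 \<le> M powr \<tau> * M powr (2 * \<tau>)" unfolding X_def using v4 by (intro mult_left_mono) auto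
  also have "\<dots> = M powr (3 * \<tau>)" by (simp flip: powr_add)
  also have "\<dots> \<le> M powr \<theta>" using M_large \<tau> by (intro powr_mono) auto
  finally have Z: "X * v ^ 4 \<le> M powr \<theta>" .
  have "v \<le> M" using v M_powr_half_le by simp
  then have "(\<Sum>a\<in>I. \<mu> a * maj v W \<beta> (c a)) \<le>
      (exp (exp (3 * L0)) + E1 * exp (8 * B\<^sup>2)) * exp (Gam Y * p0 + 8 * Gam Y * B\<^sup>2 + 6 * Gam Y) * M *
        exp ((\<Sum>p\<in>primes_in p0 W. gam v \<beta> p 1 * h p) - (\<Sum>p\<in>primes_in p0 v. sieve_x p * h p))
      + E2 * Gam Y * M powr (1 - \<xi>) * X\<^sup>2 * v ^ 4"
    unfolding maj_def using I E12 Z equi by (intro sw.sieve_bound) auto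
  also have "E2 * Gam Y * M powr (1 - \<xi>) * X\<^sup>2 * v ^ 4 \<le> E2 * Gam Y * M * M powr (- (\<xi> / 2))"
  proof -
    have "M powr (1 - \<xi>) * X\<^sup>2 * v ^ 4 \<le> M powr (1 - \<xi>) * X\<^sup>2 * M powr (2 * \<tau>)"
      using v4 by (intro mult_left_mono) auto
    also have "\<dots> = M powr (1 - \<xi> + 4 * \<tau>)"
      using M_large by (simp add: X_def powr_power algebra_simps flip: powr_add)
    also have "\<dots> \<le> M powr (1 + - (\<xi> / 2))" using M_large \<tau> by (intro powr_mono) auto
    also have "\<dots> = M * M powr (- (\<xi> / 2))" using M_large by (simp only: powr_add) simp
    finally have "E2 * Gam Y * (M powr (1 - \<xi>) * X\<^sup>2 * v ^ 4) \<le> E2 * Gam Y * (M * M powr (- (\<xi> / 2)))"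
      using E12 sw.\<Gamma> by (intro mult_left_mono) auto
    then show ?thesis by (simp add: mult_ac)
  qed
  finally show ?thesis by (simp add: K1_def)
qed

lemma K1_nonneg: "0 \<le> K1 Y"
  using E12 by (simp add: K1_def)

text \<open>Up to \<open>v\<close>, divisor weight and sieve together restore \<open>F p - 1\<close>
  with an error from the Rankin factor that is bounded in total. Between \<open>v\<close> and
  \<open>W \<le> v\<^sup>2\<close> the mass of \<open>h\<close> is at most \<open>L0\<close>, so
  crude weights suffice.\<close>

lemma sum_maj_le_main:
  assumes v: "p0 \<le> v" "v \<le> W" "W \<le> v\<^sup>2" "v \<le> M powr (\<tau> / 2)"
    and \<beta>: "0 \<le> \<beta>" "\<beta> \<le> \<epsilon>" "\<beta> * ln W \<le> b"
  shows "(\<Sum>a\<in>I. \<mu> a * maj v W \<beta> (c a)) \<le> K2 * (2 * ln M / ln v) powr \<kappa> * (M * weight)"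
    and "0 \<le> maj v W \<beta> n"
proof -
  have v3: "3 \<le> v" using v p0 by simp
  have W3: "3 \<le> W" using v v3 by simp
  have WY: "W powr \<beta> \<le> exp b" using \<beta> W3 by (simp add: powr_def)
  have sw: "sieve_weights \<kappa> lam1 lam2 B K C p0 h v W X (Gam (exp b)) (gam v \<beta>) sieve_x"
    using v v3 \<beta> WY X_ge by (intro sieve_weights_gam) auto
  then show "0 \<le> maj v W \<beta> n" by (rule maj_nonneg)
  interpret sw: sieve_weights \<kappa> lam1 lam2 B K C p0 h v W X "Gam (exp b)" "gam v \<beta>" sieve_x by (rule sw)
  have vM: "v \<le> M" using v M_powr_half_le by simp
  have split: "primes_in p0 W = primes_in p0 v \<union> primes_in v W" using v by (auto simp: primes_in_def)
  have "(\<Sum>p\<in>primes_in p0 W. gam v \<beta> p 1 * h p) - (\<Sum>p\<in>primes_in p0 v. sieve_x p * h p) =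
      (\<Sum>p\<in>primes_in p0 v. gam v \<beta> p 1 * h p - sieve_x p * h p) + (\<Sum>p\<in>primes_in v W. gam v \<beta> p 1 * h p)"
    unfolding split sum_subtractf by (subst sum.union_disjoint) (auto simp: primes_in_def)
  also have "(\<Sum>p\<in>primes_in p0 v. gam v \<beta> p 1 * h p - sieve_x p * h p) \<le>
      (\<Sum>p\<in>primes_in p0 v. (F p - 1) * h p + A0 * ((real p powr \<beta> - 1) * h p))"
  proof (rule sum_mono)
    fix p assume "p \<in> primes_in p0 v"
    then have p: "prime p" "p0 < real p" "real p \<le> v" by (auto simp: primes_in_def)
    have p1: "1 \<le> real p powr \<beta>" using p p0 \<beta> by (intro ge_one_powr_ge_zero) auto
    \<comment> \<open>The identity behind the choice of the weights: the minimum of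
      \<open>F p\<close> and 1 cancels.\<close>
    have "gam v \<beta> p 1 * h p - sieve_x p * h p = (F p - 1) * h p + F p * ((real p powr \<beta> - 1) * h p)"
      using p by (auto simp: gam_def sieve_x_def algebra_simps min_def max_def)
    also have "F p * ((real p powr \<beta> - 1) * h p) \<le> A0 * ((real p powr \<beta> - 1) * h p)"
      using p1 F_prime_le[OF p(1)] h_prime_nonneg[OF p(1)] by (intro mult_right_mono) auto
    finally show "gam v \<beta> p 1 * h p - sieve_x p * h p \<le>
        (F p - 1) * h p + A0 * ((real p powr \<beta> - 1) * h p)" by simp
  qed
  also have "\<dots> = (\<Sum>p\<in>primes_in p0 v. (F p - 1) * h p) + A0 * (\<Sum>p\<in>primes_in p0 v. (real p powr \<beta> - 1) * h p)"
    by (simp add: sum.distrib sum_distrib_left)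
  also have "(\<Sum>p\<in>primes_in p0 v. (real p powr \<beta> - 1) * h p) \<le> 2 * (b * exp b * L0)"
  proof (rule sum_powr_minus_one_le)
    have "\<beta> * ln v \<le> \<beta> * ln W" using v v3 \<beta> by (intro mult_left_mono) auto
    then show "\<beta> * ln v \<le> b" using \<beta> by simp
  qed (use v3 \<beta> in auto)
  also have "(\<Sum>p\<in>primes_in v W. gam v \<beta> p 1 * h p) \<le> (\<Sum>p\<in>primes_in v W. exp b * h p)"
  proof (rule sum_mono)
    fix p assume "p \<in> primes_in v W"
    then have p: "prime p" "v < real p" "real p \<le> W" by (auto simp: primes_in_def)
    have "real p powr \<beta> \<le> W powr \<beta>" using p \<beta> by (intro powr_mono2) auto
    then have "gam v \<beta> p 1 \<le> exp b" using p v WY by (simp add: gam_def)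
    then show "gam v \<beta> p 1 * h p \<le> exp b * h p" using h_prime_nonneg[OF p(1)] by (intro mult_right_mono)
  qed
  also have "\<dots> = exp b * (\<Sum>p\<in>primes_in v W. h p)" by (simp add: sum_distrib_left)
  also have "\<dots> \<le> exp b * L0" using v by (intro mult_left_mono sum_h_le_L0) auto
  finally have "(\<Sum>p\<in>primes_in p0 W. gam v \<beta> p 1 * h p) - (\<Sum>p\<in>primes_in p0 v. sieve_x p * h p) \<le>
      (\<Sum>p\<in>primes_in p0 v. (F p - 1) * h p) + (A0 * (2 * (b * exp b * L0)) + exp b * L0)"
    using A0 by simp
  then have "exp ((\<Sum>p\<in>primes_in p0 W. gam v \<beta> p 1 * h p) - (\<Sum>p\<in>primes_in p0 v. sieve_x p * h p)) \<le>
      exp (\<Sum>p\<in>primes_in p0 v. (F p - 1) * h p) * exp (A0 * (2 * (b * exp b * L0)) + exp b * L0)"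
    by (simp flip: exp_add)
  also have "\<dots> \<le> (weight * (exp K * (2 * ln M / ln v) powr \<kappa>)) * exp (A0 * (2 * (b * exp b * L0)) + exp b * L0)"
    using sum_F_h_le[OF v(1) vM] by (intro mult_right_mono) auto
  also have "\<dots> = weight * (2 * ln M / ln v) powr \<kappa> * exp (A0 * (2 * (b * exp b * L0)) + exp b * L0 + K)"
    by (simp add: exp_add mult_ac)
  finally have main: "exp ((\<Sum>p\<in>primes_in p0 W. gam v \<beta> p 1 * h p) - (\<Sum>p\<in>primes_in p0 v. sieve_x p * h p)) \<le>
      weight * (2 * ln M / ln v) powr \<kappa> * exp (A0 * (2 * (b * exp b * L0)) + exp b * L0 + K)" .
  have ratio: "1 \<le> (2 * ln M / ln v) powr \<kappa>"
  proof (rule ge_one_powr_ge_zero)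
    have "ln v \<le> ln M" using vM v3 by simp
    then show "1 \<le> 2 * ln M / ln v" using v3 ln_M by (simp add: field_simps)
  qed (use pos in simp)
  have "(\<Sum>a\<in>I. \<mu> a * maj v W \<beta> (c a)) \<le>
    K1 (exp b) * M * exp ((\<Sum>p\<in>primes_in p0 W. gam v \<beta> p 1 * h p) - (\<Sum>p\<in>primes_in p0 v. sieve_x p * h p))
    + E2 * Gam (exp b) * M * M powr (- (\<xi> / 2))"
    using v v3 sw by (intro sum_maj_le) auto
  also have "\<dots> \<le> K1 (exp b) * M * (weight * (2 * ln M / ln v) powr \<kappa> * exp (A0 * (2 * (b * exp b * L0)) + exp b * L0 + K))
      + E2 * Gam (exp b) * M * (decay (\<xi> / 2) * weight * (2 * ln M / ln v) powr \<kappa>)"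
  proof (intro add_mono mult_left_mono main)
    have "M powr (- (\<xi> / 2)) \<le> decay (\<xi> / 2) * weight * 1"
      using powr_minus_le_weight[of "\<xi> / 2"] exponents by simp
    also have "\<dots> \<le> decay (\<xi> / 2) * weight * (2 * ln M / ln v) powr \<kappa>"
      using ratio by (intro mult_left_mono) (auto simp: decay_def weight_def)
    finally show "M powr (- (\<xi> / 2)) \<le> decay (\<xi> / 2) * weight * (2 * ln M / ln v) powr \<kappa>" .
  qed (use K1_nonneg M_large E12 sw.\<Gamma> in auto)
  also have "\<dots> = K2 * (2 * ln M / ln v) powr \<kappa> * (M * weight)"
    by (simp only: K2_def distrib_right distrib_left mult_ac)
  finally show "(\<Sum>a\<in>I. \<mu> a * maj v W \<beta> (c a)) \<le> K2 * (2 * ln M / ln v) powr \<kappa> * (M * weight)" .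
qed

text \<open>With sieving limit 1 no prime is sieved, and since \<open>W\<close> is bounded
  everything is a constant. The missing factor \<open>weight\<close> is later supplied by a negative
  power of \<open>M\<close>.\<close>

lemma sum_maj_le_tail:
  assumes W: "1 \<le> W" "W \<le> W0\<^sup>2"
  shows "(\<Sum>a\<in>I. \<mu> a * maj 1 W \<epsilon> (c a)) \<le> K3 * M" and "0 \<le> maj 1 W \<epsilon> n"
proof -
  have WY: "W powr \<epsilon> \<le> Yt" unfolding Yt_def using W \<epsilon> by (intro powr_mono2) auto
  have sw: "sieve_weights \<kappa> lam1 lam2 B K C p0 h 1 W X (Gam Yt) (gam 1 \<epsilon>) sieve_x"
    using W \<epsilon> WY X_ge by (intro sieve_weights_gam) auto
  then show "0 \<le> maj 1 W \<epsilon> n" by (rule maj_nonneg)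
  interpret sw: sieve_weights \<kappa> lam1 lam2 B K C p0 h 1 W X "Gam Yt" "gam 1 \<epsilon>" sieve_x by (rule sw)
  have "(\<Sum>p\<in>primes_in p0 W. gam 1 \<epsilon> p 1 * h p) \<le> (\<Sum>p\<in>primes_in p0 W. Yt * h p)"
  proof (rule sum_mono)
    fix p assume "p \<in> primes_in p0 W"
    then have p: "prime p" "p0 < real p" "real p \<le> W" by (auto simp: primes_in_def)
    have "real p powr \<epsilon> \<le> W powr \<epsilon>" using p \<epsilon> by (intro powr_mono2) auto
    then have "gam 1 \<epsilon> p 1 \<le> Yt" using p p0 WY by (simp add: gam_def)
    then show "gam 1 \<epsilon> p 1 * h p \<le> Yt * h p" using h_prime_nonneg[OF p(1)] by (intro mult_right_mono)
  qed
  also have "\<dots> = Yt * (\<Sum>p\<in>primes_in p0 W. h p)" by (simp add: sum_distrib_left)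
  also have "\<dots> \<le> Yt * (\<kappa> * ln (2 * ln (W0\<^sup>2) / ln p0) + K)"
  proof (rule mult_left_mono)
    have "(\<Sum>p\<in>primes_in p0 W. h p) \<le> (\<Sum>p\<in>primes_in p0 (W0\<^sup>2). h p)"
      using W by (intro sum_mono2 h_prime_nonneg finite_primes_in) (auto simp: primes_in_def)
    also have "\<dots> \<le> \<kappa> * ln (2 * ln (W0\<^sup>2) / ln p0) + K"
    proof (rule sum_h_le)
      have "W0 * 1 \<le> W0 * W0" using W0 by (intro mult_left_mono) auto
      then show "p0 \<le> W0\<^sup>2" using W0(1) unfolding power2_eq_square by linarith
    qed simp
    finally show "(\<Sum>p\<in>primes_in p0 W. h p) \<le> \<kappa> * ln (2 * ln (W0\<^sup>2) / ln p0) + K" .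
  qed (simp add: Yt_def)
  finally have main: "(\<Sum>p\<in>primes_in p0 W. gam 1 \<epsilon> p 1 * h p) \<le> Yt * (\<kappa> * ln (2 * ln (W0\<^sup>2) / ln p0) + K)" .
  have empty: "primes_in p0 1 = {}" using p0 by (auto simp: primes_in_def)
  have "(\<Sum>a\<in>I. \<mu> a * maj 1 W \<epsilon> (c a)) \<le>
    K1 Yt * M * exp ((\<Sum>p\<in>primes_in p0 W. gam 1 \<epsilon> p 1 * h p) - (\<Sum>p\<in>primes_in p0 1. sieve_x p * h p))
    + E2 * Gam Yt * M * M powr (- (\<xi> / 2))"
    using M_large \<tau> sw by (intro sum_maj_le) (auto intro: ge_one_powr_ge_zero)
  also have "\<dots> \<le> K1 Yt * M * exp (Yt * (\<kappa> * ln (2 * ln (W0\<^sup>2) / ln p0) + K)) + E2 * Gam Yt * M * 1"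
  proof (intro add_mono mult_left_mono)
    have "M powr (- (\<xi> / 2)) \<le> M powr 0" using M_large exponents by (intro powr_mono) auto
    then show "M powr (- (\<xi> / 2)) \<le> 1" using M_large by simp
  qed (use main empty K1_nonneg M_large E12 sw.\<Gamma> in auto)
  also have "\<dots> = K3 * M" by (simp add: K3_def algebra_simps)
  finally show "(\<Sum>a\<in>I. \<mu> a * maj 1 W \<epsilon> (c a)) \<le> K3 * M" .
qed

section \<open>The scales and the pointwise bounds\<close>

lemma w_bounds:
  "1 < w j" "w 0 = M powr (\<tau> / 2)" "w j \<le> w 0" "w (Suc j) \<le> w j" "w j = (w (Suc j))\<^sup>2" "ln (w j) = \<tau> / 2 / 2 ^ j * ln M"
proof -
  show w0: "w 0 = M powr (\<tau> / 2)" by (simp add: w_def)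
  show w1: "1 < w j" for j using M_large \<tau> by (simp add: w_def)
  have "\<tau> / 2 / 2 ^ j \<le> \<tau> / 2 / 1" using \<tau> by (intro divide_left_mono) auto
  then show "w j \<le> w 0" using M_large by (simp add: w_def)
  show sq: "w j = (w (Suc j))\<^sup>2" using M_large by (simp add: w_def powr_power)
  show "w (Suc j) \<le> w j"
    using w1[of "Suc j"] mult_left_mono[of 1 "w (Suc j)" "w (Suc j)"] unfolding sq power2_eq_square by simp
  show "ln (w j) = \<tau> / 2 / 2 ^ j * ln M" using M_large by (simp add: w_def ln_powr)
qed

text \<open>At \<open>J\<close> the Rankin exponent is still admissible, while
  \<open>w J = (w (Suc J))\<^sup>2\<close> is below \<open>W0\<^sup>2\<close>, so the range left
  over is bounded.\<close>

lemma ex_last_index: "\<exists>J. (\<forall>j\<le>J. W0 \<le> w j) \<and> w (Suc J) < W0"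
proof -
  have "\<exists>j. w j < W0"
  proof -
    obtain j :: nat where j: "\<tau> / 2 * ln M < real j" using reals_Archimedean2 by blast
    have "real j < 2 ^ j" by (rule of_nat_less_two_power)
    then have "\<tau> / 2 * ln M < 2 ^ j" using j by linarith
    then have "ln (w j) < 1" unfolding w_bounds(6) by (simp add: field_simps)
    also have "1 \<le> ln W0" using W0(3) exp_le by (simp add: ln_ge_iff)
    finally have "w j < W0" using w_bounds(1)[of j] W0(3) by (subst (asm) ln_less_cancel_iff) auto
    then show ?thesis ..
  qed
  then obtain j where j: "w j < W0" "\<And>i. i < j \<Longrightarrow> W0 \<le> w i"
    using exists_least_iff[of "\<lambda>j. w j < W0"] by (auto simp: not_less)
  have "j \<noteq> 0"
  proof
    assume "j = 0"
    then show False using j(1) M_large w_bounds(2) by simp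
  qed
  then obtain J where "j = Suc J" using not0_implies_Suc by blast
  then show ?thesis using j by (intro exI[of _ J]) auto
qed

lemma ln_c_le:
  assumes "0 < n" "real n \<le> Bt * M powr \<alpha>"
  shows "ln (real n) \<le> 2 * \<alpha> * ln M"
proof -
  have "real n \<le> M powr \<alpha> * M powr \<alpha>"
    using assms(2) M_large(2) by (meson mult_right_mono order_trans powr_ge_zero)
  then have "ln (real n) \<le> ln (M powr \<alpha> * M powr \<alpha>)"
    using assms M_large by (subst ln_le_cancel_iff) auto
  then show ?thesis using M_large by (simp add: ln_mult ln_powr)
qed

lemma F_le_smooth_part:
  assumes "0 < n" "real n \<le> Bt * M powr \<alpha>"
  shows "F n \<le> F (smooth_part (w j) n) * exp (\<rho> * ln A0 * 2 ^ j)"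
proof -
  have "ln (real n) / ln (w j) \<le> 2 * \<alpha> * ln M / ln (w j)"
    using ln_c_le[OF assms] w_bounds(1)[of j] by (intro divide_right_mono) auto
  also have "\<dots> = \<rho> * 2 ^ j"
    unfolding w_bounds(6) \<rho>_def using ln_M \<tau> by (simp add: field_simps)
  finally have "A0 powr (ln (real n) / ln (w j)) \<le> A0 powr (\<rho> * 2 ^ j)"
    using A0 by (intro powr_mono) auto
  also have "\<dots> = exp (\<rho> * ln A0 * 2 ^ j)" using A0 by (simp add: powr_def mult_ac)
  finally have "F (smooth_part (w j) n) * A0 powr (ln (real n) / ln (w j)) \<le>
      F (smooth_part (w j) n) * exp (\<rho> * ln A0 * 2 ^ j)"
    by (intro mult_left_mono F_nonneg) auto
  moreover have "F n \<le> F (smooth_part (w j) n) * A0 powr (ln (real n) / ln (w j))"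
    using F_mult F_nonneg A0 F_pow assms w_bounds(1) by (intro le_smooth_part_mult) auto
  ultimately show ?thesis by simp
qed

lemma smooth_part_prime_factors:
  assumes "D dvd smooth_part W n"
  shows "prime_factors D \<subseteq> primes_in 0 W"
proof -
  have "prime_factors D \<subseteq> prime_factors (smooth_part W n)"
    using assms by (intro dvd_prime_factors) (use smooth_part_pos[of W n] in linarith)
  also have "\<dots> \<subseteq> primes_in 0 W"
    unfolding smooth_part_def by (rule prime_factors_prime_power_prod) (auto simp: primes_in_prime)
  finally show ?thesis .
qed

lemma X_half: "X = M powr (\<tau> / 2) * M powr (\<tau> / 2)"
  by (simp add: X_def flip: powr_add)

text \<open>The truncated divisor misses \<open>X\<close> by at most a factor \<open>w j\<close>,
  which is no more than the square root of \<open>X\<close>.\<close>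

lemma ex_divisor_near_X:
  assumes n: "0 < n" and v: "1 \<le> v" "v \<le> w j"
    and sp: "real (smooth_part v n) \<le> X" "X < real (smooth_part (w j) n)"
  shows "\<exists>D. D dvd n \<and> smooth_part v n dvd D \<and> prime_factors D \<subseteq> primes_in 0 (w j) \<and>
    real D \<le> X \<and> M powr (\<tau> / 2) \<le> real D"
proof -
  obtain D where D: "D dvd smooth_part (w j) n" "smooth_part v n dvd D" "real D \<le> X" "X < real D * w j"
    using ex_truncated_divisor[OF v sp] by blast
  have "M powr (\<tau> / 2) * M powr (\<tau> / 2) < real D * M powr (\<tau> / 2)"
    using D(4) mult_left_mono[OF w_bounds(3)[of j], of "real D"] w_bounds(2) X_half by simp
  then have "M powr (\<tau> / 2) \<le> real D" using M_large by (simp add: mult_less_cancel_right)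
  then show ?thesis
    using D smooth_part_prime_factors[OF D(1)] dvd_trans[OF D(1) smooth_part_dvd[OF n]] by blast
qed

lemma F_le_maj_0:
  assumes n: "0 < n" "real n \<le> Bt * M powr \<alpha>" and sp: "real (smooth_part (w 0) n) \<le> X"
  shows "F n \<le> exp (\<rho> * ln A0) * maj (w 0) (w 0) 0 n"
proof -
  have sw: "sieve_weights \<kappa> lam1 lam2 B K C p0 h (w 0) (w 0) X (Gam 1) (gam (w 0) 0) sieve_x"
    using w_bounds(1)[of 0] \<epsilon> X_ge by (intro sieve_weights_gam) auto
  \<comment> \<open>The smooth part itself serves as \<open>D\<close>; with exponent 0 there is no
    Rankin gain.\<close>
  have "F (smooth_part (w 0) n) * real (smooth_part (w 0) n) powr 0 \<le> maj (w 0) (w 0) 0 n"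
    unfolding maj_def using n sp smooth_part_dvd
    by (intro sieve_majorant[OF sw]) (auto intro!: smooth_part_prime_factors[OF dvd_refl])
  then have "F (smooth_part (w 0) n) \<le> maj (w 0) (w 0) 0 n"
    using smooth_part_pos[of "w 0" n] by simp
  then have "F (smooth_part (w 0) n) * exp (\<rho> * ln A0) \<le> maj (w 0) (w 0) 0 n * exp (\<rho> * ln A0)"
    by (intro mult_right_mono) auto
  moreover have "F n \<le> F (smooth_part (w 0) n) * exp (\<rho> * ln A0)"
    using F_le_smooth_part[OF n, of 0] by simp
  ultimately have "F n \<le> maj (w 0) (w 0) 0 n * exp (\<rho> * ln A0)" by linarith
  then show ?thesis by (simp only: mult.commute)
qed

lemma Rankin_exponent:
  assumes "W0 \<le> w j"
  shows "0 < b / ln (w j)" "b / ln (w j) \<le> \<epsilon>" "b / ln (w j) * ln (w j) = b"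
proof -
  have lw: "0 < ln (w j)" using w_bounds(1)[of j] by simp
  then show "0 < b / ln (w j)" "b / ln (w j) * ln (w j) = b" using b by auto
  have "ln W0 \<le> ln (w j)" using assms W0 by (subst ln_le_cancel_iff) auto
  then have "b / \<epsilon> \<le> ln (w j)" using W0(2) by simp
  then show "b / ln (w j) \<le> \<epsilon>" using \<epsilon> lw by (simp add: field_simps)
qed

text \<open>
  Rankin's trick: the truncated divisor exceeds \<open>X powr (1 / 2)\<close>, and \<open>b\<close> is so large that the gain
  \<open>exp (b * 2 ^ j)\<close> beats the loss \<open>A0 powr (\<rho> * 2 ^ Suc j)\<close> from the rough part of \<open>n\<close>.
\<close>

lemma F_le_maj_Suc:
  assumes n: "0 < n" "real n \<le> Bt * M powr \<alpha>"
    and j: "W0 \<le> w j" "real (smooth_part (w (Suc j)) n) \<le> X" "X < real (smooth_part (w j) n)"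
  shows "F n \<le> exp (- (2 ^ Suc j)) * maj (w (Suc j)) (w j) (b / ln (w j)) n"
proof -
  define \<beta> where "\<beta> = b / ln (w j)"
  note \<beta>0 = Rankin_exponent(1)[OF j(1), folded \<beta>_def] and \<beta>\<epsilon> = Rankin_exponent(2)[OF j(1), folded \<beta>_def]
  have "w j powr \<beta> = exp b"
    using Rankin_exponent(3)[OF j(1), folded \<beta>_def] w_bounds(1)[of j] by (simp add: powr_def)
  then have sw: "sieve_weights \<kappa> lam1 lam2 B K C p0 h (w (Suc j)) (w j) X (Gam (exp b)) (gam (w (Suc j)) \<beta>) sieve_x"
    using w_bounds(1)[of "Suc j"] w_bounds(4)[of j] \<beta>0 \<beta>\<epsilon> X_ge by (intro sieve_weights_gam) auto
  obtain D where D: "D dvd n" "smooth_part (w (Suc j)) n dvd D" "prime_factors D \<subseteq> primes_in 0 (w j)"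
      "real D \<le> X" "M powr (\<tau> / 2) \<le> real D"
    using ex_divisor_near_X[of n "w (Suc j)" j] n(1) w_bounds(1)[of "Suc j"] w_bounds(4)[of j] j by auto
  have "(M powr (\<tau> / 2)) powr \<beta> \<le> real D powr \<beta>"
    using \<beta>0 M_large D(5) by (intro powr_mono2) auto
  moreover have "(M powr (\<tau> / 2)) powr \<beta> = exp (b * 2 ^ j)"
  proof -
    have "\<tau> / 2 * \<beta> * ln M = b * 2 ^ j"
      unfolding \<beta>_def w_bounds(6) using \<tau> ln_M by (simp add: field_simps)
    moreover have "(M powr (\<tau> / 2)) powr \<beta> = exp (\<tau> / 2 * \<beta> * ln M)"
      unfolding powr_powr using M_large by (simp add: powr_def)
    ultimately show ?thesis by simp
  qed
  ultimately have D\<beta>: "exp (b * 2 ^ j) \<le> real D powr \<beta>" by simp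
  have maj: "F (smooth_part (w (Suc j)) n) * real D powr \<beta> \<le> maj (w (Suc j)) (w j) \<beta> n"
    unfolding maj_def using n D \<beta>0
    by (intro sieve_majorant[OF sw]) auto
  have "F n \<le> F (smooth_part (w (Suc j)) n) * exp (\<rho> * ln A0 * 2 ^ Suc j)"
    by (rule F_le_smooth_part[OF n])
  also have "\<rho> * ln A0 * 2 ^ Suc j = - (2 ^ Suc j) + b * 2 ^ j"
    by (simp add: b_def algebra_simps)
  also have "exp (- (2 ^ Suc j) + b * 2 ^ j) = exp (- (2 ^ Suc j)) * exp (b * 2 ^ j)" by (rule exp_add)
  also have "F (smooth_part (w (Suc j)) n) * (exp (- (2 ^ Suc j)) * exp (b * 2 ^ j)) \<le>
      F (smooth_part (w (Suc j)) n) * (exp (- (2 ^ Suc j)) * real D powr \<beta>)"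
    using D\<beta> by (intro mult_left_mono F_nonneg) auto
  also have "\<dots> = exp (- (2 ^ Suc j)) * (F (smooth_part (w (Suc j)) n) * real D powr \<beta>)" by simp
  also have "\<dots> \<le> exp (- (2 ^ Suc j)) * maj (w (Suc j)) (w j) \<beta> n"
    using maj by (intro mult_left_mono) auto
  finally show ?thesis unfolding \<beta>_def .
qed

text \<open>For bounded \<open>w j\<close> the count of large prime factors is useless. Instead,
  \<open>F n\<close> is at most \<open>Ct * M powr (\<tau> * \<epsilon> / 4)\<close>, while a
  divisor above the square root of \<open>X\<close> gives a Rankin gain of
  \<open>M powr (\<tau> * \<epsilon> / 2)\<close>.\<close>

lemma F_le_maj_tail:
  assumes n: "0 < n" "real n \<le> Bt * M powr \<alpha>"
    and j: "w j \<le> W0\<^sup>2" "X < real (smooth_part (w j) n)"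
  shows "F n \<le> Ct * M powr (- (\<tau> * \<epsilon> / 4)) * maj 1 (w j) \<epsilon> n"
proof -
  have Y: "w j powr \<epsilon> \<le> Yt" unfolding Yt_def using j(1) \<epsilon> w_bounds(1)[of j] by (intro powr_mono2) auto
  have sw: "sieve_weights \<kappa> lam1 lam2 B K C p0 h 1 (w j) X (Gam Yt) (gam 1 \<epsilon>) sieve_x"
    using w_bounds(1)[of j] \<epsilon> X_ge Y by (intro sieve_weights_gam) auto
  have "primes_in 0 1 = {}" by (auto simp: primes_in_def dest!: prime_gt_1_nat)
  then have sp1: "smooth_part 1 n = 1" by (simp add: smooth_part_def)
  obtain D where D: "D dvd n" "smooth_part 1 n dvd D" "prime_factors D \<subseteq> primes_in 0 (w j)"
      "real D \<le> X" "M powr (\<tau> / 2) \<le> real D"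
    using ex_divisor_near_X[of n 1 j] n(1) w_bounds(1)[of j] j X_ge sp1 by auto
  have "(M powr (\<tau> / 2)) powr \<epsilon> \<le> real D powr \<epsilon>"
    using \<epsilon> M_large D(5) by (intro powr_mono2) auto
  then have D\<epsilon>: "M powr (\<tau> * \<epsilon> / 2) \<le> real D powr \<epsilon>" by (simp add: powr_powr)
  have F1: "F 1 = 1" using F_mult by (simp add: multiplicative_fun_def)
  have "F (smooth_part 1 n) * real D powr \<epsilon> \<le> maj 1 (w j) \<epsilon> n"
    unfolding maj_def using n D \<epsilon>
    by (intro sieve_majorant[OF sw]) auto
  then have maj: "M powr (\<tau> * \<epsilon> / 2) \<le> maj 1 (w j) \<epsilon> n" using D\<epsilon> sp1 F1 by simp
  have "F n \<le> Ct * real n powr (\<tau> * \<epsilon> / (8 * \<alpha>))" using F_le_Ct[OF n(1)] by (simp add: \<tau>_def)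
  also have "\<dots> \<le> Ct * M powr (\<tau> * \<epsilon> / 4)"
  proof (rule mult_left_mono)
    have "\<tau> * \<epsilon> / (8 * \<alpha>) * ln (real n) \<le> \<tau> * \<epsilon> / (8 * \<alpha>) * (2 * \<alpha> * ln M)"
      using ln_c_le[OF n] \<tau> \<epsilon> exponents by (intro mult_left_mono) auto
    also have "\<dots> = \<tau> * \<epsilon> / 4 * ln M" using exponents by simp
    finally show "real n powr (\<tau> * \<epsilon> / (8 * \<alpha>)) \<le> M powr (\<tau> * \<epsilon> / 4)"
      using n M_large by (simp add: powr_def)
  qed (rule Ct)
  also have "M powr (\<tau> * \<epsilon> / 4) = M powr (- (\<tau> * \<epsilon> / 4)) * M powr (\<tau> * \<epsilon> / 2)"
    unfolding powr_add[symmetric] by (intro arg_cong[where f = "(powr) M"]) (simp add: field_simps)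
  also have "Ct * (M powr (- (\<tau> * \<epsilon> / 4)) * M powr (\<tau> * \<epsilon> / 2)) \<le>
      Ct * (M powr (- (\<tau> * \<epsilon> / 4)) * maj 1 (w j) \<epsilon> n)"
    using maj Ct by (intro mult_left_mono) auto
  finally show ?thesis by (simp add: mult_ac)
qed

text \<open>At scale \<open>j\<close> the sieve gives \<open>weight\<close> up to a loss of order
  \<open>2 powr (j * \<kappa>)\<close>; the factor \<open>exp (- (2 ^ Suc j))\<close> makes the sum
  over all scales converge.\<close>

theorem sum_F_le: "(\<Sum>a\<in>I. \<mu> a * F (c a)) \<le> K4 * (M * weight)"
proof -
  obtain J where J: "\<And>j. j \<le> J \<Longrightarrow> W0 \<le> w j" "w (Suc J) < W0" using ex_last_index by blast
  have wJ: "w J \<le> W0\<^sup>2"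
    using J(2) w_bounds(1)[of "Suc J"] unfolding w_bounds(5)[of J] by (intro power_mono) auto
  have wM: "w j \<le> M powr (\<tau> / 2)" for j using w_bounds(2,3) by metis
  let ?m0 = "\<lambda>n. exp (\<rho> * ln A0) * maj (w 0) (w 0) 0 n"
  let ?mj = "\<lambda>j n. exp (- (2 ^ Suc j)) * maj (w (Suc j)) (w j) (b / ln (w j)) n"
  let ?mt = "\<lambda>n. Ct * M powr (- (\<tau> * \<epsilon> / 4)) * maj 1 (w J) \<epsilon> n"
  have \<beta>: "0 \<le> b / ln (w j)" "b / ln (w j) \<le> \<epsilon>" "b / ln (w j) * ln (w j) \<le> b" if "j \<le> J" for j
    using Rankin_exponent[OF J(1)[OF that]] by linarith+
  have main: "(\<Sum>a\<in>I. \<mu> a * maj (w (Suc j)) (w j) (b / ln (w j)) (c a)) \<le> K2 * (4 / \<tau> * 2 ^ Suc j) powr \<kappa> * (M * weight)"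
    "0 \<le> maj (w (Suc j)) (w j) (b / ln (w j)) n" if "j < J" for j n
  proof -
    have v: "p0 \<le> w (Suc j)" "w (Suc j) \<le> w j" "w j \<le> (w (Suc j))\<^sup>2" "w (Suc j) \<le> M powr (\<tau> / 2)"
      using J(1)[of "Suc j"] that W0(1) w_bounds(4)[of j] w_bounds(5)[of j] wM[of "Suc j"] by auto
    have ratio: "2 * ln M / ln (w (Suc j)) = 4 / \<tau> * 2 ^ Suc j"
      unfolding w_bounds(6) using \<tau> ln_M by (simp add: field_simps)
    show "(\<Sum>a\<in>I. \<mu> a * maj (w (Suc j)) (w j) (b / ln (w j)) (c a)) \<le> K2 * (4 / \<tau> * 2 ^ Suc j) powr \<kappa> * (M * weight)"
      "0 \<le> maj (w (Suc j)) (w j) (b / ln (w j)) n"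
      using sum_maj_le_main[OF v \<beta>] that unfolding ratio by auto
  qed
  have main0: "(\<Sum>a\<in>I. \<mu> a * maj (w 0) (w 0) 0 (c a)) \<le> K2 * (4 / \<tau>) powr \<kappa> * (M * weight)"
    "0 \<le> maj (w 0) (w 0) 0 n" for n
  proof -
    have v: "p0 \<le> w 0" "w 0 \<le> w 0" "w 0 \<le> (w 0)\<^sup>2" "w 0 \<le> M powr (\<tau> / 2)"
      using J(1)[of 0] W0(1) w_bounds(1)[of 0] wM[of 0] mult_left_mono[of 1 "w 0" "w 0"]
      by (auto simp: power2_eq_square)
    have z: "0 \<le> (0 :: real)" "0 \<le> \<epsilon>" "0 * ln (w 0) \<le> b" using \<epsilon> b by auto
    have ratio: "2 * ln M / ln (w 0) = 4 / \<tau>"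
      unfolding w_bounds(6) using \<tau> ln_M by (simp add: field_simps)
    show "(\<Sum>a\<in>I. \<mu> a * maj (w 0) (w 0) 0 (c a)) \<le> K2 * (4 / \<tau>) powr \<kappa> * (M * weight)"
      "0 \<le> maj (w 0) (w 0) 0 n"
      using sum_maj_le_main[OF v z] unfolding ratio by auto
  qed
  have tail: "(\<Sum>a\<in>I. \<mu> a * maj 1 (w J) \<epsilon> (c a)) \<le> K3 * M" "0 \<le> maj 1 (w J) \<epsilon> n" for n
    using sum_maj_le_tail[of "w J"] w_bounds(1)[of J] wJ by auto
  have pointwise: "F n \<le> ?m0 n + (\<Sum>j<J. ?mj j n) + ?mt n"
    if n: "0 < n" "real n \<le> Bt * M powr \<alpha>" for n
  proof -
    have nonneg: "0 \<le> ?m0 n" "0 \<le> (\<Sum>j<J. ?mj j n)" "0 \<le> ?mt n"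
      using main main0 tail Ct by (auto intro!: sum_nonneg)
    consider "real (smooth_part (w 0) n) \<le> X" | "X < real (smooth_part (w J) n)"
      | "X < real (smooth_part (w 0) n)" "real (smooth_part (w J) n) \<le> X" by linarith
    then show ?thesis
    proof cases
      case 1
      then show ?thesis using F_le_maj_0[OF n] nonneg by linarith
    next
      case 2
      then show ?thesis using F_le_maj_tail[OF n wJ] nonneg by linarith
    next
      case 3
      define Q where "Q j \<longleftrightarrow> real (smooth_part (w j) n) \<le> X" for j
      have "Q J" using 3 by (simp add: Q_def)
      \<comment> \<open>The predecessor of the least such index is the scale at which
        \<open>F_le_maj_Suc\<close> applies.\<close>
      define i where "i = (LEAST j. Q j)"
      have i: "Q i" "i \<le> J" using \<open>Q J\<close> by (auto simp: i_def intro: LeastI Least_le)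
      have "i \<noteq> 0"
      proof
        assume "i = 0"
        then show False using i(1) 3(1) by (simp add: Q_def)
      qed
      then obtain j where j: "i = Suc j" using not0_implies_Suc by blast
      have "\<not> Q j" using not_less_Least[of j Q] j by (simp add: i_def)
      then have "F n \<le> ?mj j n"
        using i j J(1)[of j] by (intro F_le_maj_Suc[OF n]) (auto simp: Q_def)
      also have "\<dots> \<le> (\<Sum>j<J. ?mj j n)"
        using i j main by (intro member_le_sum) auto
      finally show ?thesis using nonneg by linarith
    qed
  qed
  have "(\<Sum>a\<in>I. \<mu> a * F (c a)) \<le> (\<Sum>a\<in>I. \<mu> a * (?m0 (c a) + (\<Sum>j<J. ?mj j (c a)) + ?mt (c a)))"
    using I c_le pointwise by (intro sum_mono mult_left_mono) auto
  also have "\<dots> = exp (\<rho> * ln A0) * (\<Sum>a\<in>I. \<mu> a * maj (w 0) (w 0) 0 (c a))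
      + (\<Sum>j<J. exp (- (2 ^ Suc j)) * (\<Sum>a\<in>I. \<mu> a * maj (w (Suc j)) (w j) (b / ln (w j)) (c a)))
      + Ct * M powr (- (\<tau> * \<epsilon> / 4)) * (\<Sum>a\<in>I. \<mu> a * maj 1 (w J) \<epsilon> (c a))"
    unfolding sum_distrib_left distrib_left sum.distrib
    by (subst sum.swap[of _ I]) (simp add: mult_ac)
  also have "\<dots> \<le> exp (\<rho> * ln A0) * (K2 * (4 / \<tau>) powr \<kappa> * (M * weight))
      + (\<Sum>j<J. exp (- (2 ^ Suc j)) * (K2 * (4 / \<tau> * 2 ^ Suc j) powr \<kappa> * (M * weight)))
      + Ct * (decay (\<tau> * \<epsilon> / 4) * weight) * (K3 * M)"
  proof (intro add_mono mult_left_mono sum_mono mult_mono)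
    show "M powr (- (\<tau> * \<epsilon> / 4)) \<le> decay (\<tau> * \<epsilon> / 4) * weight"
      using \<tau> \<epsilon> by (intro powr_minus_le_weight) auto
    have "0 \<le> (\<Sum>a\<in>I. \<mu> a * maj 1 (w J) \<epsilon> (c a))"
      using tail(2) I by (intro sum_nonneg mult_nonneg_nonneg) auto
    then show "0 \<le> (\<Sum>a\<in>I. \<mu> a * maj 1 (w J) \<epsilon> (c a))" .
  qed (use main main0 tail Ct in \<open>auto simp: decay_def weight_def\<close>)
  also have "(\<Sum>j<J. exp (- (2 ^ Suc j)) * (K2 * (4 / \<tau> * 2 ^ Suc j) powr \<kappa> * (M * weight))) \<le>
      K2 * (4 / \<tau>) powr \<kappa> * (2 * (\<kappa> + 1) powr (\<kappa> + 1)) * (M * weight)"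
  proof -
    let ?c = "(\<kappa> + 1) powr (\<kappa> + 1)"
    have K2: "0 \<le> K2"
    proof -
      \<comment> \<open>A trivial instance, formed only to read off
        \<open>1 \<le> Gam (exp b)\<close>.\<close>
      have sw: "sieve_weights \<kappa> lam1 lam2 B K C p0 h 1 1 X (Gam (exp b)) (gam 1 0) sieve_x"
        using \<epsilon> X_ge b by (intro sieve_weights_gam) auto
      then have "1 \<le> Gam (exp b)" by (rule sieve_weights.\<Gamma>)
      then show ?thesis using K1_nonneg E12 by (simp add: K2_def decay_def)
    qed
    have "(\<Sum>j<J. exp (- (2 ^ Suc j)) * (K2 * (4 / \<tau> * 2 ^ Suc j) powr \<kappa> * (M * weight))) \<le>
        (\<Sum>j<J. K2 * (4 / \<tau>) powr \<kappa> * (M * weight) * ?c * (1 / 2) ^ j)"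
    proof (rule sum_mono)
      fix j
      define y :: real where "y = 2 ^ Suc j"
      have y: "0 < y" by (simp add: y_def)
      have "y powr \<kappa> * exp (- y) = y powr (\<kappa> + 1) * exp (- y) / y" using y by (simp add: powr_add)
      also have "\<dots> \<le> ?c / y" using y pos powr_mult_exp_minus_le[of y "\<kappa> + 1"] by (intro divide_right_mono) auto
      also have "\<dots> \<le> ?c * (1 / 2) ^ j"
        by (simp add: y_def power_one_over divide_simps)
      finally have le: "y powr \<kappa> * exp (- y) \<le> ?c * (1 / 2) ^ j" .
      have "exp (- y) * (K2 * (4 / \<tau> * y) powr \<kappa> * (M * weight)) =
          K2 * (4 / \<tau>) powr \<kappa> * (M * weight) * (y powr \<kappa> * exp (- y))"
        using \<tau> y by (subst powr_mult) (auto simp: mult_ac)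
      also have "\<dots> \<le> K2 * (4 / \<tau>) powr \<kappa> * (M * weight) * (?c * (1 / 2) ^ j)"
        using le K2 M_large by (intro mult_left_mono) (auto simp: weight_def)
      finally show "exp (- (2 ^ Suc j)) * (K2 * (4 / \<tau> * 2 ^ Suc j) powr \<kappa> * (M * weight)) \<le>
          K2 * (4 / \<tau>) powr \<kappa> * (M * weight) * ?c * (1 / 2) ^ j" by (simp add: y_def mult.assoc)
    qed
    also have "\<dots> = K2 * (4 / \<tau>) powr \<kappa> * (M * weight) * ?c * (\<Sum>j<J. (1 / 2) ^ j)"
      by (simp add: sum_distrib_left)
    also have "\<dots> \<le> K2 * (4 / \<tau>) powr \<kappa> * (M * weight) * ?c * 2"
      using K2 M_large by (intro mult_left_mono sum_half_powers_le) (auto simp: weight_def)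
    finally show ?thesis by (simp add: mult_ac)
  qed
  finally show ?thesis by (simp add: K4_def algebra_simps)
qed

end

end

section \<open>Tail estimates\<close>

lemma primes_le_eq: "{p. prime p \<and> real p \<le> x} = primes_in 0 x"
  by (auto simp: primes_in_def prime_gt_0_nat)

lemma bigomega_prime_power: "prime p \<Longrightarrow> bigomega (p ^ k) = k"
  by (simp add: bigomega_def prime_factorization_prime_power)

lemma sum_density_le:
  assumes h: "h \<in> density_functions \<kappa> lam1 lam2 B K" and lam: "0 < lam1" "0 < lam2" and x: "1 \<le> x"
  shows "(\<Sum>p\<in>primes_in 0 x. h p) \<le> x * x powr lam2"
proof -
  have "(\<Sum>p\<in>primes_in 0 x. h p) \<le> real (card (primes_in 0 x)) * x powr lam2"
  proof (rule sum_bounded_above)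
    fix p assume "p \<in> primes_in 0 x"
    then have p: "prime p" "real p \<le> x" "1 \<le> real p"
      using prime_ge_1_nat by (auto simp: primes_in_def)
    have "\<forall>p e. prime p \<longrightarrow> 1 \<le> e \<longrightarrow> h (p ^ e) \<le> real p powr (- real e * lam1 + lam2)"
      using h by (simp add: density_functions_def)
    then have "h (p ^ 1) \<le> real p powr (- real 1 * lam1 + lam2)" using p(1) by blast
    also have "\<dots> \<le> real p powr lam2" using p lam by (intro powr_mono) auto
    also have "\<dots> \<le> x powr lam2" using p lam by (intro powr_mono2) auto
    finally show "h p \<le> x powr lam2" by simp
  qed
  also have "\<dots> \<le> x * x powr lam2" using x card_primes_in_le[of x] by (intro mult_right_mono) auto
  finally show ?thesis .
qed

lemma additive_fun_1: "additive_fun \<psi> \<Longrightarrow> \<psi> 1 = 0"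
  unfolding additive_fun_def by (drule spec[of _ 1], drule spec[of _ 1]) simp

lemma exp_additive_multiplicative:
  assumes "additive_fun \<psi>"
  shows "multiplicative_fun (\<lambda>n. exp (s * \<psi> n))"
  using assms additive_fun_1[OF assms]
  by (auto simp: multiplicative_fun_def additive_fun_def distrib_left exp_add)

text \<open>Each omitted factor lies between 0 and 1, because \<open>h p \<le> B / p\<close> above
  \<open>B\<close>.\<close>

lemma prod_one_minus_squared_le:
  assumes h: "h \<in> density_functions \<kappa> lam1 lam2 B K" and B: "0 < B" "B \<le> p0"
  shows "(\<Prod>p | prime p \<and> B < real p \<and> real p \<le> M \<and> \<not> p dvd d. (1 - h p)\<^sup>2)
    \<le> (\<Prod>p | p \<in> primes_in p0 M \<and> \<not> p dvd d. (1 - h p)\<^sup>2)"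
proof -
  let ?S = "{p. p \<in> primes_in p0 M \<and> \<not> p dvd d}"
  let ?T = "{p. prime p \<and> B < real p \<and> real p \<le> M \<and> \<not> p dvd d}"
  have bounds: "0 \<le> (1 - h p)\<^sup>2" "(1 - h p)\<^sup>2 \<le> 1" if p: "prime p" "B < real p" for p
  proof -
    have "\<forall>p e. prime p \<longrightarrow> B < real p \<longrightarrow> 1 \<le> e \<longrightarrow> h (p ^ e) \<le> B / real p"
      using h by (simp add: density_functions_def)
    then have "h (p ^ 1) \<le> B / real p" using p by blast
    also have "\<dots> \<le> 1" using p B by simp
    finally have "h p \<le> 1" by simp
    moreover have "0 \<le> h p" using h p prime_ge_1_nat by (simp add: density_functions_def)
    ultimately show "(1 - h p)\<^sup>2 \<le> 1" by (simp add: power_le_one)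
  qed simp
  have ST: "?S \<subseteq> ?T" using B by (auto simp: primes_in_def)
  have "prod (\<lambda>p. (1 - h p)\<^sup>2) ?T = prod (\<lambda>p. (1 - h p)\<^sup>2) (?T - ?S) * prod (\<lambda>p. (1 - h p)\<^sup>2) ?S"
    using ST by (intro prod.subset_diff) simp_all
  also have "\<dots> \<le> 1 * prod (\<lambda>p. (1 - h p)\<^sup>2) ?S"
    using bounds by (intro mult_right_mono prod_le_1 prod_nonneg) auto
  finally show ?thesis by simp
qed

definition admissible ::
  "real \<Rightarrow> real \<Rightarrow> real \<Rightarrow> real \<Rightarrow> real \<Rightarrow> real \<Rightarrow> real \<Rightarrow> real \<Rightarrow> real \<Rightarrow> real \<Rightarrow> real \<Rightarrow> real \<Rightarrow>
   'a set \<Rightarrow> (real \<Rightarrow> 'a \<Rightarrow> real) \<Rightarrow> ('a \<Rightarrow> nat) \<Rightarrow> (real \<Rightarrow> real) \<Rightarrow> (nat \<Rightarrow> real) \<Rightarrow> bool" where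
  "admissible \<kappa> lam1 lam2 B K C \<theta> \<xi> \<alpha> Bt E1 E2 A chi c M h \<longleftrightarrow>
     weight_family A chi \<and> h \<in> density_functions \<kappa> lam1 lam2 B K \<and>
     (\<forall>p e. prime p \<longrightarrow> 2 \<le> e \<longrightarrow> h (p ^ e) \<le> C / (real p)\<^sup>2) \<and> (\<forall>a\<in>A. 0 < c a) \<and>
     equidistributed E1 E2 \<theta> \<xi> \<kappa> lam1 lam2 B K A chi c M h \<and>
     (\<forall>T\<ge>1. \<forall>a\<in>A. chi T a > 0 \<longrightarrow> real (c a) \<le> Bt * M T powr \<alpha>)"

text \<open>The common source of both tails, applied to \<psi> and to its negative.\<close>

theorem sum_exp_additive_le:
  fixes \<kappa> lam1 lam2 B K C \<theta> \<xi> \<alpha> Bt E1 E2 s D :: real and \<psi> :: "nat \<Rightarrow> real"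
  assumes pos: "0 < \<kappa>" "0 < lam1" "0 < lam2" "0 < B" "0 < K" "0 < C"
    and exponents: "0 < \<theta>" "0 < \<xi>" "max \<theta> \<xi> < 1" "0 < \<alpha>"
    and \<psi>: "additive_fun \<psi>" "\<forall>n\<ge>1. \<psi> n \<le> D * real (bigomega n)"
      "\<forall>\<epsilon>>0. \<exists>Ct. \<forall>n\<ge>1. \<psi> n \<le> \<epsilon> * ln (real n) + Ct"
    and s: "0 < s"
  shows "\<exists>L>0. \<exists>M0\<ge>3. \<forall>(A :: 'a set) chi (c :: 'a \<Rightarrow> nat) M h T.
     admissible \<kappa> lam1 lam2 B K C \<theta> \<xi> \<alpha> Bt E1 E2 A chi c M h \<longrightarrow> 1 \<le> T \<longrightarrow> M0 \<le> M T \<longrightarrow>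
     (\<Sum>a | a \<in> A \<and> chi T a > 0. chi T a * exp (s * \<psi> (c a))) \<le>
       L * (M T * exp (\<Sum>p\<in>primes_in 0 (M T). (exp (s * \<psi> p) - 1) * h p))"
proof -
  define F where "F n = exp (s * \<psi> n)" for n
  \<comment> \<open>The maximum guarantees \<open>1 \<le> A0\<close> even for negative
    \<open>D\<close>.\<close>
  define A0 where "A0 = exp (s * max D 0)"
  define \<epsilon> where "\<epsilon> = min lam1 1 / 4"
  \<comment> \<open>The third entry is what \<open>A0 \<le> p0 powr \<epsilon>\<close>
    requires.\<close>
  define p0 where "p0 = max 3 (max (2 * B) (A0 powr (1 / \<epsilon>)))"
  have \<epsilon>: "0 < \<epsilon>" "4 * \<epsilon> \<le> lam1" "4 * \<epsilon> \<le> 1" using pos by (auto simp: \<epsilon>_def)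
  have A0: "1 \<le> A0" using s by (simp add: A0_def)
  have F_sub: "\<exists>Cf\<ge>1. \<forall>n>0. F n \<le> Cf * real n powr \<delta>" if \<delta>: "0 < \<delta>" for \<delta>
  proof -
    have "0 < \<delta> / s" using \<delta> s by simp
    then obtain Ct where Ct: "\<And>n. 1 \<le> n \<Longrightarrow> \<psi> n \<le> \<delta> / s * ln (real n) + Ct" using \<psi>(3) by blast
    have "F n \<le> exp (s * max Ct 0) * real n powr \<delta>" if "0 < n" for n
    proof -
      have "s * \<psi> n \<le> s * (\<delta> / s * ln (real n) + max Ct 0)"
        using Ct[of n] that s by (intro mult_left_mono) auto
      also have "\<dots> = s * max Ct 0 + \<delta> * ln (real n)" using s by (simp add: field_simps)
      finally have "F n \<le> exp (s * max Ct 0 + \<delta> * ln (real n))" by (simp add: F_def)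
      then show ?thesis using that by (simp add: exp_add powr_def)
    qed
    moreover have "1 \<le> exp (s * max Ct 0)" using s by simp
    ultimately show ?thesis by blast
  qed
  obtain Ce where Ce: "1 \<le> Ce" "\<And>n. 0 < n \<Longrightarrow> F n \<le> Ce * real n powr \<epsilon>" using F_sub[OF \<epsilon>(1)] by blast
  have "0 < (min \<theta> \<xi> / 8) * \<epsilon> / (8 * \<alpha>)" using exponents \<epsilon> by simp
  from F_sub[OF this] obtain Ct where
    Ct: "1 \<le> Ct" "\<And>n. 0 < n \<Longrightarrow> F n \<le> Ct * real n powr ((min \<theta> \<xi> / 8) * \<epsilon> / (8 * \<alpha>))" by blast
  have p0: "3 \<le> p0" "2 * B \<le> p0" by (auto simp: p0_def)
  have A0p0: "A0 \<le> p0 powr \<epsilon>"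
  proof -
    have "A0 = (A0 powr (1 / \<epsilon>)) powr \<epsilon>" using A0 \<epsilon> by (simp add: powr_powr)
    also have "\<dots> \<le> p0 powr \<epsilon>" using \<epsilon> by (intro powr_mono2) (auto simp: p0_def)
    finally show ?thesis .
  qed
  have F_mult: "multiplicative_fun F" unfolding F_def using \<psi>(1) by (rule exp_additive_multiplicative)
  have F_pow: "F (p ^ k) \<le> A0 ^ k" if "prime p" for p k
  proof -
    have "1 \<le> p ^ k" using prime_gt_0_nat[OF that] by (simp add: Suc_le_eq)
    then have "\<psi> (p ^ k) \<le> D * real (bigomega (p ^ k))" using \<psi>(2) by blast
    then have "\<psi> (p ^ k) \<le> D * real k" using bigomega_prime_power[OF that] by simp
    also have "\<dots> \<le> max D 0 * real k" by (intro mult_right_mono) auto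
    finally have "s * \<psi> (p ^ k) \<le> s * (max D 0 * real k)" using s by (intro mult_left_mono) auto
    then have "F (p ^ k) \<le> exp (real k * (s * max D 0))" by (simp add: F_def mult_ac)
    then show ?thesis by (simp only: exp_of_nat_mult A0_def)
  qed
  define E1' where "E1' = max E1 0"
  define E2' where "E2' = max E2 0"
  \<comment> \<open>Outside the locale, \<open>K4\<close> and \<open>W0\<close> take only numerical
    parameters as arguments. They can thus be fixed before \<open>A\<close>, \<open>chi\<close>,
    \<open>c\<close>, \<open>M\<close>, \<open>h\<close> and \<open>T\<close>.\<close>
  define Kc where "Kc = sieve_problem.K4 \<kappa> lam1 lam2 B K C p0 A0 Ce \<epsilon> \<theta> \<xi> \<alpha> E1' E2' Ct"
  define Wc where "Wc = sieve_problem.W0 p0 A0 \<epsilon> \<theta> \<xi> \<alpha>"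
  define \<eta> where "\<eta> = min \<theta> \<xi> / 16"
  have \<eta>: "0 < \<eta>" using exponents by (simp add: \<eta>_def)
  define M0 where "M0 = max 3 (max (\<bar>Bt\<bar> powr (1 / \<alpha>)) (\<bar>Wc\<bar> powr (1 / \<eta>)))"
  \<comment> \<open>The exponential pays for reinstating the primes up to \<open>p0\<close> in the
    exponent, each of which contributes at least \<open>- h p\<close>.\<close>
  define L where "L = max Kc 1 * exp (p0 * p0 powr lam2)"
  have "(\<Sum>a | a \<in> A \<and> chi T a > 0. chi T a * F (c a)) \<le>
      L * (M T * exp (\<Sum>p\<in>primes_in 0 (M T). (F p - 1) * h p))"
    if adm: "admissible \<kappa> lam1 lam2 B K C \<theta> \<xi> \<alpha> Bt E1 E2 A chi c M h"
      and T: "1 \<le> T" "M0 \<le> M T"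
    for A :: "'a set" and chi c M h T
  proof -
    have wf: "weight_family A chi" and h: "h \<in> density_functions \<kappa> lam1 lam2 B K"
      and h2: "\<forall>p e. prime p \<longrightarrow> 2 \<le> e \<longrightarrow> h (p ^ e) \<le> C / (real p)\<^sup>2" and c: "\<forall>a\<in>A. 0 < c a"
      and eq: "equidistributed E1 E2 \<theta> \<xi> \<kappa> lam1 lam2 B K A chi c M h"
      and cM: "\<forall>T\<ge>1. \<forall>a\<in>A. chi T a > 0 \<longrightarrow> real (c a) \<le> Bt * M T powr \<alpha>"
      using adm by (simp_all add: admissible_def)
    have powr_ge: "y \<le> M T powr \<delta>" if "\<bar>y\<bar> powr (1 / \<delta>) \<le> M T" "0 < \<delta>" for y \<delta>
    proof -
      have "\<bar>y\<bar> = (\<bar>y\<bar> powr (1 / \<delta>)) powr \<delta>" using that by (simp add: powr_powr)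
      also have "\<dots> \<le> M T powr \<delta>" using that by (intro powr_mono2) auto
      finally show ?thesis by simp
    qed
    have M3: "3 \<le> M T" using T by (simp add: M0_def)
    interpret sieve_problem \<kappa> lam1 lam2 B K C p0 h F A0 Ce \<epsilon> "{a. a \<in> A \<and> chi T a > 0}" "chi T" c
      "M T" \<theta> \<xi> \<alpha> Bt E1' E2' Ct
    proof
      show "finite {a. a \<in> A \<and> chi T a > 0}" using wf T by (simp add: weight_family_def)
      show "F (p ^ k) \<le> A0 ^ k" if "prime p" for p k using F_pow that .
      fix d :: nat assume d: "0 < d" "real d \<le> M T powr \<theta>"
      have "1 \<le> d" using d by simp
      with eq T(1) d(2) have "\<exists>u v. \<bar>u\<bar> \<le> E1 * (\<Prod>p | prime p \<and> B < real p \<and> real p \<le> M T \<and> \<not> p dvd d. (1 - h p)\<^sup>2) \<and>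
        \<bar>v\<bar> \<le> E2 * M T powr (1 - \<xi>) \<and> chi_sum A chi T (\<lambda>a. d dvd c a) = h d * M T * (1 + u) + v"
        unfolding equidistributed_def by blast
      then obtain u v where uv: "\<bar>u\<bar> \<le> E1 * (\<Prod>p | prime p \<and> B < real p \<and> real p \<le> M T \<and> \<not> p dvd d. (1 - h p)\<^sup>2)"
        "\<bar>v\<bar> \<le> E2 * M T powr (1 - \<xi>)" "chi_sum A chi T (\<lambda>a. d dvd c a) = h d * M T * (1 + u) + v"
        by blast
      have "\<bar>u\<bar> \<le> E1' * (\<Prod>p | prime p \<and> B < real p \<and> real p \<le> M T \<and> \<not> p dvd d. (1 - h p)\<^sup>2)"
        by (rule order_trans[OF uv(1)], rule mult_right_mono) (auto simp: E1'_def intro!: prod_nonneg)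
      also have "\<dots> \<le> E1' * (\<Prod>p | p \<in> primes_in p0 (M T) \<and> \<not> p dvd d. (1 - h p)\<^sup>2)"
        using h pos p0 by (intro mult_left_mono prod_one_minus_squared_le) (auto simp: E1'_def)
      finally have "\<bar>u\<bar> \<le> E1' * (\<Prod>p | p \<in> primes_in p0 (M T) \<and> \<not> p dvd d. (1 - h p)\<^sup>2)" .
      moreover have "\<bar>v\<bar> \<le> E2' * M T powr (1 - \<xi>)"
        by (rule order_trans[OF uv(2)], rule mult_right_mono) (auto simp: E2'_def)
      moreover have "(\<Sum>a | a \<in> {a. a \<in> A \<and> chi T a > 0} \<and> d dvd c a. chi T a) = h d * M T * (1 + u) + v"
        using uv(3) by (simp add: chi_sum_def conj_ac)
      ultimately show "\<exists>u v. \<bar>u\<bar> \<le> E1' * (\<Prod>p | p \<in> primes_in p0 (M T) \<and> \<not> p dvd d. (1 - h p)\<^sup>2) \<and>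
        \<bar>v\<bar> \<le> E2' * M T powr (1 - \<xi>) \<and>
        (\<Sum>a | a \<in> {a. a \<in> A \<and> chi T a > 0} \<and> d dvd c a. chi T a) = h d * M T * (1 + u) + v" by blast
    qed (use pos p0 h h2 F_mult A0 \<epsilon> Ce Ct A0p0 c cM T exponents in \<open>auto simp: F_def E1'_def E2'_def\<close>)
    have large: "1 < M T" "Bt \<le> M T powr \<alpha>" "Wc \<le> M T powr \<eta>"
      using M3 T \<eta> exponents powr_ge[of Bt \<alpha>] powr_ge[of Wc \<eta>] by (auto simp: M0_def)
    have "(\<Sum>a | a \<in> A \<and> chi T a > 0. chi T a * F (c a)) \<le> Kc * (M T * weight)"
      unfolding Kc_def using large by (intro sum_F_le) (simp_all add: \<tau>_def Wc_def \<eta>_def)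
    also have "\<dots> \<le> max Kc 1 * (M T * (exp (p0 * p0 powr lam2) * exp (\<Sum>p\<in>primes_in 0 (M T). (F p - 1) * h p)))"
    proof (intro mult_mono mult_left_mono)
      have "(\<Sum>p\<in>primes_in p0 (M T). (F p - 1) * h p) - p0 * p0 powr lam2 \<le>
          (\<Sum>p\<in>primes_in p0 (M T). (F p - 1) * h p) - (\<Sum>p\<in>primes_in 0 p0 \<inter> primes_in 0 (M T). h p)"
      proof -
        have "(\<Sum>p\<in>primes_in 0 p0 \<inter> primes_in 0 (M T). h p) \<le> (\<Sum>p\<in>primes_in 0 p0. h p)"
          by (intro sum_mono2 h_prime_nonneg) (auto simp: primes_in_prime)
        also have "\<dots> \<le> p0 * p0 powr lam2" using p0 by (intro sum_density_le[OF h pos(2,3)]) auto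
        finally show ?thesis by simp
      qed
      also have "\<dots> \<le> (\<Sum>p\<in>primes_in p0 (M T). (F p - 1) * h p) +
          (\<Sum>p\<in>primes_in 0 p0 \<inter> primes_in 0 (M T). (F p - 1) * h p)"
      proof -
        have "(\<Sum>p\<in>primes_in 0 p0 \<inter> primes_in 0 (M T). - h p) \<le>
            (\<Sum>p\<in>primes_in 0 p0 \<inter> primes_in 0 (M T). (F p - 1) * h p)"
        proof (rule sum_mono)
          fix p assume "p \<in> primes_in 0 p0 \<inter> primes_in 0 (M T)"
          then have p: "prime p" by (auto simp: primes_in_prime)
          have "- 1 * h p \<le> (F p - 1) * h p"
            using h_prime_nonneg[OF p] by (intro mult_right_mono) (auto simp: F_def)
          then show "- h p \<le> (F p - 1) * h p" by simp
        qed
        then show ?thesis by (simp add: sum_negf)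
      qed
      also have "\<dots> = (\<Sum>p\<in>primes_in 0 (M T). (F p - 1) * h p)"
      proof -
        have "primes_in 0 (M T) = primes_in p0 (M T) \<union> (primes_in 0 p0 \<inter> primes_in 0 (M T))"
          using p0 by (auto simp: primes_in_def)
        moreover have "primes_in p0 (M T) \<inter> (primes_in 0 p0 \<inter> primes_in 0 (M T)) = {}"
          by (auto simp: primes_in_def)
        ultimately show ?thesis by (metis (no_types, lifting) finite_Int finite_primes_in sum.union_disjoint)
      qed
      finally show "weight \<le> exp (p0 * p0 powr lam2) * exp (\<Sum>p\<in>primes_in 0 (M T). (F p - 1) * h p)"
        by (simp add: weight_def flip: exp_add)
    qed (use M3 in \<open>auto simp: weight_def\<close>)
    finally show ?thesis by (simp add: L_def mult_ac)
  qed
  moreover have "0 < L" by (simp add: L_def)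
  moreover have "3 \<le> M0" by (simp add: M0_def)
  ultimately show ?thesis unfolding F_def by blast
qed

section \<open>Trivial bound and Chernoff's inequality\<close>

lemma frak_c_nonneg:
  assumes "0 < \<epsilon>"
  shows "0 \<le> frak_c \<epsilon>"
proof -
  have "ln (inverse (1 + \<epsilon>)) \<le> inverse (1 + \<epsilon>) - 1" using assms by (intro ln_le_minus_one) auto
  also have "\<dots> = - \<epsilon> / (1 + \<epsilon>)" using assms by (simp add: field_simps)
  finally show ?thesis using assms by (simp add: frak_c_def ln_inverse)
qed

text \<open>Equidistribution at the modulus 1 bounds the total mass. This settles the ranges where
  the target exponential is bounded below.\<close>

lemma chi_sum_le_total:
  assumes wf: "weight_family A chi" and T: "1 \<le> T" and B: "0 < B"
    and eq: "equidistributed E1 E2 \<theta> \<xi> \<kappa> lam1 lam2 B K A chi c M h"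
  shows "chi_sum A chi T P \<le> (1 + max E1 0 + max E2 0) * M T"
proof -
  have M: "1 \<le> M T" and h: "h \<in> density_functions \<kappa> lam1 lam2 B K" and ex: "0 < \<theta>" "0 < \<xi>"
    using eq T by (auto simp: equidistributed_def)
  have fin: "finite {a \<in> A. chi T a > 0}" using wf T by (simp add: weight_family_def)
  have "chi_sum A chi T P \<le> chi_sum A chi T (\<lambda>a. 1 dvd c a)"
    unfolding chi_sum_def by (intro sum_mono2) (use fin in auto)
  also have "chi_sum A chi T (\<lambda>a. 1 dvd c a) \<le> (1 + max E1 0 + max E2 0) * M T"
  proof -
    let ?p = "\<Prod>p | prime p \<and> B < real p \<and> real p \<le> M T \<and> \<not> p dvd 1. (1 - h p)\<^sup>2"
    have "real 1 \<le> M T powr \<theta>" using M ex by (simp add: ge_one_powr_ge_zero)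
    with eq T have "\<exists>u v. \<bar>u\<bar> \<le> E1 * ?p \<and> \<bar>v\<bar> \<le> E2 * M T powr (1 - \<xi>) \<and>
        chi_sum A chi T (\<lambda>a. 1 dvd c a) = h 1 * M T * (1 + u) + v"
      unfolding equidistributed_def by blast
    then obtain u v where uv: "\<bar>u\<bar> \<le> E1 * ?p" "\<bar>v\<bar> \<le> E2 * M T powr (1 - \<xi>)"
      "chi_sum A chi T (\<lambda>a. 1 dvd c a) = h 1 * M T * (1 + u) + v" by blast
    have h1: "h 1 = 1" using h by (simp add: density_functions_def multiplicative_fun_def)
    \<comment> \<open>With this threshold no prime is left on the right, so the comparison gives the
      bound 1.\<close>
    have "?p \<le> (\<Prod>p | p \<in> primes_in (max B (M T)) (M T) \<and> \<not> p dvd 1. (1 - h p)\<^sup>2)"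
      using h B by (intro prod_one_minus_squared_le) auto
    also have "primes_in (max B (M T)) (M T) = {}" by (auto simp: primes_in_def)
    finally have p1: "?p \<le> 1" by simp
    have p0: "0 \<le> ?p" by (intro prod_nonneg) auto
    have "E1 * ?p \<le> max E1 0 * 1" using p0 p1 by (intro mult_mono) auto
    then have u: "u \<le> max E1 0" using uv(1) by simp
    have "M T powr (1 - \<xi>) \<le> M T powr 1" using M ex by (intro powr_mono) auto
    then have "E2 * M T powr (1 - \<xi>) \<le> max E2 0 * M T" using M by (intro mult_mono) auto
    then have v: "v \<le> max E2 0 * M T" using uv(2) by simp
    have "M T * (1 + u) \<le> M T * (1 + max E1 0)" using u M by (intro mult_left_mono) auto
    then show ?thesis using uv(3) h1 v by (simp add: algebra_simps)
  qed
  finally show ?thesis .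
qed

lemma chi_sum_le_exp_moment:
  assumes wf: "weight_family A chi" and T: "1 \<le> T" and s: "0 \<le> s" and P: "\<And>a. P a \<Longrightarrow> z \<le> f a"
  shows "chi_sum A chi T P \<le> exp (- (s * z)) * (\<Sum>a | a \<in> A \<and> chi T a > 0. chi T a * exp (s * f a))"
proof -
  have fin: "finite {a. a \<in> A \<and> chi T a > 0}" using wf T by (simp add: weight_family_def)
  have "chi_sum A chi T P \<le> (\<Sum>a | a \<in> A \<and> chi T a > 0 \<and> P a. chi T a * exp (s * f a - s * z))"
    unfolding chi_sum_def
  proof (rule sum_mono)
    fix a assume a: "a \<in> {a. a \<in> A \<and> chi T a > 0 \<and> P a}"
    then have "s * z \<le> s * f a" using P s by (intro mult_left_mono) auto
    then have "1 \<le> exp (s * f a - s * z)" by simp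
    then have "chi T a * 1 \<le> chi T a * exp (s * f a - s * z)" using a by (intro mult_left_mono) auto
    then show "chi T a \<le> chi T a * exp (s * f a - s * z)" by simp
  qed
  also have "\<dots> \<le> (\<Sum>a | a \<in> A \<and> chi T a > 0. chi T a * exp (s * f a - s * z))"
    using fin by (intro sum_mono2) auto
  also have "\<dots> = exp (- (s * z)) * (\<Sum>a | a \<in> A \<and> chi T a > 0. chi T a * exp (s * f a))"
    by (simp add: sum_distrib_left exp_diff exp_minus field_simps)
  finally show ?thesis .
qed

text \<open>The choice \<open>s = ln (1 + \<epsilon>2) / At\<close> gives
  \<open>exp (s * \<psi> p) \<le> 1 + \<epsilon>2\<close>, so the moment is at most about
  \<open>exp (\<epsilon>2 * r * ln (ln M))\<close>. The assumption on \<open>z\<close> bounds this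
  exponent by \<open>\<epsilon>2 / (1 + \<epsilon>2) * z / At\<close>, and subtracting
  \<open>s * z\<close> leaves \<open>- frak_c \<epsilon>2 * z / At\<close>.\<close>

theorem upper_tail:
  fixes \<kappa> lam1 lam2 B K C \<theta> \<xi> \<alpha> Bt At \<epsilon>2 E1 E2 R :: real
    and \<psi> :: "nat \<Rightarrow> real"
  assumes pos: "0 < \<kappa>" "0 < lam1" "0 < lam2" "0 < B" "0 < K" "0 < C"
    and exponents: "0 < \<theta>" "0 < \<xi>" "max \<theta> \<xi> < 1" "0 < \<alpha>"
    and \<psi>: "additive_fun \<psi>" "\<forall>n\<ge>1. \<psi> n \<le> At * real (bigomega n)"
      "\<forall>\<epsilon>>0. \<exists>Ct. \<forall>n\<ge>1. \<psi> n \<le> \<epsilon> * ln (real n) + Ct"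
    and At: "0 < At" and \<epsilon>2: "0 < \<epsilon>2" and Bt: "0 < Bt"
  shows "\<exists>L>0. \<forall>(A :: 'a set) chi (c :: 'a \<Rightarrow> nat) M h r T z.
     admissible \<kappa> lam1 lam2 B K C \<theta> \<xi> \<alpha> Bt E1 E2 A chi c M h \<longrightarrow>
     (\<forall>x\<ge>3. \<bar>(\<Sum>p | prime p \<and> real p \<le> x. h p) - r * ln (ln x)\<bar> \<le> R) \<longrightarrow>
     1 \<le> T \<longrightarrow> 1 < M T \<longrightarrow> r * At * (1 + \<epsilon>2) * ln (ln (M T)) \<le> z \<longrightarrow>
     chi_sum A chi T (\<lambda>a. z \<le> \<psi> (c a)) \<le> L * (M T * exp (- (frak_c \<epsilon>2 / At) * z))"
proof -
  define s where "s = ln (1 + \<epsilon>2) / At"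
  have s: "0 < s" using At \<epsilon>2 by (simp add: s_def)
  from sum_exp_additive_le[where 'a = 'a, OF pos exponents \<psi> s, of Bt E1 E2]
  obtain L M0 where L: "0 < L" "3 \<le> M0" and moment: "\<And>(A :: 'a set) chi (c :: 'a \<Rightarrow> nat) M h T.
     admissible \<kappa> lam1 lam2 B K C \<theta> \<xi> \<alpha> Bt E1 E2 A chi c M h \<Longrightarrow> 1 \<le> T \<Longrightarrow> M0 \<le> M T \<Longrightarrow>
     (\<Sum>a | a \<in> A \<and> chi T a > 0. chi T a * exp (s * \<psi> (c a))) \<le>
       L * (M T * exp (\<Sum>p\<in>primes_in 0 (M T). (exp (s * \<psi> p) - 1) * h p))"
    by blast
  obtain Ct where Ct: "\<And>n. 1 \<le> n \<Longrightarrow> \<psi> n \<le> 1 * ln (real n) + Ct"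
    using \<psi>(3) by (meson zero_less_one)
  define Z where "Z = ln Bt + \<alpha> * ln M0 + Ct"
  define E where "E = 1 + max E1 0 + max E2 0"
  define L' where "L' = L * exp (\<epsilon>2 * R) + E * exp (frak_c \<epsilon>2 / At * Z)"
  have E: "0 < E" by (simp add: E_def add_pos_nonneg)
  have fc: "0 \<le> frak_c \<epsilon>2 / At" using frak_c_nonneg[OF \<epsilon>2] At by simp
  have "chi_sum A chi T (\<lambda>a. z \<le> \<psi> (c a)) \<le> L' * (M T * exp (- (frak_c \<epsilon>2 / At) * z))"
    if adm: "admissible \<kappa> lam1 lam2 B K C \<theta> \<xi> \<alpha> Bt E1 E2 A chi c M h"
      and hr: "\<forall>x\<ge>3. \<bar>(\<Sum>p | prime p \<and> real p \<le> x. h p) - r * ln (ln x)\<bar> \<le> R"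
      and T: "1 \<le> T" and M: "1 < M T" and z: "r * At * (1 + \<epsilon>2) * ln (ln (M T)) \<le> z"
    for A :: "'a set" and chi c M h r T z
  proof -
    have wf: "weight_family A chi" and h: "h \<in> density_functions \<kappa> lam1 lam2 B K"
      and h2: "\<forall>p e. prime p \<longrightarrow> 2 \<le> e \<longrightarrow> h (p ^ e) \<le> C / (real p)\<^sup>2" and c: "\<forall>a\<in>A. 0 < c a"
      and eq: "equidistributed E1 E2 \<theta> \<xi> \<kappa> lam1 lam2 B K A chi c M h"
      and cM: "\<forall>T\<ge>1. \<forall>a\<in>A. chi T a > 0 \<longrightarrow> real (c a) \<le> Bt * M T powr \<alpha>"
      using adm by (simp_all add: admissible_def)
    let ?e = "M T * exp (- (frak_c \<epsilon>2 / At) * z)"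
    show ?thesis
    proof (cases "M0 \<le> M T")
      case True
      have hn: "0 \<le> h p" if "p \<in> primes_in 0 (M T)" for p
        using h that by (simp add: density_functions_def primes_in_def)
      have "(\<Sum>p\<in>primes_in 0 (M T). (exp (s * \<psi> p) - 1) * h p) \<le> (\<Sum>p\<in>primes_in 0 (M T). \<epsilon>2 * h p)"
      proof (intro sum_mono mult_right_mono hn)
        fix p assume "p \<in> primes_in 0 (M T)"
        then have p: "prime p" by (rule primes_in_prime)
        then have "\<psi> p \<le> At * real (bigomega (p ^ 1))" using \<psi>(2) prime_ge_1_nat by simp
        then have "\<psi> p \<le> At" unfolding bigomega_prime_power[OF p] by simp
        then have "s * \<psi> p \<le> s * At" using s by (intro mult_left_mono) auto
        also have "\<dots> = ln (1 + \<epsilon>2)" using At by (simp add: s_def)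
        finally have "exp (s * \<psi> p) \<le> exp (ln (1 + \<epsilon>2))" by simp
        then show "exp (s * \<psi> p) - 1 \<le> \<epsilon>2" using \<epsilon>2 by simp
      qed
      also have "\<dots> = \<epsilon>2 * (\<Sum>p\<in>primes_in 0 (M T). h p)" by (simp add: sum_distrib_left)
      also have "\<dots> \<le> \<epsilon>2 * (r * ln (ln (M T)) + R)"
      proof (rule mult_left_mono)
        have "3 \<le> M T" using True L by simp
        with hr have "\<bar>(\<Sum>p | prime p \<and> real p \<le> M T. h p) - r * ln (ln (M T))\<bar> \<le> R" by blast
        then show "(\<Sum>p\<in>primes_in 0 (M T). h p) \<le> r * ln (ln (M T)) + R"
          unfolding primes_le_eq by linarith
      qed (use \<epsilon>2 in simp)
      also have "\<dots> = \<epsilon>2 / (At * (1 + \<epsilon>2)) * (r * At * (1 + \<epsilon>2) * ln (ln (M T))) + \<epsilon>2 * R"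
      proof -
        have "At * (1 + \<epsilon>2) \<noteq> 0" using At \<epsilon>2 by simp
        then have "\<epsilon>2 * (r * ln (ln (M T))) = (\<epsilon>2 * (r * ln (ln (M T)))) * (At * (1 + \<epsilon>2)) / (At * (1 + \<epsilon>2))"
          by (rule nonzero_mult_div_cancel_right[symmetric])
        also have "\<dots> = \<epsilon>2 / (At * (1 + \<epsilon>2)) * (r * At * (1 + \<epsilon>2) * ln (ln (M T)))"
          by (simp only: times_divide_eq_left times_divide_eq_right mult_ac)
        finally show ?thesis by (simp only: distrib_left)
      qed
      also have "\<dots> \<le> \<epsilon>2 / (At * (1 + \<epsilon>2)) * z + \<epsilon>2 * R"
        using z At \<epsilon>2 by (intro add_right_mono mult_left_mono) auto
      finally have S: "(\<Sum>p\<in>primes_in 0 (M T). (exp (s * \<psi> p) - 1) * h p) \<le> \<epsilon>2 / (At * (1 + \<epsilon>2)) * z + \<epsilon>2 * R" .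
      have "chi_sum A chi T (\<lambda>a. z \<le> \<psi> (c a)) \<le>
          exp (- (s * z)) * (\<Sum>a | a \<in> A \<and> chi T a > 0. chi T a * exp (s * \<psi> (c a)))"
        using s by (intro chi_sum_le_exp_moment[OF wf T]) auto
      also have "\<dots> \<le> exp (- (s * z)) * (L * (M T * exp (\<epsilon>2 / (At * (1 + \<epsilon>2)) * z + \<epsilon>2 * R)))"
      proof (rule mult_left_mono)
        have "L * (M T * exp (\<Sum>p\<in>primes_in 0 (M T). (exp (s * \<psi> p) - 1) * h p)) \<le>
            L * (M T * exp (\<epsilon>2 / (At * (1 + \<epsilon>2)) * z + \<epsilon>2 * R))"
          using S L M by (intro mult_left_mono) auto
        then show "(\<Sum>a | a \<in> A \<and> chi T a > 0. chi T a * exp (s * \<psi> (c a))) \<le>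
            L * (M T * exp (\<epsilon>2 / (At * (1 + \<epsilon>2)) * z + \<epsilon>2 * R))"
          using moment[OF adm T True] by linarith
      qed simp
      also have "\<dots> = L * exp (\<epsilon>2 * R) * (M T * (exp (- (s * z)) * exp (\<epsilon>2 / (At * (1 + \<epsilon>2)) * z)))"
        by (simp add: exp_add mult_ac)
      also have "exp (- (s * z)) * exp (\<epsilon>2 / (At * (1 + \<epsilon>2)) * z) = exp (- (frak_c \<epsilon>2 / At) * z)"
      proof -
        have "- s + \<epsilon>2 / (At * (1 + \<epsilon>2)) = - (frak_c \<epsilon>2 / At)"
          using At \<epsilon>2 by (simp add: s_def frak_c_def divide_simps)
        then have "- (s * z) + \<epsilon>2 / (At * (1 + \<epsilon>2)) * z = - (frak_c \<epsilon>2 / At) * z"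
          by (metis distrib_right mult_minus_left)
        then show ?thesis by (simp flip: exp_add)
      qed
      also have "L * exp (\<epsilon>2 * R) * ?e \<le> L' * ?e"
        using E M by (intro mult_right_mono) (auto simp: L'_def)
      finally show ?thesis .
    next
      case False
      show ?thesis
      \<comment> \<open>For \<open>M T < M0\<close> the values \<open>c a\<close> are bounded. If
        any of them contributes, then \<open>z \<le> Z\<close>, so the exponential on the right is
        bounded below.\<close>
      proof (cases "\<exists>a. a \<in> A \<and> chi T a > 0 \<and> z \<le> \<psi> (c a)")
        case True
        then obtain a where a: "a \<in> A" "chi T a > 0" "z \<le> \<psi> (c a)" by blast
        have ca: "1 \<le> c a" using c a by (simp add: Suc_le_eq)
        have "ln (real (c a)) \<le> ln (Bt * M T powr \<alpha>)" using cM T a ca by (subst ln_le_cancel_iff) (use Bt M in auto)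
        also have "\<dots> = ln Bt + \<alpha> * ln (M T)" using Bt M by (simp add: ln_mult ln_powr)
        also have "\<alpha> * ln (M T) \<le> \<alpha> * ln M0" using exponents M False by (intro mult_left_mono) auto
        finally have "z \<le> Z" using a(3) Ct[OF ca] by (simp add: Z_def)
        then have "frak_c \<epsilon>2 / At * z \<le> frak_c \<epsilon>2 / At * Z" using fc by (rule mult_left_mono)
        then have e1: "1 \<le> exp (frak_c \<epsilon>2 / At * Z) * exp (- (frak_c \<epsilon>2 / At) * z)"
          by (simp flip: exp_add)
        have "chi_sum A chi T (\<lambda>a. z \<le> \<psi> (c a)) \<le> E * M T"
          unfolding E_def by (rule chi_sum_le_total[OF wf T pos(4) eq])
        also have "\<dots> \<le> E * M T * (exp (frak_c \<epsilon>2 / At * Z) * exp (- (frak_c \<epsilon>2 / At) * z))"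
          using mult_left_mono[OF e1, of "E * M T"] E M by simp
        also have "\<dots> = E * exp (frak_c \<epsilon>2 / At * Z) * ?e" by simp
        also have "\<dots> \<le> L' * ?e"
          using L M by (intro mult_right_mono) (auto simp: L'_def)
        finally show ?thesis .
      next
        case False
        then have "{a. a \<in> A \<and> chi T a > 0 \<and> z \<le> \<psi> (c a)} = {}" by blast
        then have "chi_sum A chi T (\<lambda>a. z \<le> \<psi> (c a)) = 0" unfolding chi_sum_def by (simp only: sum.empty)
        then show ?thesis using L E M by (simp add: L'_def)
      qed
    qed
  qed
  moreover have "0 < L'" using L E by (simp add: L'_def add_pos_pos)
  ultimately show ?thesis by blast
qed

text \<open>With \<open>s = - ln (1 - \<epsilon>1) / At1\<close>, the factor
  \<open>exp (- s * \<psi> p)\<close> is the one in the hypothesis on primes. The moment then saves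
  \<open>exp (- \<epsilon>1 * r * ln (ln M))\<close>, and the claim is a weakening of the resulting
  Chernoff bound.\<close>

theorem lower_tail:
  fixes \<kappa> lam1 lam2 B K C \<theta> \<xi> \<alpha> Bt At1 \<epsilon>1 E1 E2 R R1 :: real
    and \<psi> :: "nat \<Rightarrow> real"
  assumes pos: "0 < \<kappa>" "0 < lam1" "0 < lam2" "0 < B" "0 < K" "0 < C"
    and exponents: "0 < \<theta>" "0 < \<xi>" "max \<theta> \<xi> < 1" "0 < \<alpha>"
    and \<psi>: "additive_fun \<psi>" "moderate_below \<psi>"
    and At1: "0 < At1" and \<epsilon>1: "0 < \<epsilon>1" "\<epsilon>1 < 1"
  shows "\<exists>L>0. \<forall>(A :: 'a set) chi (c :: 'a \<Rightarrow> nat) M h r T z.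
     admissible \<kappa> lam1 lam2 B K C \<theta> \<xi> \<alpha> Bt E1 E2 A chi c M h \<longrightarrow> 0 < r \<longrightarrow>
     (\<forall>x\<ge>3. \<bar>(\<Sum>p | prime p \<and> real p \<le> x. h p) - r * ln (ln x)\<bar> \<le> R) \<longrightarrow>
     (\<forall>x\<ge>3. (\<Sum>p | prime p \<and> real p \<le> x. (1 - \<epsilon>1) powr (\<psi> p / At1) * h p)
        \<le> r * (1 - \<epsilon>1) * ln (ln x) + R1) \<longrightarrow>
     1 \<le> T \<longrightarrow> 0 \<le> z \<longrightarrow> 1 < M T \<longrightarrow>
     chi_sum A chi T (\<lambda>a. \<psi> (c a) \<le> z) \<le>
       L * (M T * exp (- (ln (1 + \<epsilon>1) / At1) * (r * At1 * (1 - \<epsilon>1) * ln (ln (M T)) - z)))"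
proof -
  define s where "s = - ln (1 - \<epsilon>1) / At1"
  have s: "0 < s" using At1 \<epsilon>1 by (simp add: s_def divide_neg_pos)
  obtain D where D: "\<forall>n\<ge>1. - \<psi> n \<le> D * real (bigomega n)"
    using \<psi>(2) by (auto simp: moderate_below_def)
  have neg: "additive_fun (\<lambda>n. - \<psi> n)" using \<psi>(1) by (simp add: additive_fun_def)
  have sub: "\<forall>\<epsilon>>0. \<exists>Ct. \<forall>n\<ge>1. - \<psi> n \<le> \<epsilon> * ln (real n) + Ct"
    using \<psi>(2) by (simp add: moderate_below_def)
  from sum_exp_additive_le[where 'a = 'a, OF pos exponents neg D sub s, of Bt E1 E2]
  obtain L M0 where L: "0 < L" "3 \<le> M0" and moment: "\<And>(A :: 'a set) chi (c :: 'a \<Rightarrow> nat) M h T.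
     admissible \<kappa> lam1 lam2 B K C \<theta> \<xi> \<alpha> Bt E1 E2 A chi c M h \<Longrightarrow> 1 \<le> T \<Longrightarrow> M0 \<le> M T \<Longrightarrow>
     (\<Sum>a | a \<in> A \<and> chi T a > 0. chi T a * exp (s * - \<psi> (c a))) \<le>
       L * (M T * exp (\<Sum>p\<in>primes_in 0 (M T). (exp (s * - \<psi> p) - 1) * h p))"
    by blast
  define l where "l = ln (1 + \<epsilon>1)"
  have l: "0 < l" using \<epsilon>1 by (simp add: l_def)
  \<comment> \<open>A bound for \<open>r * ln (ln M0)\<close> that does not involve
    \<open>r\<close>, which is quantified after \<open>L\<close>: the asymptotics of
    \<open>h\<close> at \<open>M0\<close>, combined with a crude bound for the sum of
    \<open>h\<close>.\<close>
  define S where "S = R + M0 * M0 powr lam2"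
  define E where "E = 1 + max E1 0 + max E2 0"
  define L' where "L' = L * exp (R1 + R) + E * (1 + exp (l * (1 - \<epsilon>1) * S))"
  have E: "0 < E" by (simp add: E_def add_pos_nonneg)
  have "chi_sum A chi T (\<lambda>a. \<psi> (c a) \<le> z) \<le>
       L' * (M T * exp (- (l / At1) * (r * At1 * (1 - \<epsilon>1) * ln (ln (M T)) - z)))"
    if adm: "admissible \<kappa> lam1 lam2 B K C \<theta> \<xi> \<alpha> Bt E1 E2 A chi c M h" and r: "0 < r"
      and hr: "\<forall>x\<ge>3. \<bar>(\<Sum>p | prime p \<and> real p \<le> x. h p) - r * ln (ln x)\<bar> \<le> R"
      and hR1: "\<forall>x\<ge>3. (\<Sum>p | prime p \<and> real p \<le> x. (1 - \<epsilon>1) powr (\<psi> p / At1) * h p)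
        \<le> r * (1 - \<epsilon>1) * ln (ln x) + R1"
      and T: "1 \<le> T" and z: "0 \<le> z" and M: "1 < M T"
    for A :: "'a set" and chi c M h r T z
  proof -
    have wf: "weight_family A chi" and h: "h \<in> density_functions \<kappa> lam1 lam2 B K"
      and h2: "\<forall>p e. prime p \<longrightarrow> 2 \<le> e \<longrightarrow> h (p ^ e) \<le> C / (real p)\<^sup>2" and c: "\<forall>a\<in>A. 0 < c a"
      and eq: "equidistributed E1 E2 \<theta> \<xi> \<kappa> lam1 lam2 B K A chi c M h"
      and cM: "\<forall>T\<ge>1. \<forall>a\<in>A. chi T a > 0 \<longrightarrow> real (c a) \<le> Bt * M T powr \<alpha>"
      using adm by (simp_all add: admissible_def)
    define y where "y = r * ln (ln (M T))"
    define t where "t = z / At1"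
    let ?q = "exp (l * (t - (1 - \<epsilon>1) * y))"
    let ?e = "M T * ?q"
    have target: "exp (- (l / At1) * (r * At1 * (1 - \<epsilon>1) * ln (ln (M T)) - z)) = ?q"
      using At1 by (simp add: t_def y_def field_simps)
    have total: "chi_sum A chi T (\<lambda>a. \<psi> (c a) \<le> z) \<le> E * M T"
      unfolding E_def by (rule chi_sum_le_total[OF wf T pos(4) eq])
    \<comment> \<open>In the first two ranges the target exponential is bounded below and the total
      mass suffices; only the third needs the moment.\<close>
    consider "M T < M0" | "M0 \<le> M T" "(1 - \<epsilon>1) * y \<le> t" | "M0 \<le> M T" "t \<le> (1 - \<epsilon>1) * y" by linarith
    then have "chi_sum A chi T (\<lambda>a. \<psi> (c a) \<le> z) \<le> L' * ?e"
    proof cases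
      case 1
      have "\<bar>(\<Sum>p | prime p \<and> real p \<le> M0. h p) - r * ln (ln M0)\<bar> \<le> R" using hr L by blast
      then have "r * ln (ln M0) \<le> R + (\<Sum>p\<in>primes_in 0 M0. h p)" unfolding primes_le_eq by linarith
      also have "\<dots> \<le> S" unfolding S_def using L sum_density_le[OF h pos(2,3), of M0] by simp
      finally have "r * ln (ln M0) \<le> S" .
      moreover have "ln (ln (M T)) \<le> ln (ln M0)" using 1 M by simp
      then have "y \<le> r * ln (ln M0)" using r unfolding y_def by (intro mult_left_mono) auto
      ultimately have "(1 - \<epsilon>1) * y \<le> (1 - \<epsilon>1) * S" using \<epsilon>1 by (intro mult_left_mono) auto
      moreover have "0 \<le> t" using z At1 by (simp add: t_def)
      ultimately have "- ((1 - \<epsilon>1) * S) \<le> t - (1 - \<epsilon>1) * y" by linarith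
      then have "l * - ((1 - \<epsilon>1) * S) \<le> l * (t - (1 - \<epsilon>1) * y)" using l by (intro mult_left_mono) auto
      then have e1: "1 \<le> exp (l * (1 - \<epsilon>1) * S) * ?q"
        by (simp add: mult.assoc flip: exp_add)
      have "chi_sum A chi T (\<lambda>a. \<psi> (c a) \<le> z) \<le> E * M T * (exp (l * (1 - \<epsilon>1) * S) * ?q)"
      proof -
        have "E * M T * 1 \<le> E * M T * (exp (l * (1 - \<epsilon>1) * S) * ?q)"
          using E M by (intro mult_left_mono[OF e1]) simp
        with total show ?thesis unfolding mult_1_right by (rule order_trans)
      qed
      also have "\<dots> = E * exp (l * (1 - \<epsilon>1) * S) * ?e" by simp
      also have "\<dots> \<le> L' * ?e"
        using L M E by (intro mult_right_mono) (auto simp: L'_def distrib_left)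
      finally show ?thesis .
    next
      case 2
      then have "1 \<le> ?q" using l by simp
      then have "E * M T * 1 \<le> E * M T * ?q" using E M by (intro mult_left_mono) auto
      also have "\<dots> = E * ?e" by simp
      also have "\<dots> \<le> L' * ?e"
        using L M E by (intro mult_right_mono) (auto simp: L'_def distrib_left)
      finally show ?thesis using total by simp
    next
      case 3
      have M3: "3 \<le> M T" using 3 L by simp
      have F: "exp (s * - \<psi> p) = (1 - \<epsilon>1) powr (\<psi> p / At1)" for p
        using \<epsilon>1 by (simp add: s_def powr_def)
      have "(\<Sum>p\<in>primes_in 0 (M T). (exp (s * - \<psi> p) - 1) * h p) =
          (\<Sum>p\<in>primes_in 0 (M T). (1 - \<epsilon>1) powr (\<psi> p / At1) * h p) - (\<Sum>p\<in>primes_in 0 (M T). h p)"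
        by (simp add: F left_diff_distrib sum_subtractf del: mult_minus_right)
      also have "\<dots> \<le> (r * (1 - \<epsilon>1) * ln (ln (M T)) + R1) - (r * ln (ln (M T)) - R)"
      proof (rule diff_mono)
        show "(\<Sum>p\<in>primes_in 0 (M T). (1 - \<epsilon>1) powr (\<psi> p / At1) * h p) \<le> r * (1 - \<epsilon>1) * ln (ln (M T)) + R1"
          using hR1 M3 unfolding primes_le_eq by blast
        have "\<bar>(\<Sum>p\<in>primes_in 0 (M T). h p) - r * ln (ln (M T))\<bar> \<le> R"
          using hr M3 unfolding primes_le_eq by blast
        then show "r * ln (ln (M T)) - R \<le> (\<Sum>p\<in>primes_in 0 (M T). h p)" by linarith
      qed
      also have "\<dots> = (R1 + R) - \<epsilon>1 * y" by (simp add: y_def algebra_simps)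
      finally have S: "(\<Sum>p\<in>primes_in 0 (M T). (exp (s * - \<psi> p) - 1) * h p) \<le> (R1 + R) - \<epsilon>1 * y" .
      \<comment> \<open>Both sides are linear in \<open>t\<close>, with slopes
        \<open>m \<ge> l\<close> because
        \<open>(1 - \<epsilon>1) * (1 + \<epsilon>1) \<le> 1\<close>. It is enough to compare them
        at the right end \<open>t = (1 - \<epsilon>1) * y\<close>, where
        \<open>(1 - \<epsilon>1) * m \<le> \<epsilon>1\<close> decides.\<close>
      have "s * z - \<epsilon>1 * y \<le> l * (t - (1 - \<epsilon>1) * y)"
      proof -
        define m where "m = - ln (1 - \<epsilon>1)"
        have y: "0 \<le> y"
        proof -
          have "exp 1 \<le> M T" using M3 exp_le by linarith
          then have "1 \<le> ln (M T)" using M by (simp add: ln_ge_iff)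
          then show ?thesis using r by (simp add: y_def)
        qed
        have "m + - l = - ln ((1 - \<epsilon>1) * (1 + \<epsilon>1))" using \<epsilon>1 by (simp add: m_def l_def ln_mult)
        moreover have "ln ((1 - \<epsilon>1) * (1 + \<epsilon>1)) \<le> ln 1"
        proof (subst ln_le_cancel_iff)
          have "(1 - \<epsilon>1) * (1 + \<epsilon>1) = 1 - \<epsilon>1 * \<epsilon>1" by (simp add: algebra_simps)
          then show "(1 - \<epsilon>1) * (1 + \<epsilon>1) \<le> 1" by simp
        qed (use \<epsilon>1 in simp_all)
        ultimately have ml: "0 \<le> m - l" by simp
        have "ln (inverse (1 - \<epsilon>1)) \<le> inverse (1 - \<epsilon>1) - 1" using \<epsilon>1 by (intro ln_le_minus_one) auto
        then have "m \<le> inverse (1 - \<epsilon>1) - 1" using \<epsilon>1 by (simp add: m_def ln_inverse)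
        also have "\<dots> = \<epsilon>1 / (1 - \<epsilon>1)" using \<epsilon>1 by (simp add: field_simps)
        finally have "m \<le> \<epsilon>1 / (1 - \<epsilon>1)" .
        then have m: "(1 - \<epsilon>1) * m \<le> \<epsilon>1" using \<epsilon>1 by (simp add: field_simps)
        have "(m - l) * t \<le> (m - l) * ((1 - \<epsilon>1) * y)" using 3 ml by (intro mult_left_mono)
        also have "\<dots> = ((1 - \<epsilon>1) * m) * y - l * ((1 - \<epsilon>1) * y)" by (simp add: algebra_simps)
        also have "((1 - \<epsilon>1) * m) * y \<le> \<epsilon>1 * y" using m y by (intro mult_right_mono)
        finally have "m * t - \<epsilon>1 * y \<le> l * (t - (1 - \<epsilon>1) * y)" by (simp add: algebra_simps)
        moreover have "s * z = m * t" by (simp add: s_def m_def t_def)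
        ultimately show ?thesis by simp
      qed
      then have e: "exp (s * z) * exp ((R1 + R) - \<epsilon>1 * y) \<le> exp (R1 + R) * ?q"
        by (simp flip: exp_add)
      have "chi_sum A chi T (\<lambda>a. \<psi> (c a) \<le> z) \<le>
          exp (- (s * - z)) * (\<Sum>a | a \<in> A \<and> chi T a > 0. chi T a * exp (s * - \<psi> (c a)))"
        using s by (intro chi_sum_le_exp_moment[OF wf T]) auto
      also have "\<dots> \<le> exp (s * z) * (L * (M T * exp ((R1 + R) - \<epsilon>1 * y)))"
      proof -
        have "L * (M T * exp (\<Sum>p\<in>primes_in 0 (M T). (exp (s * - \<psi> p) - 1) * h p)) \<le>
            L * (M T * exp ((R1 + R) - \<epsilon>1 * y))"
          using S L M by (intro mult_left_mono) auto
        then have "(\<Sum>a | a \<in> A \<and> chi T a > 0. chi T a * exp (s * - \<psi> (c a))) \<le>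
            L * (M T * exp ((R1 + R) - \<epsilon>1 * y))"
          using moment[OF adm T 3(1)] by linarith
        then show ?thesis by simp
      qed
      also have "\<dots> = L * M T * (exp (s * z) * exp ((R1 + R) - \<epsilon>1 * y))" by simp
      also have "\<dots> \<le> L * M T * (exp (R1 + R) * ?q)"
        using e L M by (intro mult_left_mono) auto
      also have "\<dots> = L * exp (R1 + R) * ?e" by simp
      also have "\<dots> \<le> L' * ?e"
        using L M E by (intro mult_right_mono) (auto simp: L'_def)
      finally show ?thesis .
    qed
    then show ?thesis unfolding target .
  qed
  moreover have "0 < L'" using L E by (simp add: L'_def add_pos_pos)
  ultimately show ?thesis unfolding l_def by blast
qed

theorem theorem3p2:
  fixes \<kappa> lam1 lam2 B K C \<theta> \<xi> \<alpha> Bt At At1 \<epsilon>1 \<epsilon>2 E1 E2 R R1 :: real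
    and \<psi> :: "nat \<Rightarrow> real"
  assumes "0 < \<kappa>" "0 < lam1" "0 < lam2" "0 < B" "0 < K" "0 < C"
    and "0 < \<theta>" "0 < \<xi>" "max \<theta> \<xi> < 1"
    and "0 < \<alpha>" "0 < Bt"
    and "additive_fun \<psi>"
    and "1 \<le> At" "\<forall>n\<ge>1. \<psi> n \<le> At * real (bigomega n)"
    and "\<forall>\<epsilon>>0. \<exists>Ct\<ge>0. \<forall>n\<ge>1. \<psi> n \<le> \<epsilon> * ln (real n) + Ct"
    and "0 < \<epsilon>1" "\<epsilon>1 < 1" "0 < \<epsilon>2"
    and "0 < At1"
  shows "\<exists>L>0. \<forall>(A :: 'a set) chi (c :: 'a \<Rightarrow> nat) M h r.
     weight_family A chi \<longrightarrow>
     0 < r \<longrightarrow>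
     h \<in> density_functions \<kappa> lam1 lam2 B K \<longrightarrow>
     (\<forall>x\<ge>3. \<bar>(\<Sum>p | prime p \<and> real p \<le> x. h p) - r * ln (ln x)\<bar> \<le> R) \<longrightarrow>
     (\<forall>p e. prime p \<longrightarrow> 2 \<le> e \<longrightarrow> h (p ^ e) \<le> C / (real p)\<^sup>2) \<longrightarrow>
     (\<forall>a\<in>A. 0 < c a) \<longrightarrow>
     equidistributed E1 E2 \<theta> \<xi> \<kappa> lam1 lam2 B K A chi c M h \<longrightarrow>
     (\<forall>T\<ge>1. \<forall>a\<in>A. chi T a > 0 \<longrightarrow> real (c a) \<le> Bt * M T powr \<alpha>) \<longrightarrow>
       (\<forall>T\<ge>1. \<forall>z2\<ge>1. 1 < M T \<longrightarrow> r * At * (1 + \<epsilon>2) * ln (ln (M T)) \<le> z2 \<longrightarrow>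
          chi_sum A chi T (\<lambda>a. z2 \<le> \<psi> (c a))
            \<le> L * (M T * exp (- (frak_c \<epsilon>2 / At) * z2)))
     \<and> (moderate_below \<psi> \<longrightarrow>
        (\<forall>x\<ge>3. (\<Sum>p | prime p \<and> real p \<le> x. (1 - \<epsilon>1) powr (\<psi> p / At1) * h p)
                  \<le> r * (1 - \<epsilon>1) * ln (ln x) + R1) \<longrightarrow>
        (\<forall>T\<ge>1. \<forall>z1\<ge>1. 1 < M T \<longrightarrow>
          chi_sum A chi T (\<lambda>a. \<psi> (c a) \<le> z1)
            \<le> L * (M T * exp (- (ln (1 + \<epsilon>1) / At1) *
                               (r * At1 * (1 - \<epsilon>1) * ln (ln (M T)) - z1)))))"
proof -
  have At: "0 < At" using \<open>1 \<le> At\<close> by simp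
  have sub: "\<forall>\<epsilon>>0. \<exists>Ct. \<forall>n\<ge>1. \<psi> n \<le> \<epsilon> * ln (real n) + Ct" using assms(15) by blast
  obtain L1 where L1: "0 < L1" and up: "\<And>(A :: 'a set) chi (c :: 'a \<Rightarrow> nat) M h r T z.
     admissible \<kappa> lam1 lam2 B K C \<theta> \<xi> \<alpha> Bt E1 E2 A chi c M h \<Longrightarrow>
     (\<forall>x\<ge>3. \<bar>(\<Sum>p | prime p \<and> real p \<le> x. h p) - r * ln (ln x)\<bar> \<le> R) \<Longrightarrow>
     1 \<le> T \<Longrightarrow> 1 < M T \<Longrightarrow> r * At * (1 + \<epsilon>2) * ln (ln (M T)) \<le> z \<Longrightarrow>
     chi_sum A chi T (\<lambda>a. z \<le> \<psi> (c a)) \<le> L1 * (M T * exp (- (frak_c \<epsilon>2 / At) * z))"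
    using upper_tail[where 'a = 'a, OF assms(1-9,10,12,14) sub At assms(18,11), of E1 E2 R] by blast
  obtain L2 where L2: "0 < L2" and low: "\<And>(A :: 'a set) chi (c :: 'a \<Rightarrow> nat) M h r T z.
     moderate_below \<psi> \<Longrightarrow> admissible \<kappa> lam1 lam2 B K C \<theta> \<xi> \<alpha> Bt E1 E2 A chi c M h \<Longrightarrow> 0 < r \<Longrightarrow>
     (\<forall>x\<ge>3. \<bar>(\<Sum>p | prime p \<and> real p \<le> x. h p) - r * ln (ln x)\<bar> \<le> R) \<Longrightarrow>
     (\<forall>x\<ge>3. (\<Sum>p | prime p \<and> real p \<le> x. (1 - \<epsilon>1) powr (\<psi> p / At1) * h p)
        \<le> r * (1 - \<epsilon>1) * ln (ln x) + R1) \<Longrightarrow>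
     1 \<le> T \<Longrightarrow> 0 \<le> z \<Longrightarrow> 1 < M T \<Longrightarrow>
     chi_sum A chi T (\<lambda>a. \<psi> (c a) \<le> z) \<le>
       L2 * (M T * exp (- (ln (1 + \<epsilon>1) / At1) * (r * At1 * (1 - \<epsilon>1) * ln (ln (M T)) - z)))"
  proof (cases "moderate_below \<psi>")
    case True
    from lower_tail[where 'a = 'a, OF assms(1-9,10,12) True assms(19,16,17), of Bt E1 E2 R R1] that show ?thesis by blast
  next
    \<comment> \<open>The claim has \<open>moderate_below \<psi>\<close> as a premise, so any
      positive constant serves.\<close>
    case False
    then show ?thesis using that[of 1] by simp
  qed
  have weaken: "S \<le> (L1 + L2) * (m * exp e)"
    if "S \<le> L1 * (m * exp e) \<or> S \<le> L2 * (m * exp e)" "1 < m" for S m e :: real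
  proof -
    have "0 \<le> L1 * (m * exp e)" "0 \<le> L2 * (m * exp e)" using L1 L2 that by auto
    then show ?thesis using that(1) by (auto simp: distrib_right)
  qed
  show ?thesis
  proof (intro exI[of _ "L1 + L2"] conjI allI impI)
    show "0 < L1 + L2" using L1 L2 by simp
  next
    fix A :: "'a set" and chi and c :: "'a \<Rightarrow> nat" and M h r T and z2 :: real
    assume hyps: "weight_family A chi" "h \<in> density_functions \<kappa> lam1 lam2 B K"
      "\<forall>p e. prime p \<longrightarrow> 2 \<le> e \<longrightarrow> h (p ^ e) \<le> C / (real p)\<^sup>2" "\<forall>a\<in>A. 0 < c a"
      "equidistributed E1 E2 \<theta> \<xi> \<kappa> lam1 lam2 B K A chi c M h"
      "\<forall>T\<ge>1. \<forall>a\<in>A. chi T a > 0 \<longrightarrow> real (c a) \<le> Bt * M T powr \<alpha>"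
      and "\<forall>x\<ge>3. \<bar>(\<Sum>p | prime p \<and> real p \<le> x. h p) - r * ln (ln x)\<bar> \<le> R"
      "1 \<le> T" "1 < M T" "r * At * (1 + \<epsilon>2) * ln (ln (M T)) \<le> z2"
    moreover have "admissible \<kappa> lam1 lam2 B K C \<theta> \<xi> \<alpha> Bt E1 E2 A chi c M h" using hyps by (simp add: admissible_def)
    ultimately show "chi_sum A chi T (\<lambda>a. z2 \<le> \<psi> (c a)) \<le> (L1 + L2) * (M T * exp (- (frak_c \<epsilon>2 / At) * z2))"
      by (intro weaken disjI1 up)
  next
    fix A :: "'a set" and chi and c :: "'a \<Rightarrow> nat" and M h r T and z1 :: real
    assume "moderate_below \<psi>" "0 < r" and hyps: "weight_family A chi" "h \<in> density_functions \<kappa> lam1 lam2 B K"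
      "\<forall>p e. prime p \<longrightarrow> 2 \<le> e \<longrightarrow> h (p ^ e) \<le> C / (real p)\<^sup>2" "\<forall>a\<in>A. 0 < c a"
      "equidistributed E1 E2 \<theta> \<xi> \<kappa> lam1 lam2 B K A chi c M h"
      "\<forall>T\<ge>1. \<forall>a\<in>A. chi T a > 0 \<longrightarrow> real (c a) \<le> Bt * M T powr \<alpha>"
      and "\<forall>x\<ge>3. \<bar>(\<Sum>p | prime p \<and> real p \<le> x. h p) - r * ln (ln x)\<bar> \<le> R"
      "\<forall>x\<ge>3. (\<Sum>p | prime p \<and> real p \<le> x. (1 - \<epsilon>1) powr (\<psi> p / At1) * h p)
        \<le> r * (1 - \<epsilon>1) * ln (ln x) + R1"
      "1 \<le> T" "1 < M T" and z: "1 \<le> z1"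
    moreover have "admissible \<kappa> lam1 lam2 B K C \<theta> \<xi> \<alpha> Bt E1 E2 A chi c M h" using hyps by (simp add: admissible_def)
    moreover have "0 \<le> z1" using z by simp
    ultimately show "chi_sum A chi T (\<lambda>a. \<psi> (c a) \<le> z1) \<le>
        (L1 + L2) * (M T * exp (- (ln (1 + \<epsilon>1) / At1) * (r * At1 * (1 - \<epsilon>1) * ln (ln (M T)) - z1)))"
      by (intro weaken disjI2 low)
  qed
qed

end
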